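(* Let $f_1,g_1$ be fixed spectral densities, $\varepsilon_1\in(0,1)$, $\varepsilon_2>0$, $P_1>0$, and $$D_{\varepsilon_1}=\Big\{f:\ f(\lambda)=(1-\varepsilon_1)f_1(\lambda)+\varepsilon_1w(\lambda),\ \tfrac1{2\pi}\int_{-\infty}^\infty f(\lambda)d\lambda\le P_1\Big\},$$ where $w$ ranges over all (unknown) spectral densities, and $$D_{\varepsilon_2}^1=\Big\{g:\tfrac1{2\pi}\int_{-\infty}^\infty|g(\lambda)-g_1(\lambda)|d\lambda\le\varepsilon_2\Big\}.$$ Let the spectral densities $f_0\in D_{\varepsilon_1}$, $g_0\in D_{\varepsilon_2}^1$ satisfy the minimality condition, let the operator $\mathbf{B}^0$ be invertible, and let the functions $$h_f(f_0,g_0)=\frac{|A(e^{i\lambda})g_0(\lambda)+C^0(e^{i\lambda})|^2}{(f_0(\lambda)+g_0(\lambda))^2},\qquad h_g(f_0,g_0)=\frac{|A(e^{i\lambda})f_0(\lambda)-C^0(e^{i\lambda})|^2}{(f_0(\lambda)+g_0(\lambda))^2}$$ be bounded. Suppose that $$|A(e^{i\lambda})g_0(\lambda)+C^0(e^{i\lambda})|=(f_0(\lambda)+g_0(\lambda))(\varphi(\lambda)+\alpha_1^{-1}),$$ $$|A(e^{i\lambda})f_0(\lambda)-C^0(e^{i\lambda})|=(f_0(\lambda)+g_0(\lambda))\Psi(\lambda)\alpha_2,$$ where $\alpha_1,\alpha_2$ are constants, $\varphi(\lambda)\le0$ and $\varphi(\lambda)=0$ when $f_0(\lambda)>(1-\varepsilon_1)f_1(\lambda)$,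 $|\Psi(\lambda)|\le1$ and $\Psi(\lambda)=\operatorname{sign}(g_0(\lambda)-g_1(\lambda))$ when $g_0(\lambda)\ne g_1(\lambda)$; and that $(f_0,g_0)$ determine a solution to the optimization problem $$\max_{(f,g)\in D_{\varepsilon_1}\times D_{\varepsilon_2}^1}\big(\langle\mathbf{R}\mathbf{a},\mathbf{B}^{-1}\mathbf{R}\mathbf{a}\rangle+\langle\mathbf{Q}\mathbf{a},\mathbf{a}\rangle\big)=\langle\mathbf{R}^0\mathbf{a},(\mathbf{B}^0)^{-1}\mathbf{R}^0\mathbf{a}\rangle+\langle\mathbf{Q}^0\mathbf{a},\mathbf{a}\rangle.$$ Then $f_0,g_0$ are the least favorable spectral densities in the class $D=D_{\varepsilon_1}\times D_{\varepsilon_2}^1$ for the optimal linear filtering of the functional $A\xi=\int_{R^s}a(t)\xi(-t)dt$, and the function $$h^0(e^{i\lambda})=A(e^{i\lambda})\frac{f_0(\lambda)}{f_0(\lambda)+g_0(\lambda)}-\frac{C^0(e^{i\lambda})}{f_0(\lambda)+g_0(\lambda)}$$ is the minimax-robust spectral characteristic of the optimal estimate of $A\xi$.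
   Context: Sets. Let $s\ge1$, $N_0=K_0=0$, $N_1,\dots,N_s,K_1,\dots,K_s>0$, $M_l=\sum_{k=0}^l(N_k+K_k)$, with the intervals $[M_l,M_l+N_l]$, $l=1,\dots,s$, pairwise disjoint. Put $S=\bigcup_{l=1}^s[-M_l-N_l,-M_l]$, $S^+=\bigcup_{l=1}^s[M_l,M_l+N_l]$, $R^s=[0,\infty)\setminus S^+$, $\mathbb{R}^-=(-\infty,0)$, $T=S\cup[0,\infty)$. In $L_2(T)$ the inner product is $\langle x,y\rangle=\int_T x(t)\overline{y(t)}\,dt$. Functional. $a:R^s\to\mathbb{C}$ satisfies $\int_{R^s}|a(t)|dt<\infty$, $\int_{R^s}t|a(t)|^2dt<\infty$; $\mathbf{a}$ is the function on $T$ equal to $a$ on $R^s$ and $0$ on $S\cup S^+$, taken to be an element of $L_2(T)$. $A(e^{i\lambda})=\int_{R^s}a(t)e^{-it\lambda}dt$ (notations such as $A(e^{i\lambda})$, $h(e^{i\lambda})$, $C^0(e^{i\lambda})$ simply denote functions of $\lambda\in\mathbb{R}$). $\xi,\eta$ are uncorrelated zero-mean stationary processes on $\mathbb{R}$ with spectral densities $f,g$ (nonnegative integrable functions on $\mathbb{R}$; covariance $\frac1{2\pi}\int e^{it\lambda}f(\lambda)d\lambda$, resp. with $g$); $A\xi$ is estimated from observations of $\xi(t)+\eta(t)$, $t\in\mathbb{R}^-\setminus S$. Minimality condition for $(f,g)$: there is a nontrivial function of exponential type $\gamma(\lambda)=\int_0^\infty\alpha(t)e^{it\lambda}dt$ with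 $\int_{-\infty}^\infty\frac{|\gamma(\lambda)|^2}{f(\lambda)+g(\lambda)}d\lambda<\infty$. Estimates. $L_2^s(f+g)$ is the closed linear subspace of $L_2((f+g)d\lambda)$ generated by $\{e^{it\lambda}:t\in\mathbb{R}^-\setminus S\}$. The estimate with spectral characteristic $h\in L_2^s(f+g)$ has mean-square error $\Delta(h;f,g)=\frac1{2\pi}\int|A-h|^2f\,d\lambda+\frac1{2\pi}\int|h|^2g\,d\lambda$. $h(f,g)$ denotes the minimizer of $\Delta(\cdot;f,g)$ over $L_2^s(f+g)$ (the spectral characteristic of the optimal estimate) and $\Delta(f,g)=\Delta(h(f,g);f,g)$. Operators in $L_2(T)$ attached to $(f,g)$, for $t\in T$: $(\mathbf{B}x)(t)=\frac1{2\pi}\int_T x(u)\int_{-\infty}^\infty e^{i\lambda(u-t)}\frac{1}{f+g}\,d\lambda\,du$, $(\mathbf{R}x)(t)=\frac1{2\pi}\int_T x(u)\int_{-\infty}^\infty e^{-i\lambda(u+t)}\frac{f}{f+g}\,d\lambda\,du$, $(\mathbf{Q}x)(t)=\frac1{2\pi}\int_T x(u)\int_{-\infty}^\infty e^{-i\lambda(u-t)}\frac{fg}{f+g}\,d\lambda\,du$. The kernels are understood in the sense of Fourier transforms. With $\hat x(\lambda)=\int_T x(u)e^{iu\lambda}du$: $\mathbf{R}x$ is the restriction to $T$ of $\frac1{2\pi}\int e^{-it\lambda}\hat x(-\lambda)\frac{f}{f+g}d\lambda$ ($L_2$-Fourier transform). $\mathbf{B}$ may be unbounded: let $\mathcal D=\{x\in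 L_2(T):\int|\hat x|^2/(f+g)\,d\lambda<\infty\}$; $\mathbf{B}x=y$ means $x\in\mathcal D$, $y\in L_2(T)$ and $\frac1{2\pi}\int\hat x\,\overline{\hat k}/(f+g)\,d\lambda=\langle y,k\rangle$ for all $k\in\mathcal D$. "Invertible" means that $\mathcal D$ is dense in $L_2(T)$ and $\mathbf{B}$ is a bijection from its domain onto $L_2(T)$. The expression $\langle\mathbf{R}\mathbf{a},\mathbf{B}^{-1}\mathbf{R}\mathbf{a}\rangle+\langle\mathbf{Q}\mathbf{a},\mathbf{a}\rangle$ is the value of the optimal error $\Delta(f,g)$; for pairs $(f,g)$ for which $\mathbf{B}$ is not invertible it is understood to mean $\Delta(f,g)$. $\mathbf{B}^0,\mathbf{R}^0,\mathbf{Q}^0$ are the operators attached to $(f_0,g_0)$, and $C^0(e^{i\lambda})=\int_T((\mathbf{B}^0)^{-1}\mathbf{R}^0\mathbf{a})(t)e^{it\lambda}dt$. Definitions. For a class $D=D_f\times D_g$ of pairs of spectral densities: $(f_0,g_0)\in D$ is least favorable in $D$ for the optimal linear filtering of $A\xi$ if $\Delta(f_0,g_0)=\max_{(f,g)\in D}\Delta(f,g)$. A spectral characteristic $h^0$ is minimax-robust if $h^0\in H_D=\bigcap_{(f,g)\in D}L_2^s(f+g)$ and $\min_{h\in H_D}\max_{(f,g)\in D}\Delta(h;f,g)=\max_{(f,g)\in D}\Delta(h^0;f,g)$ (max read as supremum where necessary). *)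

theory Defs
  imports "HOL-Analysis.Analysis"
begin

text \<open>
  Conventions.  All measure theory is with respect to Lebesgue measure on the real line, and
  elements of an \<open>L\<^sub>2\<close> space are represented by functions; identities between such
  elements are identities almost everywhere.  The frequency variable is written \<open>\<nu>\<close>, and
  \<open>cis (t * \<nu>)\<close> is \<open>e\<^bsup>it\<nu>\<^esup>\<close>.  The notation \<open>A(e\<^bsup>i\<nu>\<^esup>)\<close> just denotes a function of the
  real variable \<open>\<nu>\<close>.
\<close>

definition gap_M :: "(nat \<Rightarrow> real) \<Rightarrow> (nat \<Rightarrow> real) \<Rightarrow> nat \<Rightarrow> real" where
  "gap_M N K l = (\<Sum>k\<le>l. N k + K k)"

definition S_set :: "nat \<Rightarrow> (nat \<Rightarrow> real) \<Rightarrow> (nat \<Rightarrow> real) \<Rightarrow> real set" where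
  "S_set s N K = (\<Union>l\<in>{1..s}. {- gap_M N K l - N l .. - gap_M N K l})"

definition S_plus_set :: "nat \<Rightarrow> (nat \<Rightarrow> real) \<Rightarrow> (nat \<Rightarrow> real) \<Rightarrow> real set" where
  "S_plus_set s N K = (\<Union>l\<in>{1..s}. {gap_M N K l .. gap_M N K l + N l})"

definition R_set :: "nat \<Rightarrow> (nat \<Rightarrow> real) \<Rightarrow> (nat \<Rightarrow> real) \<Rightarrow> real set" where
  "R_set s N K = {0..} - S_plus_set s N K"

definition T_set :: "nat \<Rightarrow> (nat \<Rightarrow> real) \<Rightarrow> (nat \<Rightarrow> real) \<Rightarrow> real set" where
  "T_set s N K = S_set s N K \<union> {0..}"

definition obs_set :: "nat \<Rightarrow> (nat \<Rightarrow> real) \<Rightarrow> (nat \<Rightarrow> real) \<Rightarrow> real set" where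
  "obs_set s N K = {..<0} - S_set s N K"

definition gap_structure :: "nat \<Rightarrow> (nat \<Rightarrow> real) \<Rightarrow> (nat \<Rightarrow> real) \<Rightarrow> bool" where
  "gap_structure s N K \<longleftrightarrow>
     1 \<le> s \<and> N 0 = 0 \<and> K 0 = 0 \<and> (\<forall>l\<in>{1..s}. 0 < N l \<and> 0 < K l) \<and>
     disjoint_family_on (\<lambda>l. {gap_M N K l .. gap_M N K l + N l}) {1..s}"

definition L2 :: "'a measure \<Rightarrow> ('a \<Rightarrow> complex) set" where
  "L2 M = {x \<in> borel_measurable M. integrable M (\<lambda>t. (cmod (x t))\<^sup>2)}"

definition L2_inner :: "real set \<Rightarrow> (real \<Rightarrow> complex) \<Rightarrow> (real \<Rightarrow> complex) \<Rightarrow> complex" where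
  "L2_inner T x y = (LINT t|lebesgue_on T. x t * cnj (y t))"

text \<open>
  The Fourier transform \<open>\<integral> x(u) e\<^bsup>iu\<nu>\<^esup> du\<close> of a square integrable function: the limit in
  \<open>L\<^sub>2\<close> of the truncated integrals.
\<close>

definition L2_fourier :: "(real \<Rightarrow> complex) \<Rightarrow> real \<Rightarrow> complex" where
  "L2_fourier x = (SOME X. X \<in> L2 lebesgue \<and>
     (\<lambda>n::nat. \<integral>\<^sup>+ \<nu>. ennreal ((cmod (X \<nu> -
         (LINT u:{- real n..real n}|lebesgue. x u * cis (u * \<nu>))))\<^sup>2) \<partial>lebesgue)
       \<longlonglongrightarrow> 0)"

definition fourier_on :: "real set \<Rightarrow> (real \<Rightarrow> complex) \<Rightarrow> real \<Rightarrow> complex" where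
  "fourier_on T x = L2_fourier (\<lambda>u. if u \<in> T then x u else 0)"

definition spectral_density :: "(real \<Rightarrow> real) \<Rightarrow> bool" where
  "spectral_density f \<longleftrightarrow> (\<forall>\<nu>. 0 \<le> f \<nu>) \<and> integrable lebesgue f"

definition exponential_type :: "(complex \<Rightarrow> complex) \<Rightarrow> bool" where
  "exponential_type F \<longleftrightarrow> F holomorphic_on UNIV \<and>
     (\<exists>c \<tau>. \<forall>z. cmod (F z) \<le> c * exp (\<tau> * cmod z))"

text \<open>
  The quotient \<open>|\<gamma>|\<^sup>2 / (f + g)\<close> is taken in \<open>[0,\<infinity>]\<close>, so that it is infinite where
  \<open>f + g\<close> vanishes and \<open>\<gamma>\<close> does not.
\<close>

definition minimality :: "(real \<Rightarrow> real) \<Rightarrow> (real \<Rightarrow> real) \<Rightarrow> bool" where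
  "minimality f g \<longleftrightarrow>
     (\<exists>\<gamma> \<alpha>. exponential_type \<gamma> \<and>
        set_integrable lebesgue {0..} \<alpha> \<and>
        (\<forall>\<nu>::real. \<gamma> (of_real \<nu>) = (LINT t:{0..}|lebesgue. \<alpha> t * cis (t * \<nu>))) \<and>
        (\<exists>\<nu>::real. \<gamma> (of_real \<nu>) \<noteq> 0) \<and>
        (\<integral>\<^sup>+ \<nu>. ennreal ((cmod (\<gamma> (of_real \<nu>)))\<^sup>2) / ennreal (f \<nu> + g \<nu>) \<partial>lebesgue) < \<infinity>)"

text \<open>
  The functional \<open>A\<xi> = \<integral>\<^bsub>R\<^esub> a(t) \<xi>(-t) dt\<close> enters through its spectral representation
  \<open>A_fun\<close> and through the extension \<open>bold_a\<close> of \<open>a\<close> by zero.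
\<close>

definition A_fun :: "real set \<Rightarrow> (real \<Rightarrow> complex) \<Rightarrow> real \<Rightarrow> complex" where
  "A_fun R a \<nu> = (LINT t:R|lebesgue. a t * cis (- (t * \<nu>)))"

definition bold_a :: "real set \<Rightarrow> (real \<Rightarrow> complex) \<Rightarrow> real \<Rightarrow> complex" where
  "bold_a R a t = (if t \<in> R then a t else 0)"

definition exp_span :: "real set \<Rightarrow> (real \<Rightarrow> complex) set" where
  "exp_span U = {p. \<exists>F c. finite F \<and> F \<subseteq> U \<and> p = (\<lambda>\<nu>. \<Sum>t\<in>F. c t * cis (t * \<nu>))}"

definition spectral_measure :: "(real \<Rightarrow> real) \<Rightarrow> (real \<Rightarrow> real) \<Rightarrow> real measure" where
  "spectral_measure f g = density lebesgue (\<lambda>\<nu>. ennreal (f \<nu> + g \<nu>))"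

definition L2s :: "real set \<Rightarrow> (real \<Rightarrow> real) \<Rightarrow> (real \<Rightarrow> real) \<Rightarrow> (real \<Rightarrow> complex) set" where
  "L2s U f g = {h \<in> L2 (spectral_measure f g). \<forall>e>0. \<exists>p\<in>exp_span U.
     (LINT \<nu>|spectral_measure f g. (cmod (h \<nu> - p \<nu>))\<^sup>2) < e}"

definition mse ::
  "(real \<Rightarrow> complex) \<Rightarrow> (real \<Rightarrow> complex) \<Rightarrow> (real \<Rightarrow> real) \<Rightarrow> (real \<Rightarrow> real) \<Rightarrow> real" where
  "mse A h f g =
     1 / (2 * pi) * (LINT \<nu>|lebesgue. (cmod (A \<nu> - h \<nu>))\<^sup>2 * f \<nu>) +
     1 / (2 * pi) * (LINT \<nu>|lebesgue. (cmod (h \<nu>))\<^sup>2 * g \<nu>)"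

definition opt_char ::
  "real set \<Rightarrow> (real \<Rightarrow> complex) \<Rightarrow> (real \<Rightarrow> real) \<Rightarrow> (real \<Rightarrow> real) \<Rightarrow> real \<Rightarrow> complex" where
  "opt_char U A f g = arg_min_on (\<lambda>h. mse A h f g) (L2s U f g)"

definition opt_mse ::
  "real set \<Rightarrow> (real \<Rightarrow> complex) \<Rightarrow> (real \<Rightarrow> real) \<Rightarrow> (real \<Rightarrow> real) \<Rightarrow> real" where
  "opt_mse U A f g = mse A (opt_char U A f g) f g"

definition B_domain ::
  "real set \<Rightarrow> (real \<Rightarrow> real) \<Rightarrow> (real \<Rightarrow> real) \<Rightarrow> (real \<Rightarrow> complex) set" where
  "B_domain T f g = {x \<in> L2 (lebesgue_on T).
     (\<integral>\<^sup>+ \<nu>. ennreal ((cmod (fourier_on T x \<nu>))\<^sup>2) / ennreal (f \<nu> + g \<nu>) \<partial>lebesgue) < \<infinity>}"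

text \<open>
  \<open>B_rel T f g x y\<close> is \<open>B x = y\<close>.  The form domain consists of functions whose transform
  vanishes almost everywhere on the zero set of \<open>f + g\<close>, so the convention \<open>z / 0 = 0\<close>
  is harmless here.
\<close>

definition B_rel ::
  "real set \<Rightarrow> (real \<Rightarrow> real) \<Rightarrow> (real \<Rightarrow> real) \<Rightarrow> (real \<Rightarrow> complex) \<Rightarrow> (real \<Rightarrow> complex) \<Rightarrow> bool" where
  "B_rel T f g x y \<longleftrightarrow> x \<in> B_domain T f g \<and> y \<in> L2 (lebesgue_on T) \<and>
     (\<forall>k\<in>B_domain T f g.
        1 / (2 * pi) * (LINT \<nu>|lebesgue.
           fourier_on T x \<nu> * cnj (fourier_on T k \<nu>) / of_real (f \<nu> + g \<nu>))
        = L2_inner T y k)"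

definition B_invertible :: "real set \<Rightarrow> (real \<Rightarrow> real) \<Rightarrow> (real \<Rightarrow> real) \<Rightarrow> bool" where
  "B_invertible T f g \<longleftrightarrow>
     (\<forall>x\<in>L2 (lebesgue_on T). \<forall>e>0. \<exists>k\<in>B_domain T f g.
        (LINT t|lebesgue_on T. (cmod (x t - k t))\<^sup>2) < e) \<and>
     (\<forall>y\<in>L2 (lebesgue_on T). \<exists>x. B_rel T f g x y) \<and>
     (\<forall>x x' y. B_rel T f g x y \<longrightarrow> B_rel T f g x' y \<longrightarrow> (AE t in lebesgue_on T. x t = x' t))"

definition B_inv ::
  "real set \<Rightarrow> (real \<Rightarrow> real) \<Rightarrow> (real \<Rightarrow> real) \<Rightarrow> (real \<Rightarrow> complex) \<Rightarrow> real \<Rightarrow> complex" where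
  "B_inv T f g y = (SOME x. B_rel T f g x y)"

text \<open>The outer integral is \<open>\<integral> G(\<nu>) e\<^bsup>-it\<nu>\<^esup> d\<nu>\<close>, the transform evaluated at \<open>-t\<close>.\<close>

definition R_op ::
  "real set \<Rightarrow> (real \<Rightarrow> real) \<Rightarrow> (real \<Rightarrow> real) \<Rightarrow> (real \<Rightarrow> complex) \<Rightarrow> real \<Rightarrow> complex" where
  "R_op T f g x t = 1 / (2 * pi) *
     L2_fourier (\<lambda>\<nu>. fourier_on T x (- \<nu>) * of_real (f \<nu> / (f \<nu> + g \<nu>))) (- t)"

text \<open>
  Since \<open>fg / (f + g)\<close> is integrable, the kernel is an ordinary bounded function, and the
  integral converges absolutely for the integrable function \<open>bold_a\<close>.
\<close>

definition Q_op ::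
  "real set \<Rightarrow> (real \<Rightarrow> real) \<Rightarrow> (real \<Rightarrow> real) \<Rightarrow> (real \<Rightarrow> complex) \<Rightarrow> real \<Rightarrow> complex" where
  "Q_op T f g x t = 1 / (2 * pi) *
     (LINT u|lebesgue_on T. x u *
        (LINT \<nu>|lebesgue. cis (- (\<nu> * (u - t))) * of_real (f \<nu> * g \<nu> / (f \<nu> + g \<nu>))))"

definition C_fun ::
  "real set \<Rightarrow> (real \<Rightarrow> complex) \<Rightarrow> (real \<Rightarrow> real) \<Rightarrow> (real \<Rightarrow> real) \<Rightarrow> real \<Rightarrow> complex" where
  "C_fun T b f g = fourier_on T (B_inv T f g (R_op T f g b))"

text \<open>
  The expression \<open>\<langle>R b, B\<^sup>-\<^sup>1 R b\<rangle> + \<langle>Q b, b\<rangle>\<close>.  Its value is real (\<open>B\<^sup>-\<^sup>1\<close>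
  and \<open>Q\<close> being symmetric), so taking the real part loses nothing.
\<close>

definition error_expr ::
  "real set \<Rightarrow> (real \<Rightarrow> complex) \<Rightarrow> (real \<Rightarrow> real) \<Rightarrow> (real \<Rightarrow> real) \<Rightarrow> real" where
  "error_expr T b f g =
     Re (L2_inner T (R_op T f g b) (B_inv T f g (R_op T f g b)) + L2_inner T (Q_op T f g b) b)"

text \<open>
  For pairs whose operator \<open>B\<close> is not invertible the expression is understood to mean the
  optimal error itself.
\<close>

definition objective ::
  "real set \<Rightarrow> real set \<Rightarrow> (real \<Rightarrow> complex) \<Rightarrow> (real \<Rightarrow> complex) \<Rightarrow>
   (real \<Rightarrow> real) \<Rightarrow> (real \<Rightarrow> real) \<Rightarrow> real" where
  "objective T U A b f g =
     (if B_invertible T f g then error_expr T b f g else opt_mse U A f g)"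

definition least_favorable ::
  "real set \<Rightarrow> (real \<Rightarrow> complex) \<Rightarrow> ((real \<Rightarrow> real) \<times> (real \<Rightarrow> real)) set \<Rightarrow>
   (real \<Rightarrow> real) \<Rightarrow> (real \<Rightarrow> real) \<Rightarrow> bool" where
  "least_favorable U A D f0 g0 \<longleftrightarrow> (f0, g0) \<in> D \<and>
     (\<forall>(f, g)\<in>D. opt_mse U A f g \<le> opt_mse U A f0 g0)"

definition H_class ::
  "real set \<Rightarrow> ((real \<Rightarrow> real) \<times> (real \<Rightarrow> real)) set \<Rightarrow> (real \<Rightarrow> complex) set" where
  "H_class U D = (\<Inter>(f, g)\<in>D. L2s U f g)"

definition minimax_robust ::
  "real set \<Rightarrow> (real \<Rightarrow> complex) \<Rightarrow> ((real \<Rightarrow> real) \<times> (real \<Rightarrow> real)) set \<Rightarrow>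
   (real \<Rightarrow> complex) \<Rightarrow> bool" where
  "minimax_robust U A D h0 \<longleftrightarrow> h0 \<in> H_class U D \<and>
     (INF h\<in>H_class U D. SUP (f, g)\<in>D. ereal (mse A h f g)) =
     (SUP (f, g)\<in>D. ereal (mse A h0 f g))"

definition D_contam :: "real \<Rightarrow> (real \<Rightarrow> real) \<Rightarrow> real \<Rightarrow> (real \<Rightarrow> real) set" where
  "D_contam e1 f1 P1 = {f. (\<exists>w. spectral_density w \<and> (\<forall>\<nu>. f \<nu> = (1 - e1) * f1 \<nu> + e1 * w \<nu>)) \<and>
     1 / (2 * pi) * (LINT \<nu>|lebesgue. f \<nu>) \<le> P1}"

definition D_L1_ball :: "real \<Rightarrow> (real \<Rightarrow> real) \<Rightarrow> (real \<Rightarrow> real) set" where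
  "D_L1_ball e2 g1 = {g. spectral_density g \<and>
     1 / (2 * pi) * (LINT \<nu>|lebesgue. \<bar>g \<nu> - g1 \<nu>\<bar>) \<le> e2}"

end

(*
  Everything follows from the optimality of (f0, g0) on the convex set D together with two facts on
  a pair (f, g) for which B is invertible.  First, by uniform boundedness the form of B is coercive;
  tested on gamma times trigonometric polynomials, with gamma from the minimality condition, this
  bounds f + g almost everywhere.  Second, an element of L2(f+g) orthogonal to the observed exponentials,
  multiplied by f + g, is then square integrable, hence the Fourier transform of an element of the
  form domain of B.  So h0 = A f/(f+g) - C/(f+g) is the projection that defines the optimal estimate,
  and the expression <R a, B^{-1} R a> + <Q a, a> is its error.

  For (f, g) in D let h_t be the optimal characteristic for (1-t)(f0, g0) + t(f, g) and V = Delta(f0, g0).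
  Optimality gives (1-t) |h_t - h0|^2 / (2 pi) + t Delta(h_t; f, g) <= t V, the norm being that of
  L2(f0+g0).  As t tends to 0, h_t tends to h0 almost everywhere along a subsequence and stays bounded in
  L2(f+g), so h0 lies in L2^s(f+g) and Delta(h0; f, g) <= V by Fatou's lemma: a saddle point.
*)
theory Submission
  imports Defs "HOL-Complex_Analysis.Conformal_Mappings"
begin

section \<open>Square integrable functions\<close>

text \<open>The obstacle is that \<open>h0\<close> is built from \<open>f0\<close> and
  \<open>g0\<close> alone: for another pair of the class neither a finite norm in L2(f+g) nor
  membership in L2^s(f+g) is given, so \<open>h0\<close> cannot be inserted into the inequality
  directly. The mixture bridges the two spaces. Its total density dominates (1-t)(f0+g0) and t(f+g),
  so h_t lies in both spans; it also inherits the minimality condition, so the objective there is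
  the optimal error whether or not B is invertible. For a fixed characteristic the error is affine
  in the pair, while leaving \<open>h0\<close> costs a squared distance at (f0, g0); hence that
  distance is O(t). Minimality makes f0+g0 positive almost everywhere, so a limit found in L2(f0+g0)
  is one for Lebesgue measure and therefore for the weight f+g. In L2(f+g) the convergence obtained
  is only weak, which suffices because a closed subspace is determined by its annihilator. On the
  operator side the bound on f+g is the crux: L2(T) asks for square integrability, whereas k(f+g)
  with k in L2(f+g) is a priori only integrable.\<close>

definition L2_ip :: "'a measure \<Rightarrow> ('a \<Rightarrow> complex) \<Rightarrow> ('a \<Rightarrow> complex) \<Rightarrow> complex" where
  "L2_ip M x y = (LINT t|M. x t * cnj (y t))"

definition L2_sq :: "'a measure \<Rightarrow> ('a \<Rightarrow> complex) \<Rightarrow> real" where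
  "L2_sq M x = (LINT t|M. (cmod (x t))\<^sup>2)"

lemma L2_measurable [measurable_dest]: "x \<in> L2 M \<Longrightarrow> x \<in> borel_measurable M"
  by (simp add: L2_def)

lemma L2_integrable: "x \<in> L2 M \<Longrightarrow> integrable M (\<lambda>t. (cmod (x t))\<^sup>2)"
  by (simp add: L2_def)

lemma L2I_bound:
  fixes x :: "'a \<Rightarrow> complex" and w :: "'a \<Rightarrow> real"
  assumes "x \<in> borel_measurable M" "integrable M w" "AE t in M. (cmod (x t))\<^sup>2 \<le> w t"
  shows "x \<in> L2 M"
  unfolding L2_def
proof (intro CollectI conjI)
  show "integrable M (\<lambda>t. (cmod (x t))\<^sup>2)"
    by (rule Bochner_Integration.integrable_bound[OF assms(2)])
      (use assms in \<open>auto elim: eventually_mono\<close>)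
qed (use assms in auto)

lemma cmod_mult_le_sq: "2 * cmod (x * y) \<le> (cmod x)\<^sup>2 + (cmod y)\<^sup>2"
  using sum_squares_bound[of "cmod x" "cmod y"] by (simp add: norm_mult)

lemma L2_mult_integrable:
  assumes "x \<in> L2 M" "y \<in> L2 M"
  shows "integrable M (\<lambda>t. x t * y t)"
proof (rule Bochner_Integration.integrable_bound)
  show "integrable M (\<lambda>t. (cmod (x t))\<^sup>2 + (cmod (y t))\<^sup>2)"
    using assms by (simp add: L2_integrable)
  show "AE t in M. norm (x t * y t) \<le> norm ((cmod (x t))\<^sup>2 + (cmod (y t))\<^sup>2)"
  proof (rule AE_I2)
    fix t
    show "norm (x t * y t) \<le> norm ((cmod (x t))\<^sup>2 + (cmod (y t))\<^sup>2)"
      using cmod_mult_le_sq[of "x t" "y t"] norm_ge_zero[of "x t * y t"]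
      unfolding real_norm_def by linarith
  qed
qed (use assms in measurable)

lemma borel_measurable_cnj [measurable]:
  "f \<in> borel_measurable M \<Longrightarrow> (\<lambda>x. cnj (f x)) \<in> borel_measurable M"
  by (rule measurable_compose[OF _ borel_measurable_continuous_onI[OF continuous_on_cnj[OF continuous_on_id]]])

lemma L2_cnj: "x \<in> L2 M \<Longrightarrow> (\<lambda>t. cnj (x t)) \<in> L2 M"
  unfolding L2_def by auto

lemma L2_ip_integrable:
  assumes "x \<in> L2 M" "y \<in> L2 M"
  shows "integrable M (\<lambda>t. x t * cnj (y t))"
  by (rule L2_mult_integrable[OF assms(1) L2_cnj[OF assms(2)]])

lemma L2_scale: "x \<in> L2 M \<Longrightarrow> (\<lambda>t. c * x t) \<in> L2 M"
  unfolding L2_def by (auto simp: norm_mult power_mult_distrib)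

lemma L2_zero: "(\<lambda>t. 0) \<in> L2 M"
  by (simp add: L2_def)

lemma cmod_add_sq:
  "(cmod (x + y))\<^sup>2 = (cmod x)\<^sup>2 + (cmod y)\<^sup>2 + 2 * Re (x * cnj y)"
  unfolding cmod_power2 by (simp add: power2_eq_square algebra_simps)

lemma L2_add:
  assumes "x \<in> L2 M" "y \<in> L2 M"
  shows "(\<lambda>t. x t + y t) \<in> L2 M"
proof (rule L2I_bound)
  show "integrable M (\<lambda>t. 2 * (cmod (x t))\<^sup>2 + 2 * (cmod (y t))\<^sup>2)"
    using assms by (simp add: L2_integrable)
  have "(cmod (x t + y t))\<^sup>2 \<le> 2 * (cmod (x t))\<^sup>2 + 2 * (cmod (y t))\<^sup>2" for t
  proof -
    have "2 * Re (x t * cnj (y t)) \<le> (cmod (x t))\<^sup>2 + (cmod (y t))\<^sup>2"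
      using cmod_mult_le_sq[of "x t" "cnj (y t)"] complex_Re_le_cmod[of "x t * cnj (y t)"] by simp
    then show ?thesis by (simp add: cmod_add_sq)
  qed
  then show "AE t in M. (cmod (x t + y t))\<^sup>2 \<le> 2 * (cmod (x t))\<^sup>2 + 2 * (cmod (y t))\<^sup>2" by simp
qed (use assms in measurable)

lemma L2_diff:
  assumes "x \<in> L2 M" "y \<in> L2 M"
  shows "(\<lambda>t. x t - y t) \<in> L2 M"
  using L2_add[OF assms(1) L2_scale[OF assms(2), of "-1"]] by simp

lemma L2_sum: "(\<And>i. i \<in> F \<Longrightarrow> x i \<in> L2 M) \<Longrightarrow> (\<lambda>t. \<Sum>i\<in>F. x i t) \<in> L2 M"
  by (induction F rule: infinite_finite_induct) (auto intro: L2_add L2_zero)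

lemma L2_bounded_mult:
  assumes "x \<in> L2 M" "m \<in> borel_measurable M" "AE t in M. cmod (m t) \<le> c"
  shows "(\<lambda>t. m t * x t) \<in> L2 M"
proof (rule L2I_bound)
  show "integrable M (\<lambda>t. c\<^sup>2 * (cmod (x t))\<^sup>2)"
    using assms by (simp add: L2_integrable)
  show "AE t in M. (cmod (m t * x t))\<^sup>2 \<le> c\<^sup>2 * (cmod (x t))\<^sup>2"
    using assms(3)
  proof eventually_elim
    case (elim t)
    then have "(cmod (m t))\<^sup>2 \<le> c\<^sup>2" by (intro power_mono) auto
    then show ?case by (auto simp: norm_mult power_mult_distrib intro!: mult_right_mono)
  qed
qed (use assms in measurable)

lemma L2_sq_nonneg [simp]: "0 \<le> L2_sq M x"
  by (simp add: L2_sq_def)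

lemma L2_ip_self: "L2_ip M x x = of_real (L2_sq M x)"
  unfolding L2_ip_def L2_sq_def integral_complex_of_real[symmetric] complex_norm_square ..

lemma L2_ip_commute: "L2_ip M x y = cnj (L2_ip M y x)"
proof -
  have "cnj (L2_ip M y x) = (LINT t|M. cnj (y t * cnj (x t)))"
    unfolding L2_ip_def by (rule Bochner_Integration.integral_cnj[symmetric])
  then show ?thesis unfolding L2_ip_def by (simp add: mult.commute)
qed

lemma L2_ip_add_left:
  assumes "x \<in> L2 M" "y \<in> L2 M" "z \<in> L2 M"
  shows "L2_ip M (\<lambda>t. x t + y t) z = L2_ip M x z + L2_ip M y z"
  using assms by (simp add: L2_ip_def distrib_right L2_ip_integrable)

lemma L2_ip_diff_left:
  assumes "x \<in> L2 M" "y \<in> L2 M" "z \<in> L2 M"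
  shows "L2_ip M (\<lambda>t. x t - y t) z = L2_ip M x z - L2_ip M y z"
  using assms by (simp add: L2_ip_def left_diff_distrib L2_ip_integrable)

lemma L2_ip_scale_left: "L2_ip M (\<lambda>t. c * x t) z = c * L2_ip M x z"
  by (simp add: L2_ip_def mult.assoc)

lemma L2_ip_add_right:
  assumes "x \<in> L2 M" "y \<in> L2 M" "z \<in> L2 M"
  shows "L2_ip M z (\<lambda>t. x t + y t) = L2_ip M z x + L2_ip M z y"
  using assms by (simp add: L2_ip_def distrib_left L2_ip_integrable)

lemma L2_ip_diff_right:
  assumes "x \<in> L2 M" "y \<in> L2 M" "z \<in> L2 M"
  shows "L2_ip M z (\<lambda>t. x t - y t) = L2_ip M z x - L2_ip M z y"
  using assms by (simp add: L2_ip_def right_diff_distrib L2_ip_integrable)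

lemma L2_ip_scale_right: "L2_ip M z (\<lambda>t. c * x t) = cnj c * L2_ip M z x"
  by (simp add: L2_ip_def mult.left_commute)

lemma L2_sq_add:
  assumes "x \<in> L2 M" "y \<in> L2 M"
  shows "L2_sq M (\<lambda>t. x t + y t) = L2_sq M x + L2_sq M y + 2 * Re (L2_ip M x y)"
proof -
  have i: "integrable M (\<lambda>t. x t * cnj (y t))" using assms by (rule L2_ip_integrable)
  then have iR: "integrable M (\<lambda>t. 2 * Re (x t * cnj (y t)))"
    by (intro integrable_mult_right integrable_Re)
  have "L2_sq M (\<lambda>t. x t + y t)
      = L2_sq M x + L2_sq M y + (LINT t|M. 2 * Re (x t * cnj (y t)))"
    unfolding L2_sq_def cmod_add_sq
    by (simp only: Bochner_Integration.integral_add[OF _ iR] Bochner_Integration.integral_add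
        Bochner_Integration.integrable_add L2_integrable[OF assms(1)] L2_integrable[OF assms(2)])
  also have "(LINT t|M. 2 * Re (x t * cnj (y t))) = 2 * Re (L2_ip M x y)"
    unfolding L2_ip_def integral_Re[OF i, symmetric] by (rule integral_mult_right_zero)
  finally show ?thesis .
qed

lemma L2_sq_scale: "L2_sq M (\<lambda>t. c * x t) = (cmod c)\<^sup>2 * L2_sq M x"
  by (simp add: L2_sq_def norm_mult power_mult_distrib)

lemma L2_sq_diff:
  assumes "x \<in> L2 M" "y \<in> L2 M"
  shows "L2_sq M (\<lambda>t. x t - y t) = L2_sq M x + L2_sq M y - 2 * Re (L2_ip M x y)"
  using L2_sq_add[OF assms(1) L2_scale[OF assms(2), of "-1"]] L2_sq_scale[of M "-1" y]
  by (simp add: L2_ip_def)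

lemma L2_sq_minus_commute: "L2_sq M (\<lambda>t. x t - y t) = L2_sq M (\<lambda>t. y t - x t)"
  by (simp add: L2_sq_def norm_minus_commute)

text \<open>Discriminant argument: the unimodular \<open>u\<close> rotates the inner product to the
  nonnegative real \<open>I\<close>, and expanding the squared norm of \<open>s * u * x - y\<close>
  gives a quadratic inequality in the real parameter \<open>s\<close>.\<close>

lemma L2_Cauchy_Schwarz:
  assumes x: "x \<in> L2 M" and y: "y \<in> L2 M"
  shows "cmod (L2_ip M x y) \<le> sqrt (L2_sq M x) * sqrt (L2_sq M y)"
proof -
  define a b I where "a = L2_sq M x" and "b = L2_sq M y" and "I = cmod (L2_ip M x y)"
  obtain u where u: "cmod u = 1" "u * L2_ip M x y = of_real I"
  proof (cases "L2_ip M x y = 0")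
    case True then show ?thesis using that[of 1] by (simp add: I_def)
  next
    case False
    then show ?thesis
      using that[of "of_real I / L2_ip M x y"] by (simp add: I_def norm_divide)
  qed
  have key: "2 * I * s \<le> s\<^sup>2 * a + b" for s :: real
  proof -
    have "0 \<le> L2_sq M (\<lambda>t. (of_real s * u) * x t - y t)" by simp
    also have "\<dots> = s\<^sup>2 * a + b - 2 * (s * I)"
      using u(2) by (subst L2_sq_diff[OF L2_scale[OF x] y])
        (simp add: L2_ip_scale_left L2_sq_scale norm_mult u a_def b_def mult.assoc)
    finally show ?thesis by (simp add: mult_ac)
  qed
  have ab: "0 \<le> a" "0 \<le> b" "0 \<le> I" by (auto simp: a_def b_def I_def)
  have "I\<^sup>2 \<le> a * b"
  proof (cases "a = 0")
    case True
    have "I = 0"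
    proof (rule ccontr)
      assume "I \<noteq> 0"
      \<comment> \<open>With \<open>a = 0\<close> the inequality is linear in \<open>s\<close>; this
        value turns it into \<open>b + 1 \<le> b\<close>.\<close>
      then show False using key[of "(b + 1) / (2 * I)"] True ab by (simp add: field_simps)
    qed
    then show ?thesis using ab by simp
  next
    case False
    then show ?thesis using key[of "I / a"] ab by (simp add: field_simps power2_eq_square)
  qed
  then have "I \<le> sqrt (a * b)" by (rule real_le_rsqrt)
  then show ?thesis by (simp add: I_def a_def b_def real_sqrt_mult)
qed

lemma L2_minkowski:
  assumes "x \<in> L2 M" "y \<in> L2 M"
  shows "sqrt (L2_sq M (\<lambda>t. x t + y t)) \<le> sqrt (L2_sq M x) + sqrt (L2_sq M y)"
proof (rule real_le_lsqrt)
  have "2 * Re (L2_ip M x y) \<le> 2 * (sqrt (L2_sq M x) * sqrt (L2_sq M y))"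
    using complex_Re_le_cmod[of "L2_ip M x y"] L2_Cauchy_Schwarz[OF assms] by linarith
  then show "L2_sq M (\<lambda>t. x t + y t) \<le> (sqrt (L2_sq M x) + sqrt (L2_sq M y))\<^sup>2"
    by (simp add: L2_sq_add[OF assms] power2_sum)
qed simp_all

lemma L2_minkowski_diff:
  assumes "x \<in> L2 M" "y \<in> L2 M"
  shows "sqrt (L2_sq M (\<lambda>t. x t - y t)) \<le> sqrt (L2_sq M x) + sqrt (L2_sq M y)"
  using L2_minkowski[OF assms(1) L2_scale[OF assms(2), of "-1"]] L2_sq_scale[of M "-1" y] by simp

lemma L2_sq_eq_0_iff:
  assumes "x \<in> L2 M"
  shows "L2_sq M x = 0 \<longleftrightarrow> (AE t in M. x t = 0)"
  unfolding L2_sq_def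
  by (subst integral_nonneg_eq_0_iff_AE) (use assms in \<open>auto simp: L2_integrable\<close>)

lemma L2_cong_AE:
  assumes "x \<in> L2 M" "y \<in> borel_measurable M" "AE t in M. x t = y t"
  shows "y \<in> L2 M"
  by (rule L2I_bound[OF assms(2) L2_integrable[OF assms(1)]])
    (use assms(3) in \<open>auto elim: eventually_mono\<close>)

section \<open>Fatou's lemma and completeness of L2\<close>

lemma nn_integral_eq_L2_sq:
  assumes "x \<in> L2 M"
  shows "(\<integral>\<^sup>+t. ennreal ((cmod (x t))\<^sup>2) \<partial>M) = ennreal (L2_sq M x)"
  unfolding L2_sq_def by (rule nn_integral_eq_integral) (use assms in \<open>auto simp: L2_integrable\<close>)

lemma L2I_nn_integral:
  assumes "x \<in> borel_measurable M" "(\<integral>\<^sup>+t. ennreal ((cmod (x t))\<^sup>2) \<partial>M) < \<infinity>"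
  shows "x \<in> L2 M"
  unfolding L2_def using assms by (auto intro!: integrableI_bounded)

text \<open>Lower semicontinuity of the norm along almost everywhere limits. That the limit lies in
  \<open>L2 M\<close> is a conclusion, not an assumption; this is what later gives \<open>h0\<close>
  a finite norm in the space of another pair.\<close>

lemma L2_Fatou:
  assumes x: "\<And>n. x n \<in> L2 M" and y[measurable]: "y \<in> borel_measurable M"
    and lim: "AE t in M. (\<lambda>n. x n t) \<longlonglongrightarrow> y t"
    and bound: "eventually (\<lambda>n. L2_sq M (x n) \<le> c) sequentially"
  shows "y \<in> L2 M" "L2_sq M y \<le> c"
proof -
  have [measurable]: "x n \<in> borel_measurable M" for n using x by measurable
  have "(\<integral>\<^sup>+t. ennreal ((cmod (y t))\<^sup>2) \<partial>M)
      = (\<integral>\<^sup>+t. liminf (\<lambda>n. ennreal ((cmod (x n t))\<^sup>2)) \<partial>M)"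
  proof (rule nn_integral_cong_AE)
    show "AE t in M. ennreal ((cmod (y t))\<^sup>2) = liminf (\<lambda>n. ennreal ((cmod (x n t))\<^sup>2))"
      using lim
    proof eventually_elim
      case (elim t)
      then have "(\<lambda>n. ennreal ((cmod (x n t))\<^sup>2)) \<longlonglongrightarrow> ennreal ((cmod (y t))\<^sup>2)"
        by (intro tendsto_intros)
      then show ?case by (intro lim_imp_Liminf[symmetric]) auto
    qed
  qed
  also have "\<dots> \<le> liminf (\<lambda>n. \<integral>\<^sup>+t. ennreal ((cmod (x n t))\<^sup>2) \<partial>M)"
    by (rule nn_integral_liminf) measurable
  also have "\<dots> \<le> limsup (\<lambda>n. \<integral>\<^sup>+t. ennreal ((cmod (x n t))\<^sup>2) \<partial>M)"
    by (rule Liminf_le_Limsup) simp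
  also have "\<dots> \<le> ennreal c"
    by (rule Limsup_bounded)
      (use bound x in \<open>auto elim!: eventually_mono simp: nn_integral_eq_L2_sq ennreal_leI\<close>)
  finally have le: "(\<integral>\<^sup>+t. ennreal ((cmod (y t))\<^sup>2) \<partial>M) \<le> ennreal c" .
  show "y \<in> L2 M"
    by (rule L2I_nn_integral[OF y]) (use le in \<open>auto intro: le_less_trans\<close>)
  from le nn_integral_eq_L2_sq[OF this] have "ennreal (L2_sq M y) \<le> ennreal c" by simp
  moreover obtain n where "L2_sq M (x n) \<le> c"
    using bound by (auto simp: eventually_sequentially)
  then have "0 \<le> c" using L2_sq_nonneg[of M "x n"] by linarith
  ultimately show "L2_sq M y \<le> c" by simp
qed

text \<open>Weighted by \<open>2 ^ n\<close>, the squared increments still have summable integrals,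
  since \<open>2 ^ n * (1/4) ^ n = (1/2) ^ n\<close>. Where the weighted series is finite the
  increments are O(2^(-n/2)), hence summable. Working with squares avoids any passage to L1, which
  an infinite measure would not allow.\<close>

lemma L2_fast_Cauchy_AE_convergent:
  assumes x: "\<And>n. x n \<in> L2 M"
    and fast: "\<And>n. L2_sq M (\<lambda>t. x (Suc n) t - x n t) \<le> (1/4) ^ n"
  shows "AE t in M. convergent (\<lambda>n. x n t)"
proof -
  define d where "d n t = x (Suc n) t - x n t" for n t
  have d: "d n \<in> L2 M" for n unfolding d_def by (rule L2_diff[OF x x])
  have [measurable]: "d n \<in> borel_measurable M" for n using d by measurable
  have "(\<integral>\<^sup>+t. (\<Sum>n. ennreal (2 ^ n * (cmod (d n t))\<^sup>2)) \<partial>M)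
      = (\<Sum>n. \<integral>\<^sup>+t. ennreal (2 ^ n * (cmod (d n t))\<^sup>2) \<partial>M)"
    by (rule nn_integral_suminf) measurable
  also have "\<dots> \<le> (\<Sum>n. ennreal ((1/2) ^ n))"
  proof (rule suminf_le)
    fix n
    have "(\<integral>\<^sup>+t. ennreal (2 ^ n * (cmod (d n t))\<^sup>2) \<partial>M)
        = ennreal (2 ^ n) * (\<integral>\<^sup>+t. ennreal ((cmod (d n t))\<^sup>2) \<partial>M)"
      by (subst nn_integral_cmult[symmetric]) (auto simp: ennreal_mult)
    also have "\<dots> = ennreal (2 ^ n * L2_sq M (d n))"
      by (simp add: nn_integral_eq_L2_sq[OF d] ennreal_mult)
    also have "\<dots> \<le> ennreal ((1/2) ^ n)"
    proof (rule ennreal_leI)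
      have "2 ^ n * L2_sq M (d n) \<le> 2 ^ n * (1/4) ^ n"
        using fast[of n] by (simp add: d_def[abs_def])
      also have "\<dots> = (1/2::real) ^ n" by (simp flip: power_mult_distrib)
      finally show "2 ^ n * L2_sq M (d n) \<le> (1/2) ^ n" .
    qed
    finally show "(\<integral>\<^sup>+t. ennreal (2 ^ n * (cmod (d n t))\<^sup>2) \<partial>M) \<le> ennreal ((1/2) ^ n)" .
  qed auto
  also have "\<dots> < \<infinity>"
    by (subst suminf_ennreal2) (auto simp: summable_geometric)
  finally have "AE t in M. (\<Sum>n. ennreal (2 ^ n * (cmod (d n t))\<^sup>2)) \<noteq> \<infinity>"
    by (intro nn_integral_noteq_infinite) auto
  then show ?thesis
  proof eventually_elim
    case (elim t)
    have s: "summable (\<lambda>n. 2 ^ n * (cmod (d n t))\<^sup>2)"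
      by (rule summable_suminf_not_top) (use elim in auto)
    then obtain C where C: "\<And>n. 2 ^ n * (cmod (d n t))\<^sup>2 \<le> C"
      using summable_LIMSEQ_zero[OF s] convergent_imp_Bseq[of "\<lambda>n. 2 ^ n * (cmod (d n t))\<^sup>2"]
      by (auto simp: convergent_def Bseq_def abs_mult)
    have "0 \<le> C" using order_trans[OF zero_le_power2 C[of 0, simplified]] .
    have "summable (\<lambda>n. sqrt C * sqrt (1/2) ^ n)"
      by (intro summable_mult summable_geometric) (simp add: real_sqrt_divide)
    then have "summable (\<lambda>n. d n t)"
    proof (rule summable_comparison_test')
      fix n
      have "(cmod (d n t))\<^sup>2 \<le> C * (1/2) ^ n" using C[of n] by (simp add: field_simps)
      then have "cmod (d n t) \<le> sqrt (C * (1/2) ^ n)" by (rule real_le_rsqrt)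
      then show "norm (d n t) \<le> sqrt C * sqrt (1/2) ^ n"
        by (simp add: real_sqrt_mult real_sqrt_power)
    qed
    then have "convergent (\<lambda>n. \<Sum>i<n. d i t)" by (simp add: summable_iff_convergent)
    moreover have "(\<Sum>i<n. d i t) = x n t - x 0 t" for n
      unfolding d_def by (rule sum_lessThan_telescope)
    ultimately have "convergent (\<lambda>n. x n t - x 0 t)" by simp
    then have "convergent (\<lambda>n. (x n t - x 0 t) + x 0 t)" by (intro convergent_add convergent_const)
    then show ?case by simp
  qed
qed

theorem L2_complete:
  assumes x: "\<And>n. x n \<in> L2 M"
    and cauchy: "\<And>e. 0 < e \<Longrightarrow> \<exists>N. \<forall>m\<ge>N. \<forall>n\<ge>N. L2_sq M (\<lambda>t. x m t - x n t) \<le> e"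
  obtains y where "y \<in> L2 M" "(\<lambda>n. L2_sq M (\<lambda>t. x n t - y t)) \<longlonglongrightarrow> 0"
proof -
  obtain N where N: "\<And>k m n. m \<ge> N k \<Longrightarrow> n \<ge> N k \<Longrightarrow> L2_sq M (\<lambda>t. x m t - x n t) \<le> (1/4) ^ k"
    using cauchy[of "(1/4) ^ k" for k] by (metis zero_less_power zero_less_divide_1_iff zero_less_numeral)
  \<comment> \<open>Summing the thresholds makes \<open>r\<close> monotone with
    \<open>N k \<le> r k\<close>, and the extra \<open>k\<close> makes it unbounded.\<close>
  define r where "r k = (\<Sum>i\<le>k. N i) + k" for k
  have r: "N k \<le> r k" "k \<le> r k" "r k \<le> r (Suc k)" for k
    using member_le_sum[of k "{..k}" N] by (auto simp: r_def)
  have "AE t in M. convergent (\<lambda>k. x (r k) t)"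
  proof (rule L2_fast_Cauchy_AE_convergent)
    show "L2_sq M (\<lambda>t. x (r (Suc k)) t - x (r k) t) \<le> (1/4) ^ k" for k
      by (rule N) (use r[of k] in auto)
  qed (rule x)
  moreover define y where "y t = lim (\<lambda>k. x (r k) t)" for t
  ultimately have lim: "AE t in M. (\<lambda>k. x (r k) t) \<longlonglongrightarrow> y t"
    by (simp add: convergent_LIMSEQ_iff)
  have [measurable]: "x n \<in> borel_measurable M" for n using x by measurable
  have y [measurable]: "y \<in> borel_measurable M" unfolding y_def by measurable
  \<comment> \<open>Fatou along the subsequence with \<open>n\<close> held fixed turns the Cauchy
    bound into a bound for the distance to \<open>y\<close>; this yields both membership of
    \<open>y\<close> and convergence of the whole sequence.\<close>
  have est: "(\<lambda>t. x n t - y t) \<in> L2 M \<and> L2_sq M (\<lambda>t. x n t - y t) \<le> (1/4) ^ k" if "n \<ge> N k" for n k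
  proof -
    have ev: "eventually (\<lambda>j. L2_sq M (\<lambda>t. x n t - x (r j) t) \<le> (1/4) ^ k) sequentially"
      by (rule eventually_sequentiallyI[of "N k"])
        (use r(2) that N in \<open>meson order_trans\<close>)
    have lim': "AE t in M. (\<lambda>j. x n t - x (r j) t) \<longlonglongrightarrow> x n t - y t"
      using lim by eventually_elim (intro tendsto_intros)
    show ?thesis
      using L2_Fatou[of "\<lambda>j t. x n t - x (r j) t" M "\<lambda>t. x n t - y t", OF L2_diff[OF x x] _ lim' ev]
      by auto
  qed
  show thesis
  proof
    show "y \<in> L2 M" using L2_diff[OF x[of "N 0"] conjunct1[OF est[of 0 "N 0"]]] by simp
    show "(\<lambda>n. L2_sq M (\<lambda>t. x n t - y t)) \<longlonglongrightarrow> 0"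
    proof (rule LIMSEQ_I)
      fix e :: real assume "0 < e"
      then obtain k where k: "(1/4) ^ k < e" using real_arch_pow_inv[of e "1/4"] by auto
      show "\<exists>no. \<forall>n\<ge>no. norm (L2_sq M (\<lambda>t. x n t - y t) - 0) < e"
        using est[of k] k by (intro exI[of _ "N k"]) force
    qed
  qed
qed

text \<open>Elements are functions rather than classes. Because approximation is measured by
  \<open>L2_sq\<close>, a closed set contains every member of \<open>L2 M\<close> that agrees almost
  everywhere with one of its elements.\<close>

definition L2_closed :: "'a measure \<Rightarrow> ('a \<Rightarrow> complex) set \<Rightarrow> bool" where
  "L2_closed M X \<longleftrightarrow> X \<subseteq> L2 M \<and>
     (\<forall>y\<in>L2 M. (\<forall>e>0. \<exists>x\<in>X. L2_sq M (\<lambda>t. y t - x t) < e) \<longrightarrow> y \<in> X)"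

definition L2_subspace :: "'a measure \<Rightarrow> ('a \<Rightarrow> complex) set \<Rightarrow> bool" where
  "L2_subspace M X \<longleftrightarrow> X \<subseteq> L2 M \<and> (\<lambda>t. 0) \<in> X \<and>
     (\<forall>x\<in>X. \<forall>y\<in>X. (\<lambda>t. x t + y t) \<in> X) \<and> (\<forall>x\<in>X. \<forall>c. (\<lambda>t. c * x t) \<in> X)"

lemma L2_parallelogram:
  assumes "x \<in> L2 M" "y \<in> L2 M"
  shows "L2_sq M (\<lambda>t. x t + y t) + L2_sq M (\<lambda>t. x t - y t) = 2 * L2_sq M x + 2 * L2_sq M y"
  using L2_sq_add[OF assms] L2_sq_diff[OF assms] by simp

text \<open>A minimizing sequence for the distance is Cauchy by the parallelogram law; its limit
  stays in the closed set, and varying it in the direction of any element of \<open>X\<close> gives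
  orthogonality.\<close>

theorem L2_projection:
  assumes sub: "L2_subspace M X" and closed: "L2_closed M X" and z: "z \<in> L2 M"
  obtains p where "p \<in> X" "\<And>x. x \<in> X \<Longrightarrow> L2_ip M (\<lambda>t. z t - p t) x = 0"
proof -
  have XL: "x \<in> L2 M" if "x \<in> X" for x using sub that by (auto simp: L2_subspace_def)
  have add: "(\<lambda>t. x t + y t) \<in> X" if "x \<in> X" "y \<in> X" for x y
    using sub that by (auto simp: L2_subspace_def)
  have scale: "(\<lambda>t. c * x t) \<in> X" if "x \<in> X" for x c
    using sub that by (auto simp: L2_subspace_def)
  define E where "E x = L2_sq M (\<lambda>t. z t - x t)" for x
  define d where "d = Inf (E ` X)"
  have ne: "E ` X \<noteq> {}" using sub by (auto simp: L2_subspace_def)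
  have bdd: "bdd_below (E ` X)" by (rule bdd_belowI[of _ 0]) (auto simp: E_def)
  have d_le: "d \<le> E x" if "x \<in> X" for x
    unfolding d_def using that bdd by (intro cInf_lower) auto
  have "\<exists>x\<in>X. E x < d + 1 / real (Suc n)" for n
    using cInf_lessD[OF ne, of "d + 1 / real (Suc n)"] by (auto simp: d_def)
  then obtain x where x: "\<And>n. x n \<in> X" "\<And>n. E (x n) < d + 1 / real (Suc n)" by metis
  have xL: "x n \<in> L2 M" for n by (rule XL[OF x(1)])
  have zx: "(\<lambda>t. z t - x n t) \<in> L2 M" for n by (rule L2_diff[OF z xL])
  have diff: "L2_sq M (\<lambda>t. x m t - x n t) \<le> 2 / real (Suc m) + 2 / real (Suc n)" for m n
  proof -
    \<comment> \<open>The midpoint of \<open>x n\<close> and \<open>x m\<close> is in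
      \<open>X\<close>, so its squared distance to \<open>z\<close> is at least \<open>d\<close>;
      this is the lower bound that the parallelogram law needs.\<close>
    have "L2_sq M (\<lambda>t. (z t - x n t) + (z t - x m t)) = 4 * E (\<lambda>t. 1/2 * (x n t + x m t))"
    proof -
      have "(\<lambda>t. (z t - x n t) + (z t - x m t)) = (\<lambda>t. 2 * (z t - 1/2 * (x n t + x m t)))"
        by (auto simp: algebra_simps)
      then show ?thesis unfolding E_def by (simp only: L2_sq_scale) simp
    qed
    moreover have "d \<le> E (\<lambda>t. 1/2 * (x n t + x m t))"
      by (rule d_le) (intro scale add x)
    ultimately have "L2_sq M (\<lambda>t. (z t - x n t) - (z t - x m t)) \<le> 2 * E (x n) + 2 * E (x m) - 4 * d"
      using L2_parallelogram[OF zx[of n] zx[of m]] by (simp add: E_def)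
    moreover have "2 * E (x n) < 2 * d + 2 / real (Suc n)" "2 * E (x m) < 2 * d + 2 / real (Suc m)"
      using x(2)[of n] x(2)[of m] by auto
    ultimately show ?thesis by simp
  qed
  obtain p where p: "p \<in> L2 M" and lim: "(\<lambda>n. L2_sq M (\<lambda>t. x n t - p t)) \<longlonglongrightarrow> 0"
  proof (rule L2_complete[of x M])
    fix e :: real assume "0 < e"
    then obtain N where N: "inverse (real (Suc N)) < e / 4"
      using reals_Archimedean[of "e / 4"] by auto
    have "L2_sq M (\<lambda>t. x m t - x n t) \<le> e" if "m \<ge> N" "n \<ge> N" for m n
    proof -
      have "1 / real (Suc m) \<le> inverse (real (Suc N))" "1 / real (Suc n) \<le> inverse (real (Suc N))"
        using that by (auto simp: field_simps)
      with diff[of m n] N show ?thesis by simp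
    qed
    then show "\<exists>N. \<forall>m\<ge>N. \<forall>n\<ge>N. L2_sq M (\<lambda>t. x m t - x n t) \<le> e" by blast
  qed (use xL that in auto)
  have pX: "p \<in> X"
  proof -
    have "\<exists>x\<in>X. L2_sq M (\<lambda>t. p t - x t) < e" if epos: "0 < e" for e :: real
    proof -
      obtain n where "L2_sq M (\<lambda>t. x n t - p t) < e"
        using order_tendstoD(2)[OF lim epos] by (auto simp: eventually_sequentially)
      then show ?thesis using x(1) by (auto simp: L2_sq_minus_commute[of M p])
    qed
    then show ?thesis using closed p by (auto simp: L2_closed_def)
  qed
  have Ep: "E p \<le> d"
  proof -
    have "(\<lambda>n. sqrt (E (x n)) + sqrt (L2_sq M (\<lambda>t. x n t - p t))) \<longlonglongrightarrow> sqrt d + sqrt 0"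
    proof (intro tendsto_intros lim)
      show "(\<lambda>n. E (x n)) \<longlonglongrightarrow> d"
      proof (rule tendsto_sandwich[where f = "\<lambda>_. d" and h = "\<lambda>n. d + 1 / real (Suc n)"])
        show "(\<lambda>n. d + 1 / real (Suc n)) \<longlonglongrightarrow> d"
          using tendsto_add[OF tendsto_const[of d] LIMSEQ_inverse_real_of_nat]
          by (simp add: inverse_eq_divide)
      qed (use d_le[OF x(1)] less_imp_le[OF x(2)] in \<open>simp_all del: of_nat_Suc\<close>)
    qed
    moreover have "sqrt (E p) \<le> sqrt (E (x n)) + sqrt (L2_sq M (\<lambda>t. x n t - p t))" for n
      using L2_minkowski[OF zx[of n] L2_diff[OF xL[of n] p]] by (simp add: E_def)
    ultimately have "sqrt (E p) \<le> sqrt d + sqrt 0"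
      by (intro LIMSEQ_le_const) auto
    then show ?thesis by simp
  qed
  have zp: "(\<lambda>t. z t - p t) \<in> L2 M" by (rule L2_diff[OF z p])
  have "L2_ip M (\<lambda>t. z t - p t) y = 0" if y: "y \<in> X" for y
  proof -
    define v where "v = L2_ip M (\<lambda>t. z t - p t) y"
    define b where "b = L2_sq M y"
    have quad: "2 * (s * (cmod v)\<^sup>2) \<le> s\<^sup>2 * (cmod v)\<^sup>2 * b" for s :: real
    proof -
      define c where "c = of_real s * v"
      have "E p \<le> E (\<lambda>t. p t + c * y t)"
        using Ep d_le[OF add[OF pX scale[OF y]], of c] by simp
      also have "\<dots> = L2_sq M (\<lambda>t. (z t - p t) - c * y t)"
        by (simp add: E_def algebra_simps)
      also have "\<dots> = E p + (cmod c)\<^sup>2 * b - 2 * Re (cnj c * v)"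
        by (subst L2_sq_diff[OF zp L2_scale[OF XL[OF y]]])
          (simp add: E_def L2_sq_scale L2_ip_scale_right v_def b_def)
      also have "cnj c * v = of_real (s * (cmod v)\<^sup>2)"
        unfolding c_def by (simp add: complex_norm_square mult_ac del: of_real_power)
      finally show ?thesis
        by (simp add: c_def norm_mult power_mult_distrib algebra_simps)
    qed
    have b: "0 \<le> b" by (simp add: b_def)
    \<comment> \<open>Any \<open>s > 0\<close> with \<open>s * b < 2\<close> forces
      \<open>v = 0\<close> in \<open>quad\<close>; \<open>1 / (b + 1)\<close> is one that also
      covers \<open>b = 0\<close>.\<close>
    have "2 * (1 / (b + 1) * (cmod v)\<^sup>2) \<le> (1 / (b + 1))\<^sup>2 * (cmod v)\<^sup>2 * b"
      by (rule quad)
    also have "\<dots> = 1 / (b + 1) * (cmod v)\<^sup>2 * (b / (b + 1))"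
      by (simp add: power2_eq_square)
    also have "\<dots> \<le> 1 / (b + 1) * (cmod v)\<^sup>2 * 1"
      using b by (intro mult_left_mono) auto
    finally have "1 / (b + 1) * (cmod v)\<^sup>2 \<le> 0" by simp
    then have "(cmod v)\<^sup>2 \<le> 0" using b by (simp add: field_simps split: if_splits)
    then show ?thesis by (simp add: v_def)
  qed
  then show thesis using that[OF pX] by blast
qed

text \<open>The residual of \<open>z\<close> after projection is itself an annihilator of
  \<open>X\<close>, so the hypothesis applies to it and makes it orthogonal to \<open>z\<close>,
  hence to itself. This is the membership test for closed spans of exponentials used
  throughout.\<close>

lemma L2_double_orthogonal:
  assumes sub: "L2_subspace M X" and closed: "L2_closed M X" and z: "z \<in> L2 M"
    and orth: "\<And>k. k \<in> L2 M \<Longrightarrow> (\<And>x. x \<in> X \<Longrightarrow> L2_ip M k x = 0) \<Longrightarrow> L2_ip M z k = 0"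
  shows "z \<in> X"
proof -
  obtain p where p: "p \<in> X" "\<And>x. x \<in> X \<Longrightarrow> L2_ip M (\<lambda>t. z t - p t) x = 0"
    by (rule L2_projection[OF sub closed z]) blast
  have pL: "p \<in> L2 M" using sub p(1) by (auto simp: L2_subspace_def)
  define k where "k t = z t - p t" for t
  have k: "k \<in> L2 M" unfolding k_def by (rule L2_diff[OF z pL])
  have "L2_ip M z k = 0" by (rule orth[OF k]) (use p(2) in \<open>simp add: k_def[abs_def]\<close>)
  moreover have "L2_ip M p k = 0"
    using p(2)[OF p(1)] L2_ip_commute[of M p k] by (simp add: k_def[abs_def])
  ultimately have "L2_ip M k k = 0"
    using L2_ip_diff_left[OF z pL k] by (simp add: k_def[abs_def])
  then have "L2_sq M k = 0" by (simp add: L2_ip_self)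
  then have "\<forall>e>0. \<exists>x\<in>X. L2_sq M (\<lambda>t. z t - x t) < e" using p(1) unfolding k_def[abs_def] by (intro allI impI bexI[of _ p]) auto
  then show ?thesis using closed z by (auto simp: L2_closed_def)
qed

text \<open>Gliding hump: the sign of each step is chosen so that the pairing with the current
  element does not get smaller.\<close>

theorem L2_uniform_boundedness:
  assumes D: "D \<subseteq> L2 M"
    and pointwise: "\<And>y. y \<in> L2 M \<Longrightarrow> \<exists>c. \<forall>k\<in>D. cmod (L2_ip M y k) \<le> c"
  shows "\<exists>C. \<forall>k\<in>D. L2_sq M k \<le> C"
proof (rule ccontr)
  assume contra: "\<not> ?thesis"
  \<comment> \<open>The norms grow like \<open>4 ^ n\<close> and the steps shrink like
    \<open>(1/3) ^ n\<close>, so the humps grow at least like \<open>(4/3) ^ n\<close>.\<close>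
  have "\<exists>k\<in>D. 4 ^ n \<le> sqrt (L2_sq M k)" for n :: nat
  proof -
    obtain k where k: "k \<in> D" "(4 ^ n)\<^sup>2 < L2_sq M k"
      using contra by (meson not_le)
    then have "4 ^ n \<le> sqrt (L2_sq M k)" by (intro real_le_rsqrt) auto
    with k show ?thesis by blast
  qed
  then obtain k where kD: "\<And>n. k n \<in> D" and kn: "\<And>n. 4 ^ n \<le> sqrt (L2_sq M (k n))" by metis
  have kL: "k n \<in> L2 M" for n using D kD by auto
  define \<kappa> where "\<kappa> n = sqrt (L2_sq M (k n))" for n
  have \<kappa>: "0 < \<kappa> n" for n unfolding \<kappa>_def using kn[of n] by (rule less_le_trans[rotated]) simp
  define c :: "nat \<Rightarrow> complex" where "c n = of_real ((1/3) ^ n / \<kappa> n)" for n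
  define step :: "nat \<Rightarrow> ('a \<Rightarrow> complex) \<Rightarrow> complex" where
    "step n y = (if (1/3) ^ n * \<kappa> n \<le> cmod (L2_ip M (\<lambda>t. y t + c n * k n t) (k n)) then c n else - c n)"
    for n y
  define y where "y = rec_nat (\<lambda>t. 0) (\<lambda>n y t. y t + step n y * k n t)"
  have y_Suc: "y (Suc n) = (\<lambda>t. y n t + step n (y n) * k n t)" for n by (simp add: y_def)
  have yL: "y n \<in> L2 M" for n
    by (induction n) (simp_all add: y_Suc L2_add L2_scale kL, simp add: y_def L2_zero)
  have ipc: "L2_ip M (\<lambda>t. c n * k n t) (k n) = of_real ((1/3) ^ n * \<kappa> n)" for n
  proof -
    have "L2_sq M (k n) = \<kappa> n * \<kappa> n" by (simp add: \<kappa>_def)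
    then show ?thesis using \<kappa>[of n] unfolding L2_ip_scale_left L2_ip_self c_def by simp
  qed
  have hump: "(1/3) ^ n * \<kappa> n \<le> cmod (L2_ip M (y (Suc n)) (k n))" for n
  proof (cases "(1/3) ^ n * \<kappa> n \<le> cmod (L2_ip M (\<lambda>t. y n t + c n * k n t) (k n))")
    case True
    then show ?thesis by (simp add: y_Suc step_def)
  next
    case False
    let ?a = "L2_ip M (y n) (k n)" and ?r = "(1/3) ^ n * \<kappa> n"
    have "L2_ip M (\<lambda>t. y n t + c n * k n t) (k n) = ?a + of_real ?r"
      by (simp only: L2_ip_add_left[OF yL L2_scale[OF kL] kL] ipc)
    then have 1: "cmod (?a + of_real ?r) < ?r" using False by simp
    have "L2_ip M (y (Suc n)) (k n) = L2_ip M (\<lambda>t. y n t - c n * k n t) (k n)"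
      using False by (simp add: y_Suc step_def)
    also have "\<dots> = ?a - of_real ?r"
      by (simp only: L2_ip_diff_left[OF yL L2_scale[OF kL] kL] ipc)
    finally have 2: "L2_ip M (y (Suc n)) (k n) = ?a - of_real ?r" .
    have "cmod (2 * of_real ?r) \<le> cmod (?a + of_real ?r) + cmod (?a - of_real ?r)"
      using norm_triangle_ineq4[of "?a + of_real ?r" "?a - of_real ?r"] by (simp add: mult_ac)
    moreover have "cmod (2 * of_real ?r) = 2 * ?r"
      unfolding norm_mult norm_of_real using \<kappa>[of n] by simp
    ultimately show ?thesis using 1 2 by simp
  qed
  have stepnorm: "sqrt (L2_sq M (\<lambda>t. step n (y n) * k n t)) = (1/3) ^ n" for n
  proof -
    have "cmod (step n (y n)) = (1/3) ^ n / \<kappa> n"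
      using \<kappa>[of n] by (simp add: step_def c_def norm_divide norm_power)
    then show ?thesis using \<kappa>[of n] by (simp add: L2_sq_scale real_sqrt_mult flip: \<kappa>_def)
  qed
  have tail: "sqrt (L2_sq M (\<lambda>t. y (n + j) t - y n t)) \<le> 3 / 2 * ((1/3) ^ n - (1/3) ^ (n + j))" for n j
  proof (induction j)
    case 0 then show ?case by (simp add: L2_sq_def)
  next
    case (Suc j)
    have "(\<lambda>t. y (n + Suc j) t - y n t)
        = (\<lambda>t. (y (n + j) t - y n t) + step (n + j) (y (n + j)) * k (n + j) t)"
      by (auto simp: y_Suc)
    then have "sqrt (L2_sq M (\<lambda>t. y (n + Suc j) t - y n t))
        \<le> sqrt (L2_sq M (\<lambda>t. y (n + j) t - y n t)) + (1/3) ^ (n + j)"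
      using L2_minkowski[OF L2_diff[OF yL yL] L2_scale[OF kL], of "n + j" n "step (n + j) (y (n + j))" "n + j"]
      by (simp add: stepnorm)
    with Suc show ?case by simp
  qed
  have tail': "sqrt (L2_sq M (\<lambda>t. y m t - y n t)) \<le> 3 / 2 * (1/3) ^ n" if "n \<le> m" for m n
    using tail[of n "m - n"] that zero_le_power[of "1/3::real" m] by (simp del: zero_le_power)
  obtain z where z: "z \<in> L2 M" and lim: "(\<lambda>n. L2_sq M (\<lambda>t. y n t - z t)) \<longlonglongrightarrow> 0"
  proof (rule L2_complete[of y M])
    fix e :: real assume "0 < e"
    then obtain N where N: "(1/3) ^ N < sqrt e / 3"
      using real_arch_pow_inv[of "sqrt e / 3" "1/3"] by auto
    have "L2_sq M (\<lambda>t. y m t - y n t) \<le> e" if "m \<ge> N" "n \<ge> N" for m n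
    proof -
      have "(\<lambda>t. y m t - y n t) = (\<lambda>t. (y m t - y N t) - (y n t - y N t))" by simp
      then have "sqrt (L2_sq M (\<lambda>t. y m t - y n t)) \<le> 3 / 2 * (1/3) ^ N + 3 / 2 * (1/3) ^ N"
        using L2_minkowski_diff[OF L2_diff[OF yL yL] L2_diff[OF yL yL], of m N n N]
          tail'[OF that(1)] tail'[OF that(2)] by simp
      also have "\<dots> \<le> sqrt e" using N by simp
      finally show ?thesis by simp
    qed
    then show "\<exists>N. \<forall>m\<ge>N. \<forall>n\<ge>N. L2_sq M (\<lambda>t. y m t - y n t) \<le> e" by blast
  qed (use yL that in auto)
  have zy: "sqrt (L2_sq M (\<lambda>t. z t - y n t)) \<le> 3 / 2 * (1/3) ^ n" for n
  proof -
    have "(\<lambda>m. sqrt (L2_sq M (\<lambda>t. y m t - z t)) + 3 / 2 * (1/3) ^ n) \<longlonglongrightarrow> sqrt 0 + 3 / 2 * (1/3) ^ n"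
      by (intro tendsto_intros lim)
    moreover have "sqrt (L2_sq M (\<lambda>t. z t - y n t)) \<le> sqrt (L2_sq M (\<lambda>t. y m t - z t)) + 3 / 2 * (1/3) ^ n"
      if "m \<ge> n" for m
      using L2_minkowski[OF L2_diff[OF z yL] L2_diff[OF yL yL], of m m n] tail'[OF that]
      by (simp add: L2_sq_minus_commute[of M z "y m"])
    ultimately have "sqrt (L2_sq M (\<lambda>t. z t - y n t)) \<le> sqrt 0 + 3 / 2 * (1/3) ^ n"
      by (intro LIMSEQ_le_const) auto
    then show ?thesis by simp
  qed
  obtain C where C: "\<And>x. x \<in> D \<Longrightarrow> cmod (L2_ip M z x) \<le> C" using pointwise[OF z] by blast
  \<comment> \<open>All steps after the one with \<open>k n\<close> together change the pairing with
    \<open>k n\<close> by at most \<open>3/2 * (1/3) ^ Suc n * \<kappa> n\<close>, which is half of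
    the guaranteed hump.\<close>
  have "(4/3) ^ n / 2 \<le> C" for n
  proof -
    have "cmod (L2_ip M (y (Suc n)) (k n)) \<le> cmod (L2_ip M z (k n)) + cmod (L2_ip M (\<lambda>t. z t - y (Suc n) t) (k n))"
      using norm_triangle_ineq4[of "L2_ip M z (k n)" "L2_ip M (\<lambda>t. z t - y (Suc n) t) (k n)"]
      by (simp add: L2_ip_diff_left[OF z yL kL])
    moreover have "cmod (L2_ip M (\<lambda>t. z t - y (Suc n) t) (k n)) \<le> 3 / 2 * (1/3) ^ Suc n * \<kappa> n"
      using L2_Cauchy_Schwarz[OF L2_diff[OF z yL] kL, of "Suc n" n] mult_right_mono[OF zy[of "Suc n"], of "\<kappa> n"] less_imp_le[OF \<kappa>[of n]]
      unfolding \<kappa>_def by linarith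
    ultimately have "(1/3) ^ n * \<kappa> n / 2 \<le> C" using hump[of n] C[OF kD[of n]] by simp
    moreover have "(4/3::real) ^ n \<le> (1/3) ^ n * \<kappa> n"
      using mult_left_mono[OF kn[of n], of "(1/3) ^ n"] by (simp add: \<kappa>_def flip: power_mult_distrib)
    ultimately show ?thesis by simp
  qed
  moreover obtain n where "2 * C + 1 < (4/3) ^ n" using real_arch_pow[of "4/3" "2 * C + 1"] by auto
  ultimately show False by (smt (verit) field_sum_of_halves)
qed

lemma L2_sq_cong_AE:
  assumes [measurable]: "x \<in> borel_measurable M" "y \<in> borel_measurable M" and "AE t in M. x t = y t"
  shows "L2_sq M x = L2_sq M y"
  unfolding L2_sq_def by (rule integral_cong_AE) (use assms(3) in \<open>auto elim: eventually_mono\<close>)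

lemma L2_ip_cong_AE:
  assumes "x \<in> L2 M" "y \<in> L2 M" "x' \<in> L2 M" "y' \<in> L2 M"
    and "AE t in M. x t = x' t" "AE t in M. y t = y' t"
  shows "L2_ip M x y = L2_ip M x' y'"
  unfolding L2_ip_def
proof (rule integral_cong_AE)
  show "AE t in M. x t * cnj (y t) = x' t * cnj (y' t)" using assms(5,6) by eventually_elim simp
qed (use L2_ip_integrable assms(1-4) in auto)

lemma L2_sq_two_step:
  assumes "x \<in> L2 M" "y \<in> L2 M" "z \<in> L2 M"
  shows "L2_sq M (\<lambda>t. x t - z t) \<le> 2 * L2_sq M (\<lambda>t. x t - y t) + 2 * L2_sq M (\<lambda>t. y t - z t)"
proof -
  have "L2_sq M (\<lambda>t. (x t - y t) + (y t - z t)) + L2_sq M (\<lambda>t. (x t - y t) - (y t - z t))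
      = 2 * L2_sq M (\<lambda>t. x t - y t) + 2 * L2_sq M (\<lambda>t. y t - z t)"
    by (intro L2_parallelogram L2_diff assms)
  moreover have "L2_sq M (\<lambda>t. (x t - y t) + (y t - z t)) = L2_sq M (\<lambda>t. x t - z t)" by simp
  moreover have "0 \<le> L2_sq M (\<lambda>t. (x t - y t) - (y t - z t))" by (rule L2_sq_nonneg)
  ultimately show ?thesis by linarith
qed

text \<open>A norm-bounded sequence that converges almost everywhere converges weakly, even where it
  does not converge in norm. Comparing norms in Fatou's lemma isolates the cross term, which is at
  most \<open>r\<^sup>2 * c\<close> for every \<open>r > 0\<close>.\<close>

lemma L2_weak_limit_orthogonal:
  assumes x: "\<And>n. x n \<in> L2 M" and y: "y \<in> L2 M" and k: "k \<in> L2 M"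
    and lim: "AE t in M. (\<lambda>n. x n t) \<longlonglongrightarrow> y t"
    and bound: "\<And>n. L2_sq M (\<lambda>t. x n t - y t) \<le> c"
    and orth: "\<And>n. L2_ip M (x n) k = 0"
  shows "L2_ip M y k = 0"
proof -
  define s where "s = L2_ip M y k"
  define d where "d n t = x n t - y t" for n t
  have d: "d n \<in> L2 M" for n unfolding d_def by (rule L2_diff[OF x y])
  have ds: "L2_ip M (d n) k = - s" for n
    by (simp add: d_def[abs_def] L2_ip_diff_left[OF x y k] orth s_def)
  have km: "k \<in> borel_measurable M" using k by measurable
  obtain v where v: "cmod v = 1" "cnj v * - s = of_real (cmod s)"
  proof (cases "s = 0")
    case True then show ?thesis using that[of 1] by simp
  next
    case False
    then have "cnj (- s / of_real (cmod s)) * - s = of_real (cmod s)"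
      using complex_norm_square[of s] by (simp add: divide_eq_eq mult.commute power2_eq_square)
    then show ?thesis using that[of "- s / of_real (cmod s)"] False by (simp add: norm_divide)
  qed
  have c0: "0 \<le> c" using order_trans[OF L2_sq_nonneg bound[of 0]] .
  \<comment> \<open>Fatou's lemma for \<open>r d\<^sub>n - v k / (2 r)\<close>, whose cross term does not depend on \<open>n\<close>.\<close>
  have key: "cmod s \<le> r\<^sup>2 * c" if r: "0 < r" for r :: real
  proof -
    define w where "w = v / of_real (2 * r)"
    have w2: "(cmod w)\<^sup>2 = 1 / (4 * r\<^sup>2)" using r v(1) by (simp add: w_def norm_divide power_divide power_mult_distrib norm_mult)
    define z where "z n t = of_real r * d n t - w * k t" for n t
    have z: "z n \<in> L2 M" for n unfolding z_def by (intro L2_diff L2_scale d k)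
    have zsq: "L2_sq M (z n) \<le> (r\<^sup>2 * c - cmod s) + (cmod w)\<^sup>2 * L2_sq M k" for n
    proof -
      have "L2_sq M (z n) = r\<^sup>2 * L2_sq M (d n) + (cmod w)\<^sup>2 * L2_sq M k - 2 * Re (of_real r * (cnj w * - s))"
        unfolding z_def
        by (subst L2_sq_diff[OF L2_scale[OF d] L2_scale[OF k]])
          (simp add: L2_sq_scale L2_ip_scale_left L2_ip_scale_right ds)
      also have "of_real r * (cnj w * - s) = of_real (cmod s / 2)"
        using v(2) r by (simp add: w_def)
      finally have "L2_sq M (z n) = r\<^sup>2 * L2_sq M (d n) + (cmod w)\<^sup>2 * L2_sq M k - cmod s" by simp
      moreover have "r\<^sup>2 * L2_sq M (d n) \<le> r\<^sup>2 * c" using bound[of n] by (intro mult_left_mono) (auto simp: d_def[abs_def])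
      ultimately show ?thesis by simp
    qed
    have zlim: "AE t in M. (\<lambda>n. z n t) \<longlonglongrightarrow> - w * k t"
      using lim
    proof eventually_elim
      case (elim t)
      have "(\<lambda>n. z n t) \<longlonglongrightarrow> of_real r * (y t - y t) - w * k t"
        unfolding z_def d_def by (intro tendsto_intros elim)
      then show ?case by simp
    qed
    have "L2_sq M (\<lambda>t. - w * k t) \<le> (r\<^sup>2 * c - cmod s) + (cmod w)\<^sup>2 * L2_sq M k"
      by (rule L2_Fatou(2)[OF z _ zlim]) (use km zsq in auto)
    then show ?thesis unfolding L2_sq_scale by simp
  qed
  have "cmod s = 0"
  proof (rule ccontr)
    assume "cmod s \<noteq> 0"
    then have s: "0 < cmod s" by simp
    \<comment> \<open>With this choice \<open>r\<^sup>2 * c\<close> is below half of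
      \<open>cmod s\<close>, against \<open>key\<close>.\<close>
    define r where "r = sqrt (cmod s / (2 * (c + 1)))"
    have r: "0 < r" "r\<^sup>2 = cmod s / (2 * (c + 1))" using s c0 by (auto simp: r_def)
    have "cmod s * (2 * (c + 1)) \<le> cmod s * c" using key[OF r(1)] c0 unfolding r(2) by (simp add: field_simps)
    then show False using s c0 by simp
  qed
  then show ?thesis by (simp add: s_def)
qed

section \<open>The Fourier integral and the Abel kernel\<close>

lemma sigma_finite_lebesgue: "sigma_finite_measure (lebesgue :: real measure)"
proof
  show "\<exists>A. countable A \<and> A \<subseteq> sets lebesgue \<and> \<Union>A = space (lebesgue :: real measure) \<and>
      (\<forall>a\<in>A. emeasure lebesgue a \<noteq> \<infinity>)"
  proof (intro exI conjI)
    show "\<Union>(range (\<lambda>n. {- real n .. real n})) = space (lebesgue :: real measure)"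
    proof -
      have "\<exists>n. - real n \<le> x \<and> x \<le> real n" for x :: real
        using real_arch_simple[of "\<bar>x\<bar>"] by (metis abs_le_iff minus_le_iff)
      then show ?thesis by auto
    qed
  qed auto
qed

interpretation lebesgue_pair: pair_sigma_finite "lebesgue :: real measure" "lebesgue :: real measure"
  by (intro pair_sigma_finite.intro sigma_finite_lebesgue)

lemma measurable_ident_lebesgue_pair [measurable]:
  "fst \<in> borel_measurable ((lebesgue :: real measure) \<Otimes>\<^sub>M (lebesgue :: real measure))"
  "snd \<in> borel_measurable ((lebesgue :: real measure) \<Otimes>\<^sub>M (lebesgue :: real measure))"
  by (rule measurable_compose[OF measurable_fst], simp add: measurable_completion)
    (rule measurable_compose[OF measurable_snd], simp add: measurable_completion)

lemma integrable_pair_bounded: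
  fixes x y :: "real \<Rightarrow> complex" and k :: "real \<Rightarrow> real \<Rightarrow> complex"
  assumes x: "integrable lebesgue x" and y: "integrable lebesgue y"
    and k: "(\<lambda>p. k (fst p) (snd p)) \<in> borel_measurable (lebesgue \<Otimes>\<^sub>M lebesgue)"
    and bound: "\<And>s t. cmod (k s t) \<le> c"
  shows "integrable (lebesgue \<Otimes>\<^sub>M lebesgue) (\<lambda>(s, t). x s * y t * k s t)"
proof (rule Bochner_Integration.integrable_bound)
  have [measurable]: "x \<in> borel_measurable lebesgue" "y \<in> borel_measurable lebesgue"
    using x y by auto
  have "integrable (lebesgue \<Otimes>\<^sub>M lebesgue) (\<lambda>(s, t). x s * y t)"
  proof (rule lebesgue_pair.Fubini_integrable)
    show "integrable lebesgue (\<lambda>s. LINT t|lebesgue. norm (case (s, t) of (s, t) \<Rightarrow> x s * y t))"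
      using x by (simp add: norm_mult)
    show "AE s in lebesgue. integrable lebesgue (\<lambda>t. case (s, t) of (s, t) \<Rightarrow> x s * y t)"
      using y by simp
  qed measurable
  then show "integrable (lebesgue \<Otimes>\<^sub>M lebesgue) (\<lambda>(s, t). of_real c * (x s * y t))"
    unfolding case_prod_beta by (rule integrable_mult_right)
  show "(\<lambda>(s, t). x s * y t * k s t) \<in> borel_measurable (lebesgue \<Otimes>\<^sub>M lebesgue)"
    using k unfolding case_prod_beta by measurable
  have "0 \<le> c" using norm_ge_zero bound[of 0 0] by (rule order_trans)
  have le: "cmod (x s * y t * k s t) \<le> cmod (of_real c * (x s * y t))" for s t
  proof -
    have "cmod (x s) * cmod (y t) * cmod (k s t) \<le> cmod (x s) * cmod (y t) * c"
      using bound by (intro mult_left_mono) auto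
    then show ?thesis using \<open>0 \<le> c\<close> by (simp add: norm_mult mult_ac)
  qed
  show "AE p in lebesgue \<Otimes>\<^sub>M lebesgue. norm (case p of (s, t) \<Rightarrow> x s * y t * k s t)
      \<le> norm (case p of (s, t) \<Rightarrow> of_real c * (x s * y t))"
    by (intro AE_I2) (simp add: case_prod_beta le)
qed

text \<open>The common form of the complex interchanges of integration below: two integrable
  functions against a bounded kernel, mostly \<open>cis\<close> of a product.\<close>

lemma Fubini_pair_bounded:
  fixes x y :: "real \<Rightarrow> complex" and k :: "real \<Rightarrow> real \<Rightarrow> complex"
  assumes "integrable lebesgue x" and "integrable lebesgue y"
    and "(\<lambda>p. k (fst p) (snd p)) \<in> borel_measurable (lebesgue \<Otimes>\<^sub>M lebesgue)"
    and "\<And>s t. cmod (k s t) \<le> c"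
  shows "(LINT t|lebesgue. y t * (LINT s|lebesgue. x s * k s t))
       = (LINT s|lebesgue. x s * (LINT t|lebesgue. y t * k s t))"
proof -
  have "(LINT t|lebesgue. LINT s|lebesgue. x s * y t * k s t)
      = (LINT s|lebesgue. LINT t|lebesgue. x s * y t * k s t)"
    by (rule lebesgue_pair.Fubini_integral) (rule integrable_pair_bounded[OF assms])
  moreover have "(LINT s|lebesgue. x s * y t * k s t) = y t * (LINT s|lebesgue. x s * k s t)" for t
    by (subst integral_mult_right_zero[symmetric]) (simp add: mult_ac)
  moreover have "(LINT t|lebesgue. x s * y t * k s t) = x s * (LINT t|lebesgue. y t * k s t)" for s
    by (subst integral_mult_right_zero[symmetric]) (simp add: mult_ac)
  ultimately show ?thesis by simp
qed

text \<open>The kernel has the sign +iu\<nu> and no normalisation, so Parseval's identity carries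
  \<open>2 * pi\<close>, and the function A of the estimation problem is the transform of the
  extended \<open>a\<close> at \<open>- \<nu>\<close>.\<close>

definition fourier_int :: "(real \<Rightarrow> complex) \<Rightarrow> real \<Rightarrow> complex" where
  "fourier_int x \<nu> = (LINT u|lebesgue. x u * cis (u * \<nu>))"

lemma borel_measurable_cis [measurable]:
  "f \<in> borel_measurable M \<Longrightarrow> (\<lambda>x. cis (f x)) \<in> borel_measurable M"
  by (rule measurable_compose[OF _ borel_measurable_continuous_onI[OF continuous_on_cis[OF continuous_on_id]]])

lemma borel_measurable_lebesgue_ident [measurable]: "(\<lambda>x. x) \<in> borel_measurable (lebesgue :: real measure)"
  by (simp add: measurable_completion)

lemma integrable_cis_mult:
  assumes "integrable lebesgue x"
  shows "integrable lebesgue (\<lambda>u. x u * cis (u * \<nu>))"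
proof (rule Bochner_Integration.integrable_bound[OF assms])
  have [measurable]: "x \<in> borel_measurable lebesgue" using assms by auto
  show "(\<lambda>u. x u * cis (u * \<nu>)) \<in> borel_measurable lebesgue" by measurable
qed (simp add: norm_mult)

lemma fourier_int_bound: "cmod (fourier_int x \<nu>) \<le> (LINT u|lebesgue. cmod (x u))"
  unfolding fourier_int_def
  by (rule order_trans[OF integral_norm_bound]) (simp add: norm_mult)

lemma isCont_fourier_int:
  assumes x: "integrable lebesgue x"
  shows "isCont (fourier_int x) \<nu>"
  unfolding continuous_at_sequentially
proof (intro allI impI)
  fix s assume s: "s \<longlonglongrightarrow> \<nu>"
  have [measurable]: "x \<in> borel_measurable lebesgue" using x by auto
  show "(fourier_int x \<circ> s) \<longlonglongrightarrow> fourier_int x \<nu>"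
    unfolding fourier_int_def comp_def
  proof (rule integral_dominated_convergence)
    show "integrable lebesgue (\<lambda>u. cmod (x u))" using x by simp
    show "AE u in lebesgue. (\<lambda>i. x u * cis (u * s i)) \<longlonglongrightarrow> x u * cis (u * \<nu>)"
      by (intro AE_I2 tendsto_intros s)
    show "AE u in lebesgue. norm (x u * cis (u * s i)) \<le> cmod (x u)" for i
      by (simp add: norm_mult)
  qed measurable
qed

lemma continuous_on_fourier_int: "integrable lebesgue x \<Longrightarrow> continuous_on S (fourier_int x)"
  by (simp add: continuous_at_imp_continuous_on isCont_fourier_int)

lemma borel_measurable_fourier_int:
  assumes "integrable lebesgue x"
  shows "fourier_int x \<in> borel_measurable lebesgue"
  using borel_measurable_continuous_onI[OF continuous_on_fourier_int[OF assms]]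
  by (simp add: measurable_completion)

lemma fourier_int_multiplication:
  assumes x: "integrable lebesgue x" and w: "integrable lebesgue w"
  shows "(LINT \<nu>|lebesgue. w \<nu> * fourier_int x \<nu>) = (LINT u|lebesgue. x u * fourier_int w u)"
proof -
  have "(LINT \<nu>|lebesgue. w \<nu> * (LINT u|lebesgue. x u * cis (u * \<nu>)))
      = (LINT u|lebesgue. x u * (LINT \<nu>|lebesgue. w \<nu> * cis (u * \<nu>)))"
    by (rule Fubini_pair_bounded[OF x w, where c = 1]) auto
  then show ?thesis by (simp add: fourier_int_def mult.commute[of "_::real"])
qed

lemma integral_lebesgue_minus:
  fixes f :: "real \<Rightarrow> 'a::euclidean_space"
  shows "(LINT t|lebesgue. f (- t)) = (LINT t|lebesgue. f t)"
  using lebesgue_integral_real_affine[of "-1" f 0] by simp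

lemma integrable_lebesgue_minus:
  fixes f :: "real \<Rightarrow> 'a::euclidean_space"
  assumes "integrable lebesgue f" shows "integrable lebesgue (\<lambda>t. f (- t))"
  using lebesgue_integrable_real_affine[OF assms, of "-1" 0] by simp

lemma cnj_fourier_int: "cnj (fourier_int x \<nu>) = fourier_int (\<lambda>u. cnj (x u)) (- \<nu>)"
  unfolding fourier_int_def Bochner_Integration.integral_cnj[symmetric] by (simp add: cis_cnj)

text \<open>Fundamental theorem of calculus with antiderivative \<open>exp (u * z) / z\<close>; a
  negative real part of \<open>z\<close> gives absolute integrability and a vanishing boundary term
  at infinity.\<close>

lemma integral_exp_half_line:
  fixes z :: complex
  assumes z: "Re z < 0"
  shows "set_integrable lborel {0..} (\<lambda>u. exp (of_real u * z))"
    and "(LINT u:{0..}|lborel. exp (of_real u * z)) = - inverse z"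
proof -
  have "((\<lambda>u. exp (- (- Re z) * u)) has_integral exp (- (- Re z) * 0) / (- Re z)) {0..}"
    by (rule has_integral_exp_minus_to_infinity) (use z in simp)
  then have "(\<lambda>u. exp (Re z * u)) absolutely_integrable_on {0..}"
    by (intro nonnegative_absolutely_integrable_1) (auto simp: integrable_on_def)
  then have "set_integrable lborel {0..} (\<lambda>u. exp (Re z * u))"
    unfolding set_integrable_def by (subst (asm) integrable_completion) auto
  then show int: "set_integrable lborel {0..} (\<lambda>u. exp (of_real u * z))"
    by (rule set_integrable_bound) (auto simp: norm_exp_eq_Re set_borel_measurable_def mult.commute)
  have "(LBINT u=0..\<infinity>. exp (of_real u * z)) = 0 - inverse z"
  proof (rule interval_integral_FTC_integrable)
    show "((\<lambda>u. exp (of_real u * z) * inverse z) has_vector_derivative exp (of_real u * z)) (at u)" for u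
    proof (rule has_vector_derivative_real_field)
      have "z \<noteq> 0" using z by auto
      then show "((\<lambda>w. exp (w * z) * inverse z) has_field_derivative exp (of_real u * z)) (at (of_real u))"
        by (auto intro!: derivative_eq_intros)
    qed
    show "set_integrable lborel (einterval 0 \<infinity>) (\<lambda>u. exp (of_real u * z))"
      by (rule set_integrable_subset[OF int]) (auto simp: einterval_def)
    show "(((\<lambda>u. exp (of_real u * z) * inverse z) \<circ> real_of_ereal) \<longlongrightarrow> inverse z) (at_right 0)"
      unfolding zero_ereal_def ereal_tendsto_simps by (auto intro!: tendsto_eq_intros)
    show "(((\<lambda>u. exp (of_real u * z) * inverse z) \<circ> real_of_ereal) \<longlongrightarrow> 0) (at_left \<infinity>)"
      unfolding ereal_tendsto_simps
    proof (rule tendsto_mult_left_zero, rule tendsto_norm_zero_cancel)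
      have "((\<lambda>u. exp (Re z * u)) \<longlongrightarrow> 0) at_top"
        by (rule filterlim_compose[OF exp_at_bot] filterlim_tendsto_neg_mult_at_bot[OF tendsto_const z filterlim_ident])+
      then show "((\<lambda>u. norm (exp (of_real u * z))) \<longlongrightarrow> 0) at_top"
        by (simp add: norm_exp_eq_Re mult.commute)
    qed
  qed (auto intro!: continuous_intros)
  then show "(LINT u:{0..}|lborel. exp (of_real u * z)) = - inverse z"
  proof -
    \<comment> \<open>The integral from the fundamental theorem runs over the open half line; the
      endpoint is a null set.\<close>
    have "(LINT u:{0..}|lborel. exp (of_real u * z)) = (LINT u:{0<..}|lborel. exp (of_real u * z))"
      unfolding set_lebesgue_integral_def
      by (rule integral_cong_AE)
        (use AE_lborel_singleton[of "0::real"] in \<open>auto elim!: eventually_mono simp: indicator_def\<close>)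
    then show ?thesis
      using \<open>(LBINT u=0..\<infinity>. exp (of_real u * z)) = 0 - inverse z\<close>
      by (simp add: interval_integral_to_infinity_eq zero_ereal_def)
  qed
qed

lemma integral_exp_half_line_lebesgue:
  fixes z :: complex
  assumes "Re z < 0"
  shows "integrable lebesgue (\<lambda>u. indicator {0..} u *\<^sub>R exp (of_real u * z))"
    and "(LINT u|lebesgue. indicator {0..} u *\<^sub>R exp (of_real u * z)) = - inverse z"
  using integral_exp_half_line[OF assms] unfolding set_integrable_def set_lebesgue_integral_def
  by (auto simp: integrable_completion integral_completion)

text \<open>The Poisson kernel of the half plane at height \<open>e\<close>, scaled by
  \<open>2 * pi\<close> so that its total mass is \<open>2 * pi\<close>. It is the transform of the
  Abel factor.\<close>

definition poisson :: "real \<Rightarrow> real \<Rightarrow> real" where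
  "poisson e s = 2 * e / (e\<^sup>2 + s\<^sup>2)"

lemma poisson_nonneg: "0 < e \<Longrightarrow> 0 \<le> poisson e s"
  by (simp add: poisson_def)

lemma poisson_minus [simp]: "poisson e (- s) = poisson e s"
  by (simp add: poisson_def)

lemma borel_measurable_poisson [measurable]:
  "f \<in> borel_measurable M \<Longrightarrow> (\<lambda>x. poisson e (f x)) \<in> borel_measurable M"
  unfolding poisson_def
  by (intro borel_measurable_divide borel_measurable_add borel_measurable_power borel_measurable_const)

lemma fourier_int_exp_abs:
  assumes e: "0 < e"
  shows "integrable lebesgue (\<lambda>\<nu>. complex_of_real (exp (- e * \<bar>\<nu>\<bar>)))"
    and "fourier_int (\<lambda>\<nu>. complex_of_real (exp (- e * \<bar>\<nu>\<bar>))) s = of_real (poisson e s)"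
proof -
  have *: "integrable lebesgue (\<lambda>\<nu>. complex_of_real (exp (- e * \<bar>\<nu>\<bar>)) * cis (\<nu> * s)) \<and>
      (LINT \<nu>|lebesgue. complex_of_real (exp (- e * \<bar>\<nu>\<bar>)) * cis (\<nu> * s)) = of_real (poisson e s)" for s
  proof -
    \<comment> \<open>The two half lines contribute \<open>- inverse z\<close> and
      \<open>- inverse z'\<close> with conjugate exponents, and their sum is
      \<open>2 * e / (e\<^sup>2 + s\<^sup>2)\<close>.\<close>
    define z z' where "z = Complex (- e) s" and "z' = Complex (- e) (- s)"
    have re: "Re z < 0" "Re z' < 0" using e by (auto simp: z_def z'_def)
    define H where "H z u = indicator {0..} u *\<^sub>R exp (of_real u * z)" for z :: complex and u :: real
    note H = integral_exp_half_line_lebesgue[folded H_def]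
    \<comment> \<open>At 0 both closed half lines contribute, so the splitting holds only off that
      point.\<close>
    have eq: "AE \<nu> in lebesgue. H z \<nu> + H z' (- \<nu>) = complex_of_real (exp (- e * \<bar>\<nu>\<bar>)) * cis (\<nu> * s)"
    proof -
      have "AE \<nu> in lebesgue. \<nu> \<noteq> (0::real)" by (rule AE_completion[OF AE_lborel_singleton])
      then show ?thesis
      proof eventually_elim
        case (elim \<nu>)
        then show ?case
          by (cases "0 < \<nu>") (auto simp: H_def z_def z'_def exp_eq_polar mult_ac)
      qed
    qed
    have int: "integrable lebesgue (\<lambda>\<nu>. H z \<nu> + H z' (- \<nu>))"
      by (intro Bochner_Integration.integrable_add H re integrable_lebesgue_minus)
    have meas: "(\<lambda>\<nu>. complex_of_real (exp (- e * \<bar>\<nu>\<bar>)) * cis (\<nu> * s)) \<in> borel_measurable lebesgue"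
      by measurable
    have 1: "integrable lebesgue (\<lambda>\<nu>. complex_of_real (exp (- e * \<bar>\<nu>\<bar>)) * cis (\<nu> * s))"
      by (rule integrable_cong_AE_imp[OF int meas]) (use eq in \<open>auto simp: eq_commute\<close>)
    have "(LINT \<nu>|lebesgue. complex_of_real (exp (- e * \<bar>\<nu>\<bar>)) * cis (\<nu> * s))
        = (LINT \<nu>|lebesgue. H z \<nu> + H z' (- \<nu>))"
      by (rule integral_cong_AE[symmetric]) (use int meas eq in auto)
    also have "\<dots> = (LINT \<nu>|lebesgue. H z \<nu>) + (LINT \<nu>|lebesgue. H z' (- \<nu>))"
      by (intro Bochner_Integration.integral_add H re integrable_lebesgue_minus)
    also have "\<dots> = - inverse z - inverse z'"
      by (simp add: integral_lebesgue_minus H re)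
    also have "\<dots> = of_real (poisson e s)"
      using e by (simp add: z_def z'_def complex_eq_iff poisson_def power2_eq_square)
    finally show ?thesis using 1 by blast
  qed
  show "integrable lebesgue (\<lambda>\<nu>. complex_of_real (exp (- e * \<bar>\<nu>\<bar>)))" using *[of 0] by simp
  show "fourier_int (\<lambda>\<nu>. complex_of_real (exp (- e * \<bar>\<nu>\<bar>))) s = of_real (poisson e s)"
    using *[of s] by (simp add: fourier_int_def)
qed

lemma integrable_bounded_mult:
  fixes w m :: "real \<Rightarrow> complex"
  assumes w: "integrable lebesgue w" and m: "m \<in> borel_measurable lebesgue" and b: "\<And>t. cmod (m t) \<le> c"
  shows "integrable lebesgue (\<lambda>t. w t * m t)"
proof (rule Bochner_Integration.integrable_bound)
  show "integrable lebesgue (\<lambda>t. of_real c * w t)" using w by simp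
  show "(\<lambda>t. w t * m t) \<in> borel_measurable lebesgue" using w m by measurable
  have "cmod (w t) * cmod (m t) \<le> cmod (w t) * \<bar>c\<bar>" for t
    using b[of t] by (intro mult_left_mono) auto
  then show "AE t in lebesgue. norm (w t * m t) \<le> norm (of_real c * w t)"
    by (auto simp: norm_mult mult.commute)
qed

text \<open>The Gauss--Weierstrass argument for Plancherel's theorem, with the Abel kernel.\<close>

lemma fourier_int_Abel:
  assumes x: "integrable lebesgue x" and y: "integrable lebesgue y" and e: "0 < e"
  shows "(LINT \<nu>|lebesgue. fourier_int x \<nu> * cnj (fourier_int y \<nu>) * of_real (exp (- e * \<bar>\<nu>\<bar>)))
       = (LINT u|lebesgue. x u * (LINT v|lebesgue. cnj (y v) * of_real (poisson e (u - v))))"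
proof -
  define E where "E \<nu> = complex_of_real (exp (- e * \<bar>\<nu>\<bar>))" for \<nu>
  have E: "integrable lebesgue E" unfolding E_def by (rule fourier_int_exp_abs[OF e])
  note [measurable] = borel_measurable_fourier_int[OF x] borel_measurable_fourier_int[OF y]
  define w where "w \<nu> = E \<nu> * cnj (fourier_int y \<nu>)" for \<nu>
  have w: "integrable lebesgue w"
    unfolding w_def
    by (rule integrable_bounded_mult[OF E, where c = "LINT u|lebesgue. cmod (y u)"])
      (auto simp: fourier_int_bound)
  have y': "integrable lebesgue (\<lambda>v. cnj (y v))" using y by simp
  have "fourier_int w u = (LINT v|lebesgue. cnj (y v) * of_real (poisson e (u - v)))" for u
  proof -
    have Eu: "integrable lebesgue (\<lambda>\<nu>. E \<nu> * cis (\<nu> * - u))" by (rule integrable_cis_mult[OF E])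
    have "fourier_int w u = (LINT \<nu>|lebesgue. E \<nu> * cis (\<nu> * u) * fourier_int (\<lambda>v. cnj (y v)) (- \<nu>))"
      by (simp add: fourier_int_def[of w] w_def cnj_fourier_int mult_ac)
    also have "\<dots> = (LINT \<nu>|lebesgue. E \<nu> * cis (\<nu> * - u) * fourier_int (\<lambda>v. cnj (y v)) \<nu>)"
      by (subst integral_lebesgue_minus[symmetric]) (simp add: E_def)
    also have "\<dots> = (LINT v|lebesgue. cnj (y v) * fourier_int (\<lambda>\<nu>. E \<nu> * cis (\<nu> * - u)) v)"
      by (rule fourier_int_multiplication[OF y' Eu])
    also have "(\<lambda>v. fourier_int (\<lambda>\<nu>. E \<nu> * cis (\<nu> * - u)) v) = (\<lambda>v. fourier_int E (v - u))"
      by (simp add: fourier_int_def mult.assoc cis_mult algebra_simps)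
    also have "(\<lambda>v. fourier_int E (v - u)) = (\<lambda>v. of_real (poisson e (u - v)))"
      using fourier_int_exp_abs(2)[OF e] poisson_minus[of e "u - v" for v] by (simp add: E_def[abs_def])
    finally show ?thesis .
  qed
  moreover have "(LINT \<nu>|lebesgue. fourier_int x \<nu> * cnj (fourier_int y \<nu>) * E \<nu>)
      = (LINT u|lebesgue. x u * fourier_int w u)"
    by (subst fourier_int_multiplication[OF x w, symmetric]) (simp add: w_def mult_ac)
  ultimately show ?thesis by (simp add: E_def)
qed

text \<open>The antiderivative \<open>2 * arctan (v / e)\<close> gives \<open>pi\<close> on each
  half line. The half lines overlap at 0, and the upper bound is what the norm estimate
  uses.\<close>

lemma nn_integral_poisson: "0 < e \<Longrightarrow> (\<integral>\<^sup>+v. ennreal (poisson e (u - v)) \<partial>lebesgue) \<le> ennreal (2 * pi)"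
proof -
  assume e: "0 < e"
  have half: "(\<integral>\<^sup>+v. ennreal (poisson e v) * indicator {0..} v \<partial>lebesgue) = ennreal pi"
  proof -
    have "(\<integral>\<^sup>+v. ennreal (poisson e v) * indicator {0..} v \<partial>lborel) = ennreal (pi - 2 * arctan (0 / e))"
    proof (rule nn_integral_FTC_atLeast)
      show "((\<lambda>v. 2 * arctan (v / e)) has_real_derivative poisson e v) (at v)" for v
        using e by (auto intro!: derivative_eq_intros simp: poisson_def field_simps power2_eq_square)
      have "((\<lambda>v. 2 * arctan (v / e)) \<longlongrightarrow> 2 * (pi / 2)) at_top"
        by (intro tendsto_intros filterlim_compose[OF tendsto_arctan_at_top])
          (use e in \<open>auto intro!: filterlim_at_top_mult_tendsto_pos[OF tendsto_const _ filterlim_ident] simp: divide_inverse\<close>)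
      then show "((\<lambda>v. 2 * arctan (v / e)) \<longlongrightarrow> pi) at_top" by simp
    qed (use e in \<open>auto simp: poisson_nonneg\<close>)
    then show ?thesis by (simp add: nn_integral_completion)
  qed
  have half': "(\<integral>\<^sup>+v. ennreal (poisson e v) * indicator {0..} (- v) \<partial>lebesgue) = ennreal pi"
    using nn_integral_real_affine_lebesgue[of "\<lambda>v. ennreal (poisson e v) * indicator {0..} (- v)" "-1" 0] half
    by simp
  have "(\<integral>\<^sup>+v. ennreal (poisson e (u - v)) \<partial>lebesgue) = (\<integral>\<^sup>+v. ennreal (poisson e v) \<partial>lebesgue)"
    using nn_integral_real_affine_lebesgue[of "\<lambda>v. ennreal (poisson e v)" "-1" u] by simp
  also have "\<dots> \<le> (\<integral>\<^sup>+v. ennreal (poisson e v) * indicator {0..} v + ennreal (poisson e v) * indicator {0..} (- v) \<partial>lebesgue)"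
    by (intro nn_integral_mono) (auto simp: indicator_def)
  also have "\<dots> = ennreal pi + ennreal pi"
    by (subst nn_integral_add) (auto simp: half half')
  also have "\<dots> = ennreal (2 * pi)" by (simp flip: ennreal_plus)
  finally show ?thesis .
qed

lemma ennreal_norm_lebesgue_integral_le:
  fixes f :: "'a \<Rightarrow> complex"
  shows "ennreal (cmod (LINT t|M. f t)) \<le> (\<integral>\<^sup>+t. ennreal (cmod (f t)) \<partial>M)"
  by (cases "integrable M f") (auto simp: integral_norm_bound_ennreal not_integrable_integral_eq)

text \<open>Schur's test: split the product of the two values of \<open>x\<close> by the inequality
  between geometric and arithmetic mean, then integrate out the variable that occurs only in the
  kernel, whose mass is at most \<open>2 * pi\<close>.\<close>

lemma nn_integral_poisson_bilinear:
  fixes x :: "real \<Rightarrow> complex"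
  assumes x: "x \<in> L2 lebesgue" and e: "0 < e"
  shows "(\<integral>\<^sup>+u. ennreal (cmod (x u)) * (\<integral>\<^sup>+v. ennreal (cmod (x v) * poisson e (u - v)) \<partial>lebesgue) \<partial>lebesgue)
      \<le> ennreal (2 * pi * L2_sq lebesgue x)"
proof -
  have [measurable]: "x \<in> borel_measurable lebesgue" using x by measurable
  have pw: "cmod (x u) * (cmod (x v) * poisson e (u - v))
      \<le> (cmod (x u))\<^sup>2 / 2 * poisson e (u - v) + (cmod (x v))\<^sup>2 / 2 * poisson e (v - u)" for u v
  proof -
    have "cmod (x u) * cmod (x v) \<le> ((cmod (x u))\<^sup>2 + (cmod (x v))\<^sup>2) / 2"
      using cmod_mult_le_sq[of "x u" "x v"] by (simp add: norm_mult)
    from mult_right_mono[OF this poisson_nonneg[OF e, of "u - v"]]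
    show ?thesis using poisson_minus[of e "u - v"] by (simp add: algebra_simps add_divide_distrib)
  qed
  have one: "(\<integral>\<^sup>+u. \<integral>\<^sup>+v. ennreal ((cmod (x u))\<^sup>2 / 2 * poisson e (u - v)) \<partial>lebesgue \<partial>lebesgue)
      \<le> ennreal (pi * L2_sq lebesgue x)"
  proof -
    have "(\<integral>\<^sup>+u. \<integral>\<^sup>+v. ennreal ((cmod (x u))\<^sup>2 / 2 * poisson e (u - v)) \<partial>lebesgue \<partial>lebesgue)
        = (\<integral>\<^sup>+u. ennreal ((cmod (x u))\<^sup>2 / 2) * (\<integral>\<^sup>+v. ennreal (poisson e (u - v)) \<partial>lebesgue) \<partial>lebesgue)"
    proof (rule nn_integral_cong)
      fix u
      show "(\<integral>\<^sup>+v. ennreal ((cmod (x u))\<^sup>2 / 2 * poisson e (u - v)) \<partial>lebesgue)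
          = ennreal ((cmod (x u))\<^sup>2 / 2) * (\<integral>\<^sup>+v. ennreal (poisson e (u - v)) \<partial>lebesgue)"
        by (subst nn_integral_cmult[symmetric]) (auto simp: ennreal_mult poisson_nonneg e simp del: times_divide_eq_left)
    qed
    also have "\<dots> \<le> (\<integral>\<^sup>+u. ennreal ((cmod (x u))\<^sup>2 / 2) * ennreal (2 * pi) \<partial>lebesgue)"
      by (intro nn_integral_mono mult_left_mono nn_integral_poisson e) auto
    also have "\<dots> = (\<integral>\<^sup>+u. ennreal pi * ennreal ((cmod (x u))\<^sup>2) \<partial>lebesgue)"
      by (intro nn_integral_cong) (simp add: mult.commute flip: ennreal_mult)
    also have "\<dots> = ennreal pi * ennreal (L2_sq lebesgue x)"
      by (subst nn_integral_cmult) (auto simp: nn_integral_eq_L2_sq[OF x])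
    finally show ?thesis by (simp add: ennreal_mult)
  qed
  have two: "(\<integral>\<^sup>+u. \<integral>\<^sup>+v. ennreal ((cmod (x v))\<^sup>2 / 2 * poisson e (v - u)) \<partial>lebesgue \<partial>lebesgue)
      \<le> ennreal (pi * L2_sq lebesgue x)"
    by (subst lebesgue_pair.Fubini') (measurable, rule one)
  have "(\<integral>\<^sup>+u. ennreal (cmod (x u)) * (\<integral>\<^sup>+v. ennreal (cmod (x v) * poisson e (u - v)) \<partial>lebesgue) \<partial>lebesgue)
      = (\<integral>\<^sup>+u. \<integral>\<^sup>+v. ennreal (cmod (x u) * (cmod (x v) * poisson e (u - v))) \<partial>lebesgue \<partial>lebesgue)"
    by (simp add: ennreal_mult poisson_nonneg e nn_integral_cmult)
  also have "\<dots> \<le> (\<integral>\<^sup>+u. \<integral>\<^sup>+v. ennreal ((cmod (x u))\<^sup>2 / 2 * poisson e (u - v))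
      + ennreal ((cmod (x v))\<^sup>2 / 2 * poisson e (v - u)) \<partial>lebesgue \<partial>lebesgue)"
    by (intro nn_integral_mono) (use pw poisson_nonneg[OF e] in \<open>auto simp flip: ennreal_plus intro!: ennreal_leI\<close>)
  also have "\<dots> = (\<integral>\<^sup>+u. (\<integral>\<^sup>+v. ennreal ((cmod (x u))\<^sup>2 / 2 * poisson e (u - v)) \<partial>lebesgue)
      + (\<integral>\<^sup>+v. ennreal ((cmod (x v))\<^sup>2 / 2 * poisson e (v - u)) \<partial>lebesgue) \<partial>lebesgue)"
    by (intro nn_integral_cong nn_integral_add) measurable
  also have "\<dots> = (\<integral>\<^sup>+u. \<integral>\<^sup>+v. ennreal ((cmod (x u))\<^sup>2 / 2 * poisson e (u - v)) \<partial>lebesgue \<partial>lebesgue)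
      + (\<integral>\<^sup>+u. \<integral>\<^sup>+v. ennreal ((cmod (x v))\<^sup>2 / 2 * poisson e (v - u)) \<partial>lebesgue \<partial>lebesgue)"
    by (intro nn_integral_add) measurable
  also have "\<dots> \<le> ennreal (pi * L2_sq lebesgue x) + ennreal (pi * L2_sq lebesgue x)"
    by (intro add_mono one two)
  also have "\<dots> = ennreal (2 * pi * L2_sq lebesgue x)" by (simp flip: ennreal_plus)
  finally show ?thesis .
qed

text \<open>The inequality half of Plancherel's theorem. Damping makes the bounded transform square
  integrable, the Abel identity and Schur's test bound its norm independently of the damping, and
  Fatou's lemma removes the damping.\<close>

lemma fourier_int_L2:
  assumes x1: "integrable lebesgue x" and x2: "x \<in> L2 lebesgue"
  shows "fourier_int x \<in> L2 lebesgue" and "L2_sq lebesgue (fourier_int x) \<le> 2 * pi * L2_sq lebesgue x"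
proof -
  \<comment> \<open>Squaring the modulus doubles the exponent, so the Abel identity is applied with
    parameter \<open>2 * d n\<close>.\<close>
  define d where "d n = 1 / (2 * real (Suc n))" for n
  have d: "0 < d n" for n by (simp add: d_def)
  define z where "z n \<nu> = fourier_int x \<nu> * complex_of_real (exp (- d n * \<bar>\<nu>\<bar>))" for n \<nu>
  note [measurable] = borel_measurable_fourier_int[OF x1]
  have cz: "complex_of_real ((cmod (z n \<nu>))\<^sup>2)
      = fourier_int x \<nu> * cnj (fourier_int x \<nu>) * of_real (exp (- (2 * d n) * \<bar>\<nu>\<bar>))" for n \<nu>
  proof -
    have "exp (- (2 * d n) * \<bar>\<nu>\<bar>) = (exp (- d n * \<bar>\<nu>\<bar>))\<^sup>2" by (simp flip: exp_double)
    then show ?thesis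
      by (simp add: z_def norm_mult power_mult_distrib flip: complex_norm_square)
  qed
  have zL: "z n \<in> L2 lebesgue" for n
    unfolding L2_def
  proof (intro CollectI conjI)
    show "z n \<in> borel_measurable lebesgue" unfolding z_def by measurable
    have "integrable lebesgue (\<lambda>\<nu>. complex_of_real (exp (- (2 * d n) * \<bar>\<nu>\<bar>)) * (fourier_int x \<nu> * cnj (fourier_int x \<nu>)))"
    proof (rule integrable_bounded_mult)
      show "cmod (fourier_int x \<nu> * cnj (fourier_int x \<nu>)) \<le> (LINT u|lebesgue. cmod (x u)) * (LINT u|lebesgue. cmod (x u))" for \<nu>
        unfolding norm_mult by (intro mult_mono) (auto simp: fourier_int_bound integral_nonneg_AE)
    qed (use fourier_int_exp_abs(1)[of "2 * d n"] d in auto)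
    then have "integrable lebesgue (\<lambda>\<nu>. complex_of_real ((cmod (z n \<nu>))\<^sup>2))"
      unfolding cz by (simp add: mult_ac)
    then show "integrable lebesgue (\<lambda>\<nu>. (cmod (z n \<nu>))\<^sup>2)"
      unfolding complex_of_real_integrable_eq .
  qed
  have zsq: "L2_sq lebesgue (z n) \<le> 2 * pi * L2_sq lebesgue x" for n
  proof -
    have "complex_of_real (L2_sq lebesgue (z n))
        = (LINT u|lebesgue. x u * (LINT v|lebesgue. cnj (x v) * of_real (poisson (2 * d n) (u - v))))"
      unfolding L2_sq_def integral_complex_of_real[symmetric] cz
      by (rule fourier_int_Abel[OF x1 x1]) (use d in simp)
    then have "ennreal (L2_sq lebesgue (z n))
        = ennreal (cmod (LINT u|lebesgue. x u * (LINT v|lebesgue. cnj (x v) * of_real (poisson (2 * d n) (u - v)))))"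
      by (metis L2_sq_nonneg abs_of_nonneg norm_of_real)
    also have "\<dots> \<le> (\<integral>\<^sup>+u. ennreal (cmod (x u)) * (\<integral>\<^sup>+v. ennreal (cmod (x v) * poisson (2 * d n) (u - v)) \<partial>lebesgue) \<partial>lebesgue)"
    proof (rule order_trans[OF ennreal_norm_lebesgue_integral_le], rule nn_integral_mono)
      fix u
      have "ennreal (cmod (LINT v|lebesgue. cnj (x v) * of_real (poisson (2 * d n) (u - v))))
          \<le> (\<integral>\<^sup>+v. ennreal (cmod (x v) * poisson (2 * d n) (u - v)) \<partial>lebesgue)"
        by (rule order_trans[OF ennreal_norm_lebesgue_integral_le])
          (use d in \<open>auto simp: norm_mult poisson_nonneg\<close>)
      then show "ennreal (cmod (x u * (LINT v|lebesgue. cnj (x v) * of_real (poisson (2 * d n) (u - v)))))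
          \<le> ennreal (cmod (x u)) * (\<integral>\<^sup>+v. ennreal (cmod (x v) * poisson (2 * d n) (u - v)) \<partial>lebesgue)"
        by (simp add: norm_mult ennreal_mult mult_left_mono)
    qed
    also have "\<dots> \<le> ennreal (2 * pi * L2_sq lebesgue x)"
      by (rule nn_integral_poisson_bilinear[OF x2]) (use d in simp)
    finally show ?thesis by simp
  qed
  have "AE \<nu> in lebesgue. (\<lambda>n. z n \<nu>) \<longlonglongrightarrow> fourier_int x \<nu>"
  proof (rule AE_I2)
    fix \<nu>
    have "d \<longlonglongrightarrow> 0"
      unfolding d_def using tendsto_mult_right[OF LIMSEQ_inverse_real_of_nat, of "1/2"]
      by (simp add: inverse_eq_divide mult.commute del: of_nat_Suc)
    then have "(\<lambda>n. z n \<nu>) \<longlonglongrightarrow> fourier_int x \<nu> * complex_of_real (exp (- 0 * \<bar>\<nu>\<bar>))"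
      unfolding z_def by (intro tendsto_intros)
    then show "(\<lambda>n. z n \<nu>) \<longlonglongrightarrow> fourier_int x \<nu>" by simp
  qed
  from L2_Fatou[OF zL _ this, of "2 * pi * L2_sq lebesgue x"] zsq
  show "fourier_int x \<in> L2 lebesgue" "L2_sq lebesgue (fourier_int x) \<le> 2 * pi * L2_sq lebesgue x"
    by auto
qed

section \<open>The Poisson kernel as an approximate identity, tested on intervals\<close>

lemma interval_poisson:
  assumes e: "0 < e" and "a \<le> b"
  shows "(LINT v|lebesgue. cnj (indicator {a..b} v) * complex_of_real (poisson e (u - v)))
    = of_real (2 * arctan ((b - u) / e) - 2 * arctan ((a - u) / e))"
proof -
  have "(LINT v|lborel. indicator {a..b} v *\<^sub>R poisson e (u - v)) = 2 * arctan ((b - u) / e) - 2 * arctan ((a - u) / e)"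
  proof (rule integral_FTC_atLeastAtMost[OF \<open>a \<le> b\<close>])
    fix v
    have "((\<lambda>v. 2 * arctan ((v - u) / e)) has_real_derivative poisson e (u - v)) (at v within {a..b})"
      using e by (auto intro!: derivative_eq_intros simp: poisson_def field_simps power2_eq_square)
    then show "((\<lambda>v. 2 * arctan ((v - u) / e)) has_vector_derivative poisson e (u - v)) (at v within {a..b})"
      by (simp add: has_real_derivative_iff_has_vector_derivative)
  next
    have "e\<^sup>2 + (u - v)\<^sup>2 \<noteq> 0" for v using e by (simp add: add_nonneg_eq_0_iff)
    then show "continuous_on {a..b} (\<lambda>v. poisson e (u - v))"
      unfolding poisson_def by (intro continuous_intros) auto
  qed
  then have "(LINT v|lebesgue. indicator {a..b} v *\<^sub>R poisson e (u - v)) = 2 * arctan ((b - u) / e) - 2 * arctan ((a - u) / e)"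
    by (subst integral_completion) auto
  moreover have "(\<lambda>v. cnj (indicator {a..b} v) * complex_of_real (poisson e (u - v)))
      = (\<lambda>v. of_real (indicator {a..b} v *\<^sub>R poisson e (u - v)))"
    by (auto simp: indicator_def)
  ultimately show ?thesis by (simp only: integral_complex_of_real)
qed

lemma tendsto_arctan_inverse_scale:
  assumes "c \<noteq> 0"
  shows "(\<lambda>n. arctan (c / (1 / real (Suc n)))) \<longlonglongrightarrow> sgn c * (pi / 2)"
proof (cases "0 < c")
  case True
  have "filterlim (\<lambda>n. c * real (Suc n)) at_top sequentially"
    using True by (intro filterlim_tendsto_pos_mult_at_top[OF tendsto_const] 
        filterlim_compose[OF filterlim_real_sequentially filterlim_Suc]) auto
  from filterlim_compose[OF tendsto_arctan_at_top this] True show ?thesis by simp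
next
  case False
  with assms have "c < 0" by simp
  then have "filterlim (\<lambda>n. c * real (Suc n)) at_bot sequentially"
    by (intro filterlim_tendsto_neg_mult_at_bot[OF tendsto_const] 
        filterlim_compose[OF filterlim_real_sequentially filterlim_Suc]) auto
  from filterlim_compose[OF tendsto_arctan_at_bot this] \<open>c < 0\<close> show ?thesis by simp
qed

text \<open>Smoothing an interval gives a difference of two arctangents: bounded by
  \<open>2 * pi\<close>, and convergent to \<open>2 * pi\<close> times the indicator off the two
  endpoints. Dominated convergence therefore works for every integrable \<open>x\<close>.\<close>

lemma interval_poisson_limit:
  fixes x :: "real \<Rightarrow> complex"
  assumes x: "integrable lebesgue x" and ab: "a < b"
  shows "(\<lambda>n. LINT u|lebesgue. x u * (LINT v|lebesgue. cnj (indicator {a..b} v) * complex_of_real (poisson (1 / real (Suc n)) (u - v))))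
    \<longlonglongrightarrow> 2 * pi * (LINT u|lebesgue. x u * indicator {a..b} u)"
proof -
  have [measurable]: "x \<in> borel_measurable lebesgue" using x by auto
  define q where "q n u = 2 * arctan ((b - u) / (1 / real (Suc n))) - 2 * arctan ((a - u) / (1 / real (Suc n)))" for n u
  have "(\<lambda>n. LINT u|lebesgue. x u * complex_of_real (q n u)) \<longlonglongrightarrow> (LINT u|lebesgue. x u * complex_of_real (2 * pi * indicator {a..b} u))"
  proof (rule integral_dominated_convergence)
    show "integrable lebesgue (\<lambda>u. 2 * pi * cmod (x u))" using x by simp
    have "AE u in lebesgue. u \<noteq> a \<and> u \<noteq> b"
      using AE_completion[OF AE_lborel_singleton[of a]] AE_completion[OF AE_lborel_singleton[of b]] by auto
    then show "AE u in lebesgue. (\<lambda>n. x u * complex_of_real (q n u)) \<longlonglongrightarrow> x u * complex_of_real (2 * pi * indicator {a..b} u)"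
    proof eventually_elim
      case (elim u)
      have "(\<lambda>n. q n u) \<longlonglongrightarrow> 2 * (sgn (b - u) * (pi / 2)) - 2 * (sgn (a - u) * (pi / 2))"
        unfolding q_def using elim by (intro tendsto_intros tendsto_arctan_inverse_scale) auto
      also have "2 * (sgn (b - u) * (pi / 2)) - 2 * (sgn (a - u) * (pi / 2)) = 2 * pi * indicator {a..b} u"
        using elim ab by (auto simp: indicator_def sgn_if)
      finally show ?case by (intro tendsto_intros)
    qed
    show "AE u in lebesgue. norm (x u * complex_of_real (q n u)) \<le> 2 * pi * cmod (x u)" for n
    proof (rule AE_I2)
      fix u
      have "\<bar>q n u\<bar> \<le> 2 * pi"
        unfolding q_def using arctan_bounded[of "(b - u) / (1 / real (Suc n))"] arctan_bounded[of "(a - u) / (1 / real (Suc n))"]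
        by linarith
      then show "norm (x u * complex_of_real (q n u)) \<le> 2 * pi * cmod (x u)"
        by (simp add: norm_mult mult.commute mult_left_mono)
    qed
    show "(\<lambda>u. x u * complex_of_real (q n u)) \<in> borel_measurable lebesgue" for n
      unfolding q_def by measurable
  qed measurable
  moreover have "(LINT u|lebesgue. x u * complex_of_real (2 * pi * indicator {a..b} u)) = 2 * pi * (LINT u|lebesgue. x u * indicator {a..b} u)"
    by (subst integral_mult_right_zero[symmetric], intro Bochner_Integration.integral_cong) (auto simp: indicator_def)
  ultimately show ?thesis
    using ab by (simp add: interval_poisson q_def del: of_nat_Suc)
qed

text \<open>The positive and the negative part of \<open>w\<close>, taken as densities, agree on all
  right half lines and therefore as measures. On the set where \<open>w\<close> is positive the
  second has no mass.\<close>

lemma AE_nonpos_if_interval_integrals_eq_0: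
  fixes w :: "real \<Rightarrow> real"
  assumes w: "integrable lebesgue w"
    and zero: "\<And>a b. a < b \<Longrightarrow> (LINT u|lebesgue. w u * indicator {a..b} u) = 0"
  shows "AE u in lebesgue. w u \<le> 0"
proof -
  have wm [measurable]: "w \<in> borel_measurable lebesgue" using w by auto
  \<comment> \<open>Half lines determine Borel measures, so the argument moves from Lebesgue measure
    to a Borel representative.\<close>
  obtain w' where w'b [measurable]: "w' \<in> borel_measurable lborel" and "AE u in lborel. w u = w' u"
    using completion_ex_borel_measurable_real[OF wm] by auto
  then have eq: "AE u in lebesgue. w u = w' u" by (intro AE_completion)
  have w'm [measurable]: "w' \<in> borel_measurable lebesgue" using w'b by (rule measurable_completion)
  have "integrable lebesgue w'" by (rule integrable_cong_AE_imp[OF w w'm]) (use eq in \<open>auto simp: eq_commute\<close>)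
  then have w': "integrable lborel w'" using integrable_completion[OF w'b] by simp
  have "(LINT u|lborel. w' u * indicator {x<..} u) = 0" for x
  proof -
    have "(\<lambda>n. LINT u|lebesgue. w u * indicator {x..x + real (Suc n)} u) \<longlonglongrightarrow> (LINT u|lebesgue. w' u * indicator {x<..} u)"
    proof (rule integral_dominated_convergence)
      show "integrable lebesgue (\<lambda>u. \<bar>w u\<bar>)" using w by simp
      show "AE u in lebesgue. (\<lambda>n. w u * indicator {x..x + real (Suc n)} u) \<longlonglongrightarrow> w' u * indicator {x<..} u"
        using eq AE_completion[OF AE_lborel_singleton[of x]]
      proof eventually_elim
        case (elim u)
        obtain n0 where n0: "u - x \<le> real n0" using real_arch_simple by blast
        have "eventually (\<lambda>n. w u * indicator {x..x + real (Suc n)} u = w' u * indicator {x<..} u) sequentially"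
          by (rule eventually_sequentiallyI[of n0]) (use n0 elim in \<open>auto simp: indicator_def\<close>)
        then show ?case by (rule tendsto_eventually)
      qed
      show "AE u in lebesgue. norm (w u * indicator {x..x + real (Suc n)} u) \<le> \<bar>w u\<bar>" for n
        by (auto simp: indicator_def)
    qed measurable
    then have "(LINT u|lebesgue. w' u * indicator {x<..} u) = 0"
      using zero[of x "x + real (Suc n)" for n] by (simp add: LIMSEQ_const_iff)
    then show ?thesis by (subst (asm) integral_completion) auto
  qed note Z = this
  \<comment> \<open>\<open>ennreal\<close> sends negative reals to 0, so these densities are the
    positive and the negative part of \<open>w'\<close>.\<close>
  define M where "M = density lborel (\<lambda>u. ennreal (w' u))"
  define N where "N = density lborel (\<lambda>u. ennreal (- w' u))"
  have fin: "(\<integral>\<^sup>+u. ennreal (w' u * indicator {x<..} u) \<partial>lborel) < \<infinity>"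
    "(\<integral>\<^sup>+u. ennreal (- (w' u * indicator {x<..} u)) \<partial>lborel) < \<infinity>" for x
  proof -
    have "integrable lborel (\<lambda>u. w' u * indicator {x<..} u)"
      using w' by (intro integrable_real_mult_indicator) auto
    then show "(\<integral>\<^sup>+u. ennreal (w' u * indicator {x<..} u) \<partial>lborel) < \<infinity>"
      "(\<integral>\<^sup>+u. ennreal (- (w' u * indicator {x<..} u)) \<partial>lborel) < \<infinity>"
      unfolding real_integrable_def by (auto simp: less_top)
  qed
  have Mx: "emeasure M {x<..} = (\<integral>\<^sup>+u. ennreal (w' u * indicator {x<..} u) \<partial>lborel)" for x
    unfolding M_def by (subst emeasure_density) (auto intro!: nn_integral_cong simp: indicator_def)
  have Nx: "emeasure N {x<..} = (\<integral>\<^sup>+u. ennreal (- (w' u * indicator {x<..} u)) \<partial>lborel)" for x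
    unfolding N_def by (subst emeasure_density) (auto intro!: nn_integral_cong simp: indicator_def)
  have MN: "M = N"
  proof (rule measure_eqI_lessThan)
    show "emeasure M {x<..} < \<infinity>" for x using fin by (simp add: Mx)
    fix x
    have "integrable lborel (\<lambda>u. w' u * indicator {x<..} u)"
      using w' by (intro integrable_real_mult_indicator) auto
    from real_lebesgue_integral_def[OF this] Z[of x]
    have "enn2real (emeasure M {x<..}) = enn2real (emeasure N {x<..})" by (simp add: Mx Nx)
    then show "emeasure M {x<..} = emeasure N {x<..}"
      using fin[of x] unfolding Mx[symmetric] Nx[symmetric]
      by (metis ennreal_enn2real infinity_ennreal_def)
  qed (auto simp: M_def N_def)
  have "AE u in lborel. w' u \<le> 0"
  proof -
    have "(\<integral>\<^sup>+u. ennreal (w' u) * indicator {u. 0 < w' u} u \<partial>lborel) = emeasure M {u. 0 < w' u}"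
      unfolding M_def by (subst emeasure_density) auto
    also have "\<dots> = (\<integral>\<^sup>+u. ennreal (- w' u) * indicator {u. 0 < w' u} u \<partial>lborel)"
      unfolding MN unfolding N_def by (subst emeasure_density) auto
    also have "\<dots> = (\<integral>\<^sup>+u. 0 \<partial>(lborel :: real measure))" by (rule nn_integral_cong) (auto simp: indicator_def ennreal_neg)
    finally have "AE u in lborel. ennreal (w' u) * indicator {u. 0 < w' u} u = 0"
      by (simp add: nn_integral_0_iff_AE)
    then show ?thesis by eventually_elim (auto simp: indicator_def ennreal_eq_0_iff split: if_splits)
  qed
  then have "AE u in lebesgue. w' u \<le> 0" by (rule AE_completion)
  with eq show ?thesis by eventually_elim simp
qed

lemma AE_eq_0_if_interval_integrals_eq_0_real:
  fixes w :: "real \<Rightarrow> real"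
  assumes "integrable lebesgue w"
    and "\<And>a b. a < b \<Longrightarrow> (LINT u|lebesgue. w u * indicator {a..b} u) = 0"
  shows "AE u in lebesgue. w u = 0"
proof -
  have "AE u in lebesgue. w u \<le> 0" "AE u in lebesgue. - w u \<le> 0"
    by (rule AE_nonpos_if_interval_integrals_eq_0; use assms in simp)+
  then show ?thesis by eventually_elim simp
qed

lemma AE_eq_0_if_interval_integrals_eq_0:
  fixes x :: "real \<Rightarrow> complex"
  assumes x: "integrable lebesgue x"
    and zero: "\<And>a b. a < b \<Longrightarrow> (LINT u|lebesgue. x u * indicator {a..b} u) = 0"
  shows "AE u in lebesgue. x u = 0"
proof -
  have int: "integrable lebesgue (\<lambda>u. x u * indicator {a..b} u)" for a b :: real
    by (rule integrable_bounded_mult[OF x, where c = 1]) (auto simp: indicator_def)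
  have "AE u in lebesgue. Re (x u) = 0"
  proof (rule AE_eq_0_if_interval_integrals_eq_0_real)
    fix a b :: real assume "a < b"
    have "(LINT u|lebesgue. Re (x u) * indicator {a..b} u) = (LINT u|lebesgue. Re (x u * indicator {a..b} u))"
      by (intro Bochner_Integration.integral_cong) (auto simp: indicator_def)
    then show "(LINT u|lebesgue. Re (x u) * indicator {a..b} u) = 0"
      using zero[OF \<open>a < b\<close>] by (simp only: integral_Re[OF int] zero_complex.simps)
  qed (use x in simp)
  moreover have "AE u in lebesgue. Im (x u) = 0"
  proof (rule AE_eq_0_if_interval_integrals_eq_0_real)
    fix a b :: real assume "a < b"
    have "(LINT u|lebesgue. Im (x u) * indicator {a..b} u) = (LINT u|lebesgue. Im (x u * indicator {a..b} u))"
      by (intro Bochner_Integration.integral_cong) (auto simp: indicator_def)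
    then show "(LINT u|lebesgue. Im (x u) * indicator {a..b} u) = 0"
      using zero[OF \<open>a < b\<close>] by (simp only: integral_Im[OF int] zero_complex.simps)
  qed (use x in simp)
  ultimately show ?thesis by eventually_elim (simp add: complex_eq_iff)
qed

lemma indicator_interval_L1_L2:
  fixes a b :: real
  shows "integrable lebesgue (indicator {a..b} :: real \<Rightarrow> complex)"
    and "(indicator {a..b} :: real \<Rightarrow> complex) \<in> L2 lebesgue"
proof -
  have r: "integrable lebesgue (indicator {a..b} :: real \<Rightarrow> real)" by (simp add: emeasure_lborel_Icc_eq)
  have "(indicator {a..b} :: real \<Rightarrow> complex) = (\<lambda>t. of_real (indicator {a..b} t))"
    by (auto simp: indicator_def)
  then show "integrable lebesgue (indicator {a..b} :: real \<Rightarrow> complex)" using r by simp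
  have "(\<lambda>t. (cmod (indicator {a..b} t))\<^sup>2) = (indicator {a..b} :: real \<Rightarrow> real)" by (auto simp: indicator_def)
  then show "(indicator {a..b} :: real \<Rightarrow> complex) \<in> L2 lebesgue" using r by (simp add: L2_def)
qed

text \<open>Pair with an interval in the Abel identity: the spectral side is zero at every level of
  damping, and the other side tends to \<open>2 * pi\<close> times the integral of \<open>x\<close>
  over the interval.\<close>

lemma fourier_int_unique:
  fixes x :: "real \<Rightarrow> complex"
  assumes x: "integrable lebesgue x" and zero: "\<And>\<nu>. fourier_int x \<nu> = 0"
  shows "AE u in lebesgue. x u = 0"
proof (rule AE_eq_0_if_interval_integrals_eq_0[OF x])
  fix a b :: real assume "a < b"
  from interval_poisson_limit[OF x this]
  have "(\<lambda>n. 0) \<longlonglongrightarrow> 2 * complex_of_real pi * (LINT u|lebesgue. x u * indicator {a..b} u)"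
    by (subst (asm) fourier_int_Abel[OF x indicator_interval_L1_L2(1), symmetric]) (auto simp: zero)
  then show "(LINT u|lebesgue. x u * indicator {a..b} u) = 0" by (simp add: LIMSEQ_const_iff)
qed

text \<open>Local integrability is enough, because cutting to \<open>{- n..n}\<close> replaces
  intervals by intervals. This covers square integrable functions, and the sum of a bounded and an
  integrable function in the inversion theorem for L1.\<close>

lemma locally_eq_0_if_interval_integrals_eq_0:
  fixes x :: "real \<Rightarrow> complex"
  assumes x: "\<And>a b. integrable lebesgue (\<lambda>u. x u * indicator {a..b} u)"
    and zero: "\<And>a b. a < b \<Longrightarrow> (LINT u|lebesgue. x u * indicator {a..b} u) = 0"
  shows "AE u in lebesgue. x u = 0"
proof -
  have "AE u in lebesgue. x u * indicator {- real n..real n} u = 0" for n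
  proof (rule AE_eq_0_if_interval_integrals_eq_0)
    show "integrable lebesgue (\<lambda>u. x u * indicator {- real n..real n} u)"
      by (rule x)
    fix a b :: real assume "a < b"
    define a' b' where "a' = max a (- real n)" and "b' = min b (real n)"
    have "(LINT u|lebesgue. x u * indicator {a'..b'} u) = 0"
    proof (cases "a' < b'")
      case True then show ?thesis by (rule zero)
    next
      case False
      have "AE u in lebesgue. x u * indicator {a'..b'} u = 0"
        using AE_completion[OF AE_lborel_singleton[of a']]
          by eventually_elim (use False in \<open>auto simp: indicator_def\<close>)
      then show ?thesis by (rule integral_eq_zero_AE)
    qed
    moreover have "(\<lambda>u. x u * indicator {- real n..real n} u * indicator {a..b} u) = (\<lambda>u. x u * indicator {a'..b'} u)"
      by (auto simp: indicator_def a'_def b'_def)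
    ultimately show "(LINT u|lebesgue. x u * indicator {- real n..real n} u * indicator {a..b} u) = 0" by simp
  qed
  then have "AE u in lebesgue. \<forall>n. x u * indicator {- real n..real n} u = 0" unfolding AE_all_countable by blast
  then show ?thesis
  proof eventually_elim
    case (elim u)
    obtain n where "\<bar>u\<bar> \<le> real n" using real_arch_simple by blast
    then have "u \<in> {- real n..real n}" by (simp add: abs_le_iff)
    with elim[rule_format, of n] show ?case by (simp add: indicator_def)
  qed
qed

lemma L2_eq_0_if_interval_integrals_eq_0:
  fixes x :: "real \<Rightarrow> complex"
  assumes x: "x \<in> L2 lebesgue"
    and zero: "\<And>a b. a < b \<Longrightarrow> (LINT u|lebesgue. x u * indicator {a..b} u) = 0"
  shows "AE u in lebesgue. x u = 0"
  by (rule locally_eq_0_if_interval_integrals_eq_0[OF L2_mult_integrable[OF x indicator_interval_L1_L2(2)] zero])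

text \<open>Parseval against an interval, assuming only that the product of transforms is
  integrable; the damping is then removed by dominated convergence. Both the L2 theory and the L1
  inversion start here.\<close>

lemma fourier_int_interval:
  fixes x :: "real \<Rightarrow> complex"
  assumes x: "integrable lebesgue x" and ab: "a < b"
    and int: "integrable lebesgue (\<lambda>\<nu>. fourier_int x \<nu> * cnj (fourier_int (indicator {a..b}) \<nu>))"
  shows "(LINT \<nu>|lebesgue. fourier_int x \<nu> * cnj (fourier_int (indicator {a..b}) \<nu>))
       = 2 * pi * (LINT u|lebesgue. x u * indicator {a..b} u)"
proof -
  let ?I = "indicator {a..b} :: real \<Rightarrow> complex"
  note I = indicator_interval_L1_L2(1)[of a b]
  define H where "H \<nu> = fourier_int x \<nu> * cnj (fourier_int ?I \<nu>)" for \<nu>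
  define E where "E n \<nu> = exp (- (1 / real (Suc n)) * \<bar>\<nu>\<bar>)" for n \<nu>
  have H: "integrable lebesgue H" using int by (simp add: H_def[abs_def])
  have "(\<lambda>n. LINT \<nu>|lebesgue. H \<nu> * of_real (E n \<nu>)) \<longlonglongrightarrow> (LINT \<nu>|lebesgue. H \<nu>)"
  proof (rule integral_dominated_convergence)
    show "integrable lebesgue (\<lambda>\<nu>. cmod (H \<nu>))" using H by (rule integrable_norm)
    show "AE \<nu> in lebesgue. (\<lambda>n. H \<nu> * of_real (E n \<nu>)) \<longlonglongrightarrow> H \<nu>"
    proof (rule AE_I2)
      fix \<nu>
      have "(\<lambda>n. H \<nu> * of_real (E n \<nu>)) \<longlonglongrightarrow> H \<nu> * of_real (exp (- 0 * \<bar>\<nu>\<bar>))"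
        unfolding E_def using LIMSEQ_inverse_real_of_nat unfolding inverse_eq_divide by (intro tendsto_intros)
      then show "(\<lambda>n. H \<nu> * of_real (E n \<nu>)) \<longlonglongrightarrow> H \<nu>" by simp
    qed
    show "AE \<nu> in lebesgue. norm (H \<nu> * of_real (E n \<nu>)) \<le> cmod (H \<nu>)" for n
      by (rule AE_I2, subst norm_mult) (auto simp: E_def intro!: mult_left_le)
    show "(\<lambda>\<nu>. H \<nu> * of_real (E n \<nu>)) \<in> borel_measurable lebesgue" for n
      using borel_measurable_integrable[OF H] unfolding E_def by measurable
  qed (use H in auto)
  moreover have "(LINT \<nu>|lebesgue. H \<nu> * of_real (E n \<nu>))
      = (LINT u|lebesgue. x u * (LINT v|lebesgue. cnj (?I v) * complex_of_real (poisson (1 / real (Suc n)) (u - v))))" for n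
    unfolding H_def E_def by (rule fourier_int_Abel[OF x I]) simp
  ultimately show ?thesis
    using LIMSEQ_unique[OF interval_poisson_limit[OF x ab]] by (simp add: H_def)
qed

lemma parseval_interval:
  fixes x :: "real \<Rightarrow> complex"
  assumes "integrable lebesgue x" and "x \<in> L2 lebesgue" and "a < b"
  shows "L2_ip lebesgue (fourier_int x) (fourier_int (indicator {a..b}))
       = 2 * pi * (LINT u|lebesgue. x u * indicator {a..b} u)"
  unfolding L2_ip_def
  by (rule fourier_int_interval[OF assms(1,3) L2_ip_integrable])
    (intro fourier_int_L2 assms indicator_interval_L1_L2)+

section \<open>Plancherel's theorem\<close>

definition L2_tendsto :: "'a measure \<Rightarrow> (nat \<Rightarrow> 'a \<Rightarrow> complex) \<Rightarrow> ('a \<Rightarrow> complex) \<Rightarrow> bool" where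
  "L2_tendsto M x y \<longleftrightarrow> (\<forall>n. x n \<in> L2 M) \<and> y \<in> L2 M \<and> (\<lambda>n. L2_sq M (\<lambda>t. x n t - y t)) \<longlonglongrightarrow> 0"

lemma L2_tendsto_ip:
  assumes x: "L2_tendsto M x x'" and y: "L2_tendsto M y y'"
  shows "(\<lambda>n. L2_ip M (x n) (y n)) \<longlonglongrightarrow> L2_ip M x' y'"
proof -
  have m: "x n \<in> L2 M" "x' \<in> L2 M" "y n \<in> L2 M" "y' \<in> L2 M" for n
    using x y by (auto simp: L2_tendsto_def)
  define dx dy where "dx n t = x n t - x' t" and "dy n t = y n t - y' t" for n t
  have d: "dx n \<in> L2 M" "dy n \<in> L2 M" for n
    unfolding dx_def dy_def using m by (auto intro: L2_diff)
  have lim: "(\<lambda>n. sqrt (L2_sq M (dx n))) \<longlonglongrightarrow> sqrt 0" "(\<lambda>n. sqrt (L2_sq M (dy n))) \<longlonglongrightarrow> sqrt 0"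
    unfolding dx_def dy_def using x y by (intro tendsto_real_sqrt, simp add: L2_tendsto_def)+
  define B where "B n = sqrt (L2_sq M (dx n)) * (sqrt (L2_sq M (dy n)) + sqrt (L2_sq M y')) + sqrt (L2_sq M x') * sqrt (L2_sq M (dy n))" for n
  have le: "norm (L2_ip M (x n) (y n) - L2_ip M x' y') \<le> B n" for n
  proof -
    have xe: "x n = (\<lambda>t. dx n t + x' t)" and ye: "y n = (\<lambda>t. dy n t + y' t)"
      by (auto simp: dx_def dy_def)
    have "L2_ip M (x n) (y n) = (L2_ip M (dx n) (dy n) + L2_ip M (dx n) y') + (L2_ip M x' (dy n) + L2_ip M x' y')"
      unfolding xe ye by (simp only: L2_ip_add_left L2_ip_add_right L2_add d m)
    then have split: "L2_ip M (x n) (y n) - L2_ip M x' y'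
        = L2_ip M (dx n) (dy n) + L2_ip M (dx n) y' + L2_ip M x' (dy n)"
      by (simp only: add.assoc[symmetric] add_diff_cancel_right')
    have "norm (L2_ip M (x n) (y n) - L2_ip M x' y')
        \<le> cmod (L2_ip M (dx n) (dy n)) + cmod (L2_ip M (dx n) y') + cmod (L2_ip M x' (dy n))"
      unfolding split by (rule order_trans[OF norm_triangle_ineq add_right_mono[OF norm_triangle_ineq]])
    also have "\<dots> \<le> sqrt (L2_sq M (dx n)) * sqrt (L2_sq M (dy n)) + sqrt (L2_sq M (dx n)) * sqrt (L2_sq M y')
        + sqrt (L2_sq M x') * sqrt (L2_sq M (dy n))"
      by (intro add_mono L2_Cauchy_Schwarz d m)
    finally show ?thesis by (simp add: B_def distrib_left)
  qed
  have "B \<longlonglongrightarrow> sqrt 0 * (sqrt 0 + sqrt (L2_sq M y')) + sqrt (L2_sq M x') * sqrt 0"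
    unfolding B_def by (intro tendsto_intros lim)
  then have "B \<longlonglongrightarrow> 0" by simp
  then have "(\<lambda>n. L2_ip M (x n) (y n) - L2_ip M x' y') \<longlonglongrightarrow> 0"
    by (rule Lim_null_comparison[OF always_eventually[OF allI[OF le]]])
  then show ?thesis by (rule LIM_zero_cancel)
qed

lemma L2_tendsto_const: "y \<in> L2 M \<Longrightarrow> L2_tendsto M (\<lambda>n. y) y"
  by (simp add: L2_tendsto_def L2_sq_def)

lemma L2_tendsto_unique:
  assumes x: "L2_tendsto M x y" and z: "L2_tendsto M x z"
  shows "AE t in M. y t = z t"
proof -
  have m: "x n \<in> L2 M" "y \<in> L2 M" "z \<in> L2 M" for n using x z by (auto simp: L2_tendsto_def)
  have lim: "(\<lambda>n. sqrt (L2_sq M (\<lambda>t. x n t - z t)) + sqrt (L2_sq M (\<lambda>t. x n t - y t))) \<longlonglongrightarrow> sqrt 0 + sqrt 0"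
    using x z by (intro tendsto_intros) (auto simp: L2_tendsto_def)
  have "sqrt (L2_sq M (\<lambda>t. y t - z t)) \<le> sqrt (L2_sq M (\<lambda>t. x n t - z t)) + sqrt (L2_sq M (\<lambda>t. x n t - y t))" for n
    using L2_minkowski_diff[OF L2_diff[OF m(1) m(3)] L2_diff[OF m(1) m(2)], of n n] by simp
  then have "sqrt (L2_sq M (\<lambda>t. y t - z t)) \<le> sqrt 0 + sqrt 0" by (intro LIMSEQ_le_const[OF lim]) auto
  then have "L2_sq M (\<lambda>t. y t - z t) = 0" by (simp add: order_antisym)
  then show ?thesis using L2_sq_eq_0_iff[OF L2_diff[OF m(2,3)]] by simp
qed

lemma L2_tendsto_cnj:
  assumes "L2_tendsto M x y" shows "L2_tendsto M (\<lambda>n t. cnj (x n t)) (\<lambda>t. cnj (y t))"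
proof -
  have "L2_sq M (\<lambda>t. cnj (x n t) - cnj (y t)) = L2_sq M (\<lambda>t. x n t - y t)" for n
    unfolding L2_sq_def complex_cnj_diff[symmetric] complex_mod_cnj ..
  then show ?thesis using assms by (simp add: L2_tendsto_def L2_cnj)
qed

lemma L2_tendsto_scale:
  assumes "L2_tendsto M x y" shows "L2_tendsto M (\<lambda>n t. c * x n t) (\<lambda>t. c * y t)"
proof -
  have "(\<lambda>n. (cmod c)\<^sup>2 * L2_sq M (\<lambda>t. x n t - y t)) \<longlonglongrightarrow> (cmod c)\<^sup>2 * 0"
    using assms by (intro tendsto_intros) (auto simp: L2_tendsto_def)
  moreover have "L2_sq M (\<lambda>t. c * x n t - c * y t) = (cmod c)\<^sup>2 * L2_sq M (\<lambda>t. x n t - y t)" for n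
    unfolding right_diff_distrib[symmetric] by (rule L2_sq_scale)
  ultimately show ?thesis using assms by (simp add: L2_tendsto_def L2_scale)
qed

lemma AE_lebesgue_minus:
  assumes "AE t in (lebesgue :: real measure). P t"
  shows "AE t in (lebesgue :: real measure). P (- t)"
proof -
  have m: "(\<lambda>t::real. 0 + -1 * t) \<in> lebesgue \<rightarrow>\<^sub>M lebesgue"
    using lebesgue_affine_measurable[where c = "\<lambda>x::real. -1" and t = 0] by simp
  define D where "D = distr lebesgue (lebesgue :: real measure) (\<lambda>t::real. 0 + -1 * t)"
  have "lebesgue = density D (\<lambda>_. ennreal \<bar>-1\<bar>)"
    unfolding D_def by (rule lebesgue_real_affine) simp
  then have "D = lebesgue" by (simp only: abs_minus_cancel abs_one ennreal_1 density_1)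
  then have "AE t in D. P t" using assms by (simp only:)
  then have "AE t in distr lebesgue (lebesgue :: real measure) (\<lambda>t::real. 0 + -1 * t). P t" unfolding D_def .
  from AE_distrD[OF m this] show ?thesis by simp
qed

lemma L2_minus:
  assumes "x \<in> L2 (lebesgue :: real measure)" shows "(\<lambda>t. x (- t)) \<in> L2 lebesgue"
proof -
  have "x \<in> borel_measurable lebesgue" using assms by measurable
  from borel_measurable_affine[OF this, of "-1" 0] integrable_lebesgue_minus[OF L2_integrable[OF assms]]
  show ?thesis by (simp add: L2_def)
qed

lemma L2_sq_lebesgue_minus: "L2_sq lebesgue (\<lambda>t::real. x (- t)) = L2_sq lebesgue x"
  unfolding L2_sq_def by (rule integral_lebesgue_minus)

lemma L2_tendsto_minus:
  assumes "L2_tendsto (lebesgue :: real measure) x y"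
  shows "L2_tendsto lebesgue (\<lambda>n t. x n (- t)) (\<lambda>t. y (- t))"
proof -
  have "L2_sq lebesgue (\<lambda>t. x n (- t) - y (- t)) = L2_sq lebesgue (\<lambda>t. x n t - y t)" for n
    by (rule L2_sq_lebesgue_minus)
  then show ?thesis using assms by (simp only: L2_tendsto_def L2_minus) simp
qed

text \<open>A truncated square integrable function is also integrable, so \<open>fourier_int\<close>
  applies to it; these are the truncations in the definition of \<open>L2_fourier\<close>.\<close>

definition trunc :: "nat \<Rightarrow> (real \<Rightarrow> complex) \<Rightarrow> real \<Rightarrow> complex" where
  "trunc n x u = x u * indicator {- real n..real n} u"

lemma trunc_L1: "x \<in> L2 lebesgue \<Longrightarrow> integrable lebesgue (trunc n x)"
  unfolding trunc_def by (rule L2_mult_integrable[OF _ indicator_interval_L1_L2(2)])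

lemma trunc_L2:
  assumes "x \<in> L2 lebesgue" shows "trunc n x \<in> L2 lebesgue"
proof -
  have "(\<lambda>u. indicator {- real n..real n} u * x u) \<in> L2 lebesgue"
    by (rule L2_bounded_mult[OF assms, where c = 1]) (auto simp: indicator_def)
  then show ?thesis unfolding trunc_def[abs_def] by (simp add: mult.commute)
qed

lemma trunc_tendsto:
  assumes x: "x \<in> L2 lebesgue" shows "L2_tendsto lebesgue (\<lambda>n. trunc n x) x"
proof -
  have [measurable]: "x \<in> borel_measurable lebesgue" using x by measurable
  have "(\<lambda>n. LINT t|lebesgue. (cmod (trunc n x t - x t))\<^sup>2) \<longlonglongrightarrow> (LINT t|(lebesgue :: real measure). 0)"
  proof (rule integral_dominated_convergence[OF _ _ L2_integrable[OF x]])
    show "AE t in lebesgue. (\<lambda>n. (cmod (trunc n x t - x t))\<^sup>2) \<longlonglongrightarrow> 0"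
    proof (rule AE_I2)
      fix t
      obtain n0 where n0: "\<bar>t\<bar> \<le> real n0" using real_arch_simple by blast
      have "eventually (\<lambda>n. (cmod (trunc n x t - x t))\<^sup>2 = 0) sequentially"
        by (rule eventually_sequentiallyI[of n0]) (use n0 in \<open>auto simp: trunc_def indicator_def abs_le_iff\<close>)
      then show "(\<lambda>n. (cmod (trunc n x t - x t))\<^sup>2) \<longlonglongrightarrow> 0" by (rule tendsto_eventually)
    qed
    show "AE t in lebesgue. norm ((cmod (trunc n x t - x t))\<^sup>2) \<le> (cmod (x t))\<^sup>2" for n
      by (auto simp: trunc_def indicator_def)
  qed (auto simp: trunc_def)
  then show ?thesis by (simp add: L2_tendsto_def trunc_L2 x L2_sq_def)
qed

lemma fourier_int_diff:
  assumes "integrable lebesgue x" "integrable lebesgue y"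
  shows "fourier_int (\<lambda>u. x u - y u) \<nu> = fourier_int x \<nu> - fourier_int y \<nu>"
  unfolding fourier_int_def using integrable_cis_mult[OF assms(1)] integrable_cis_mult[OF assms(2)]
  by (simp add: left_diff_distrib)

lemma trunc_fourier:
  "(LINT u:{- real n..real n}|lebesgue. x u * cis (u * \<nu>)) = fourier_int (trunc n x) \<nu>"
  unfolding fourier_int_def set_lebesgue_integral_def trunc_def
  by (intro Bochner_Integration.integral_cong) (auto simp: indicator_def)

lemma fourier_trunc_L2: "x \<in> L2 lebesgue \<Longrightarrow> fourier_int (trunc n x) \<in> L2 lebesgue"
  by (rule fourier_int_L2(1)[OF trunc_L1 trunc_L2])

lemma L2_fourier_limit_iff:
  assumes x: "x \<in> L2 lebesgue" and X: "X \<in> L2 lebesgue"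
  shows "(\<lambda>n::nat. \<integral>\<^sup>+ \<nu>. ennreal ((cmod (X \<nu> -
         (LINT u:{- real n..real n}|lebesgue. x u * cis (u * \<nu>))))\<^sup>2) \<partial>lebesgue) \<longlonglongrightarrow> 0
     \<longleftrightarrow> L2_tendsto lebesgue (\<lambda>n. fourier_int (trunc n x)) X"
proof -
  have "(\<integral>\<^sup>+ \<nu>. ennreal ((cmod (X \<nu> - (LINT u:{- real n..real n}|lebesgue. x u * cis (u * \<nu>))))\<^sup>2) \<partial>lebesgue)
      = ennreal (L2_sq lebesgue (\<lambda>\<nu>. fourier_int (trunc n x) \<nu> - X \<nu>))" for n
    unfolding trunc_fourier
    by (subst nn_integral_eq_L2_sq[OF L2_diff[OF X fourier_trunc_L2[OF x]]]) (simp add: L2_sq_minus_commute)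
  then show ?thesis
    unfolding L2_tendsto_def using X fourier_trunc_L2[OF x]
    by (simp add: tendsto_ennreal_iff[where x = 0, simplified])
qed

text \<open>Justifies the choice in the definition of \<open>L2_fourier\<close>: the truncations are
  Cauchy, the norm bound for \<open>fourier_int\<close> carries this to their transforms, and
  completeness provides a limit.\<close>

lemma L2_fourier_tendsto:
  assumes x: "x \<in> L2 lebesgue"
  shows "L2_tendsto lebesgue (\<lambda>n. fourier_int (trunc n x)) (L2_fourier x)"
proof -
  obtain X where "X \<in> L2 lebesgue" "(\<lambda>n. L2_sq lebesgue (\<lambda>t. fourier_int (trunc n x) t - X t)) \<longlonglongrightarrow> 0"
  proof (rule L2_complete[of "\<lambda>n. fourier_int (trunc n x)" lebesgue])
    fix e :: real assume e: "0 < e"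
    from trunc_tendsto[OF x] have "(\<lambda>n. L2_sq lebesgue (\<lambda>t. trunc n x t - x t)) \<longlonglongrightarrow> 0"
      by (simp add: L2_tendsto_def)
    \<comment> \<open>The norm bound costs a factor \<open>2 * pi\<close> and the comparison through
      \<open>x\<close> a factor 2 for each of two terms, which together give
      \<open>8 * pi\<close>.\<close>
    from order_tendstoD(2)[OF this, of "e / (8 * pi)"] e
    obtain N where N: "\<And>n. n \<ge> N \<Longrightarrow> L2_sq lebesgue (\<lambda>t. trunc n x t - x t) < e / (8 * pi)"
      by (auto simp: eventually_sequentially)
    have "L2_sq lebesgue (\<lambda>t. fourier_int (trunc m x) t - fourier_int (trunc n x) t) \<le> e"
      if "m \<ge> N" "n \<ge> N" for m n
    proof -
      have "L2_sq lebesgue (\<lambda>t. fourier_int (trunc m x) t - fourier_int (trunc n x) t)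
          = L2_sq lebesgue (fourier_int (\<lambda>u. trunc m x u - trunc n x u))"
        by (simp add: fourier_int_diff[OF trunc_L1[OF x] trunc_L1[OF x], abs_def])
      also have "\<dots> \<le> 2 * pi * L2_sq lebesgue (\<lambda>u. trunc m x u - trunc n x u)"
        by (rule fourier_int_L2(2)) (intro Bochner_Integration.integrable_diff trunc_L1 L2_diff trunc_L2 x)+
      also have "L2_sq lebesgue (\<lambda>u. trunc m x u - trunc n x u)
          \<le> 2 * L2_sq lebesgue (\<lambda>t. trunc m x t - x t) + 2 * L2_sq lebesgue (\<lambda>t. trunc n x t - x t)"
      proof -
        have "L2_sq lebesgue (\<lambda>u. trunc m x u - trunc n x u)
            = L2_sq lebesgue (\<lambda>t. (trunc m x t - x t) - (trunc n x t - x t))" by simp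
        then show ?thesis
          using L2_parallelogram[OF L2_diff[OF trunc_L2[OF x] x] L2_diff[OF trunc_L2[OF x] x], of m n]
            L2_sq_nonneg[of lebesgue "\<lambda>t. trunc m x t - x t + (trunc n x t - x t)"] by linarith
      qed
      also have "\<dots> \<le> 2 * (e / (8 * pi)) + 2 * (e / (8 * pi))"
        using N[OF that(1)] N[OF that(2)] by simp
      also have "2 * pi * \<dots> = e" by simp
      finally show ?thesis by simp
    qed
    then show "\<exists>N. \<forall>m\<ge>N. \<forall>n\<ge>N. L2_sq lebesgue (\<lambda>t. fourier_int (trunc m x) t - fourier_int (trunc n x) t) \<le> e"
      by blast
  qed (use fourier_trunc_L2[OF x] that in auto)
  then have "L2_tendsto lebesgue (\<lambda>n. fourier_int (trunc n x)) X"
    by (simp add: L2_tendsto_def fourier_trunc_L2 x)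
  moreover define P where "P Z \<longleftrightarrow> Z \<in> L2 lebesgue \<and> (\<lambda>n::nat. \<integral>\<^sup>+ \<nu>. ennreal ((cmod (Z \<nu> -
         (LINT u:{- real n..real n}|lebesgue. x u * cis (u * \<nu>))))\<^sup>2) \<partial>lebesgue) \<longlonglongrightarrow> 0" for Z
  ultimately have "P X" using L2_fourier_limit_iff[OF x, of X] by (simp add: L2_tendsto_def)
  moreover have "L2_fourier x = (SOME Z. P Z)" unfolding L2_fourier_def P_def ..
  ultimately have "P (L2_fourier x)" by (simp add: someI[of P])
  then show ?thesis using L2_fourier_limit_iff[OF x, of "L2_fourier x"] unfolding P_def by blast
qed

lemma L2_fourier_L2: "x \<in> L2 lebesgue \<Longrightarrow> L2_fourier x \<in> L2 lebesgue"
  using L2_fourier_tendsto by (auto simp: L2_tendsto_def)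

lemma L2_fourier_AE_eqI:
  assumes "x \<in> L2 lebesgue" "L2_tendsto lebesgue (\<lambda>n. fourier_int (trunc n x)) X"
  shows "AE \<nu> in lebesgue. L2_fourier x \<nu> = X \<nu>"
  by (rule L2_tendsto_unique[OF L2_fourier_tendsto[OF assms(1)] assms(2)])

lemma L2_fourier_eq_fourier_int:
  assumes x1: "integrable lebesgue x" and x2: "x \<in> L2 lebesgue"
  shows "AE \<nu> in lebesgue. L2_fourier x \<nu> = fourier_int x \<nu>"
proof (rule L2_fourier_AE_eqI[OF x2])
  have "(\<lambda>n. L2_sq lebesgue (\<lambda>t. fourier_int (trunc n x) t - fourier_int x t)) \<longlonglongrightarrow> 0"
  proof (rule Lim_null_comparison[OF always_eventually])
    have "(\<lambda>n. 2 * pi * L2_sq lebesgue (\<lambda>u. trunc n x u - x u)) \<longlonglongrightarrow> 2 * pi * 0"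
      using trunc_tendsto[OF x2] by (intro tendsto_intros) (simp add: L2_tendsto_def)
    then show "(\<lambda>n. 2 * pi * L2_sq lebesgue (\<lambda>u. trunc n x u - x u)) \<longlonglongrightarrow> 0" by simp
    show "\<forall>n. norm (L2_sq lebesgue (\<lambda>t. fourier_int (trunc n x) t - fourier_int x t))
        \<le> 2 * pi * L2_sq lebesgue (\<lambda>u. trunc n x u - x u)"
      using fourier_int_L2(2)[OF Bochner_Integration.integrable_diff[OF trunc_L1[OF x2] x1] L2_diff[OF trunc_L2[OF x2] x2]]
      by (simp add: fourier_int_diff[OF trunc_L1[OF x2] x1, abs_def])
  qed
  then show "L2_tendsto lebesgue (\<lambda>n. fourier_int (trunc n x)) (fourier_int x)"
    by (simp add: L2_tendsto_def fourier_trunc_L2 x2 fourier_int_L2 x1)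
qed

text \<open>Genuine equality of functions: the choice depends on its argument only through the
  truncated integrals, and these do not see null sets.\<close>

lemma L2_fourier_cong_AE:
  assumes "x \<in> borel_measurable lebesgue" "y \<in> borel_measurable lebesgue" "AE u in lebesgue. x u = y u"
  shows "L2_fourier x = L2_fourier y"
proof -
  have "(LINT u:{- real n..real n}|lebesgue. x u * cis (u * \<nu>)) = (LINT u:{- real n..real n}|lebesgue. y u * cis (u * \<nu>))" for n \<nu>
    unfolding set_lebesgue_integral_def
    by (rule integral_cong_AE) (use assms in \<open>auto elim: eventually_mono\<close>)
  then show ?thesis unfolding L2_fourier_def by simp
qed

lemma L2_fourier_scale:
  assumes x: "x \<in> L2 lebesgue"
  shows "AE \<nu> in lebesgue. L2_fourier (\<lambda>u. c * x u) \<nu> = c * L2_fourier x \<nu>"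
proof (rule L2_fourier_AE_eqI[OF L2_scale[OF x]])
  have "fourier_int (trunc n (\<lambda>u. c * x u)) = (\<lambda>\<nu>. c * fourier_int (trunc n x) \<nu>)" for n
    by (simp add: fourier_int_def[abs_def] trunc_def mult.assoc)
  then show "L2_tendsto lebesgue (\<lambda>n. fourier_int (trunc n (\<lambda>u. c * x u))) (\<lambda>\<nu>. c * L2_fourier x \<nu>)"
    using L2_tendsto_scale[OF L2_fourier_tendsto[OF x]] by simp
qed

lemma L2_fourier_minus:
  assumes x: "x \<in> L2 lebesgue"
  shows "AE \<nu> in lebesgue. L2_fourier (\<lambda>u. x (- u)) \<nu> = L2_fourier x (- \<nu>)"
proof (rule L2_fourier_AE_eqI[OF L2_minus[OF x]])
  have "fourier_int (trunc n (\<lambda>u. x (- u))) = (\<lambda>\<nu>. fourier_int (trunc n x) (- \<nu>))" for n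
  proof
    fix \<nu>
    have "fourier_int (trunc n (\<lambda>u. x (- u))) \<nu> = (LINT u|lebesgue. trunc n x (- u) * cis (- u * - \<nu>))"
      unfolding fourier_int_def
      by (rule Bochner_Integration.integral_cong) (auto simp: trunc_def indicator_def)
    also have "\<dots> = fourier_int (trunc n x) (- \<nu>)"
      unfolding fourier_int_def by (rule integral_lebesgue_minus)
    finally show "fourier_int (trunc n (\<lambda>u. x (- u))) \<nu> = fourier_int (trunc n x) (- \<nu>)" .
  qed
  then show "L2_tendsto lebesgue (\<lambda>n. fourier_int (trunc n (\<lambda>u. x (- u)))) (\<lambda>\<nu>. L2_fourier x (- \<nu>))"
    using L2_tendsto_minus[OF L2_fourier_tendsto[OF x]] by simp
qed

lemma L2_fourier_cnj:
  assumes x: "x \<in> L2 lebesgue"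
  shows "AE \<nu> in lebesgue. L2_fourier (\<lambda>u. cnj (x u)) \<nu> = cnj (L2_fourier x (- \<nu>))"
proof (rule L2_fourier_AE_eqI[OF L2_cnj[OF x]])
  have "fourier_int (trunc n (\<lambda>u. cnj (x u))) = (\<lambda>\<nu>. cnj (fourier_int (trunc n x) (- \<nu>)))" for n
  proof -
    have "cnj (indicator {- real n..real n} u) = indicator {- real n..real n} u" for u
      by (simp add: indicator_def)
    then show ?thesis by (simp add: cnj_fourier_int trunc_def[abs_def])
  qed
  then show "L2_tendsto lebesgue (\<lambda>n. fourier_int (trunc n (\<lambda>u. cnj (x u)))) (\<lambda>\<nu>. cnj (L2_fourier x (- \<nu>)))"
    using L2_tendsto_cnj[OF L2_tendsto_minus[OF L2_fourier_tendsto[OF x]]] by simp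
qed

lemma L2_fourier_multiplication:
  assumes x: "x \<in> L2 lebesgue" and y: "y \<in> L2 lebesgue"
  shows "(LINT \<nu>|lebesgue. L2_fourier x \<nu> * y \<nu>) = (LINT u|lebesgue. x u * L2_fourier y u)"
proof -
  have "(\<lambda>n. L2_ip lebesgue (fourier_int (trunc n x)) (\<lambda>t. cnj (trunc n y t))) \<longlonglongrightarrow> L2_ip lebesgue (L2_fourier x) (\<lambda>t. cnj (y t))"
    by (intro L2_tendsto_ip L2_fourier_tendsto L2_tendsto_cnj trunc_tendsto x y)
  moreover have "(\<lambda>n. L2_ip lebesgue (trunc n x) (\<lambda>t. cnj (fourier_int (trunc n y) t))) \<longlonglongrightarrow> L2_ip lebesgue x (\<lambda>t. cnj (L2_fourier y t))"
    by (intro L2_tendsto_ip L2_fourier_tendsto L2_tendsto_cnj trunc_tendsto x y)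
  moreover have "L2_ip lebesgue (fourier_int (trunc n x)) (\<lambda>t. cnj (trunc n y t)) = L2_ip lebesgue (trunc n x) (\<lambda>t. cnj (fourier_int (trunc n y) t))" for n
    using fourier_int_multiplication[OF trunc_L1[OF x] trunc_L1[OF y], of n n] by (simp add: L2_ip_def mult.commute)
  ultimately have "L2_ip lebesgue (L2_fourier x) (\<lambda>t. cnj (y t)) = L2_ip lebesgue x (\<lambda>t. cnj (L2_fourier y t))"
    using LIMSEQ_unique by simp
  then show ?thesis by (simp add: L2_ip_def)
qed

text \<open>Test the difference against intervals. The multiplication formula moves one transform
  onto the indicator, where Parseval for intervals evaluates the pairing.\<close>

theorem L2_fourier_inversion:
  fixes x :: "real \<Rightarrow> complex"
  assumes x: "x \<in> L2 lebesgue"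
  shows "AE t in lebesgue. L2_fourier (L2_fourier x) t = 2 * pi * x (- t)"
proof -
  have X: "L2_fourier x \<in> L2 lebesgue" and XX: "L2_fourier (L2_fourier x) \<in> L2 lebesgue"
    using x by (auto intro: L2_fourier_L2)
  have x': "(\<lambda>t. 2 * pi * x (- t)) \<in> L2 lebesgue" by (intro L2_scale L2_minus x)
  have "AE t in lebesgue. L2_fourier (L2_fourier x) t - 2 * pi * x (- t) = 0"
  proof (rule L2_eq_0_if_interval_integrals_eq_0[OF L2_diff[OF XX x']])
    fix a b :: real assume ab: "a < b"
    \<comment> \<open>The transform of \<open>?I\<close> is the conjugate of the transform of the
      reflected interval \<open>?J\<close>; this is the source of the reflection in the inversion
      formula.\<close>
    let ?I = "indicator {a..b} :: real \<Rightarrow> complex" and ?J = "indicator {-b..-a} :: real \<Rightarrow> complex"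
    note I = indicator_interval_L1_L2[of a b] and J = indicator_interval_L1_L2[of "-b" "-a"]
    have IJ: "?J = (\<lambda>t. ?I (- t))" by (rule ext) (auto simp: indicator_def)
    have eqI: "AE \<nu> in lebesgue. L2_fourier ?I \<nu> = cnj (fourier_int ?J \<nu>)"
      using L2_fourier_eq_fourier_int[OF I]
    proof eventually_elim
      case (elim \<nu>)
      have "cnj (fourier_int ?J \<nu>) = fourier_int ?J (- \<nu>)"
        unfolding cnj_fourier_int by (rule arg_cong[where f = "\<lambda>x. fourier_int x (- \<nu>)"]) (auto simp: indicator_def)
      also have "\<dots> = (LINT u|lebesgue. ?I (- u) * cis (- u * \<nu>))"
        by (simp add: fourier_int_def IJ)
      also have "\<dots> = fourier_int ?I \<nu>" unfolding fourier_int_def by (rule integral_lebesgue_minus)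
      finally show ?case using elim by simp
    qed
    have c1: "(\<lambda>n. L2_ip lebesgue (fourier_int (trunc n x)) (fourier_int ?J)) \<longlonglongrightarrow> L2_ip lebesgue (L2_fourier x) (fourier_int ?J)"
      by (intro L2_tendsto_ip L2_fourier_tendsto L2_tendsto_const fourier_int_L2 J x)
    have c2: "L2_ip lebesgue (fourier_int (trunc n x)) (fourier_int ?J) = 2 * pi * L2_ip lebesgue (trunc n x) ?J" for n
    proof -
      have "cnj (?J u) = ?J u" for u by (auto simp: indicator_def)
      then show ?thesis
        using parseval_interval[OF trunc_L1[OF x] trunc_L2[OF x], of "-b" "-a" n] ab by (simp add: L2_ip_def)
    qed
    have c3: "(\<lambda>n. 2 * pi * L2_ip lebesgue (trunc n x) ?J) \<longlonglongrightarrow> 2 * pi * L2_ip lebesgue x ?J"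
      by (intro tendsto_intros L2_tendsto_ip trunc_tendsto L2_tendsto_const J x)
    have main: "L2_ip lebesgue (L2_fourier x) (fourier_int ?J) = 2 * pi * L2_ip lebesgue x ?J"
      using c1 unfolding c2 by (rule LIMSEQ_unique[OF _ c3])
    have "(LINT u|lebesgue. (L2_fourier (L2_fourier x) u - 2 * pi * x (- u)) * ?I u)
        = (LINT u|lebesgue. L2_fourier (L2_fourier x) u * ?I u) - (LINT u|lebesgue. 2 * pi * x (- u) * ?I u)"
      using L2_mult_integrable[OF XX I(2)] L2_mult_integrable[OF x' I(2)] by (simp add: left_diff_distrib)
    also have "(LINT u|lebesgue. L2_fourier (L2_fourier x) u * ?I u) = (LINT u|lebesgue. L2_fourier x u * L2_fourier ?I u)"
      by (rule L2_fourier_multiplication[OF X I(2)])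
    also have "\<dots> = L2_ip lebesgue (L2_fourier x) (fourier_int ?J)"
      unfolding L2_ip_def
    proof (rule integral_cong_AE)
      show "(\<lambda>u. L2_fourier x u * L2_fourier ?I u) \<in> borel_measurable lebesgue"
        using L2_mult_integrable[OF X L2_fourier_L2[OF I(2)]] by auto
      show "(\<lambda>u. L2_fourier x u * cnj (fourier_int ?J u)) \<in> borel_measurable lebesgue"
        using L2_ip_integrable[OF X fourier_int_L2(1)[OF J]] by auto
      show "AE u in lebesgue. L2_fourier x u * L2_fourier ?I u = L2_fourier x u * cnj (fourier_int ?J u)"
        using eqI by eventually_elim simp
    qed
    also have "\<dots> = 2 * pi * L2_ip lebesgue x ?J" by (rule main)
    also have "L2_ip lebesgue x ?J = (LINT u|lebesgue. x (- u) * ?I u)"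
      unfolding L2_ip_def by (subst integral_lebesgue_minus[symmetric]) (auto simp: IJ indicator_def intro!: Bochner_Integration.integral_cong)
    also have "2 * pi * (LINT u|lebesgue. x (- u) * ?I u) - (LINT u|lebesgue. 2 * pi * x (- u) * ?I u) = 0"
      by (simp add: mult.assoc)
    finally show "(LINT u|lebesgue. (L2_fourier (L2_fourier x) u - 2 * pi * x (- u)) * ?I u) = 0" by simp
  qed
  then show ?thesis by eventually_elim simp
qed

text \<open>The multiplication formula moves the transform of \<open>x\<close> onto the conjugated
  transform of \<open>y\<close>, and inversion evaluates the resulting double transform.\<close>

theorem L2_fourier_Parseval:
  fixes x y :: "real \<Rightarrow> complex"
  assumes x: "x \<in> L2 lebesgue" and y: "y \<in> L2 lebesgue"
  shows "L2_ip lebesgue (L2_fourier x) (L2_fourier y) = 2 * pi * L2_ip lebesgue x y"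
proof -
  note X = L2_fourier_L2[OF x] and Y = L2_fourier_L2[OF y]
  let ?y = "\<lambda>u. cnj (y u)"
  have y': "?y \<in> L2 lebesgue" by (rule L2_cnj[OF y])
  note Y' = L2_fourier_L2[OF y']
  have AE1: "AE \<nu> in lebesgue. L2_fourier ?y (- \<nu>) = cnj (L2_fourier y \<nu>)"
    using AE_lebesgue_minus[OF L2_fourier_cnj[OF y]] by eventually_elim (simp only: minus_minus)
  have "L2_fourier (\<lambda>\<nu>. cnj (L2_fourier y \<nu>)) = L2_fourier (\<lambda>\<nu>. L2_fourier ?y (- \<nu>))"
  proof (rule L2_fourier_cong_AE)
    show "AE \<nu> in lebesgue. cnj (L2_fourier y \<nu>) = L2_fourier ?y (- \<nu>)"
      using AE1 by eventually_elim simp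
  qed (rule L2_measurable[OF L2_cnj[OF Y]] L2_measurable[OF L2_minus[OF Y']])+
  moreover have "AE t in lebesgue. L2_fourier (\<lambda>\<nu>. L2_fourier ?y (- \<nu>)) t = 2 * pi * cnj (y t)"
    using L2_fourier_minus[OF Y'] AE_lebesgue_minus[OF L2_fourier_inversion[OF y']]
    by eventually_elim simp
  ultimately have AE2: "AE t in lebesgue. L2_fourier (\<lambda>\<nu>. cnj (L2_fourier y \<nu>)) t = 2 * pi * cnj (y t)"
    by simp
  have "L2_ip lebesgue (L2_fourier x) (L2_fourier y) = (LINT u|lebesgue. x u * L2_fourier (\<lambda>\<nu>. cnj (L2_fourier y \<nu>)) u)"
    unfolding L2_ip_def by (rule L2_fourier_multiplication[OF x L2_cnj[OF Y]])
  also have "\<dots> = (LINT u|lebesgue. 2 * pi * (x u * cnj (y u)))"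
  proof (rule integral_cong_AE)
    show "(\<lambda>u. x u * L2_fourier (\<lambda>\<nu>. cnj (L2_fourier y \<nu>)) u) \<in> borel_measurable lebesgue"
      using L2_mult_integrable[OF x L2_fourier_L2[OF L2_cnj[OF Y]]] by auto
    show "(\<lambda>u. 2 * pi * (x u * cnj (y u))) \<in> borel_measurable lebesgue"
      using L2_ip_integrable[OF x y] by auto
    show "AE u in lebesgue. x u * L2_fourier (\<lambda>\<nu>. cnj (L2_fourier y \<nu>)) u = 2 * pi * (x u * cnj (y u))"
      using AE2 by eventually_elim simp
  qed
  finally show ?thesis by (simp add: L2_ip_def)
qed

text \<open>Inversion read backwards, with an explicit preimage. \<open>R_op\<close> is defined by
  exactly this formula, so the theorem also identifies the transform of its value.\<close>

theorem L2_fourier_surj: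
  fixes m :: "real \<Rightarrow> complex"
  assumes m: "m \<in> L2 lebesgue"
  defines "x \<equiv> \<lambda>t. 1 / (2 * pi) * L2_fourier m (- t)"
  shows "x \<in> L2 lebesgue" and "AE \<nu> in lebesgue. L2_fourier x \<nu> = m \<nu>"
proof -
  have M: "(\<lambda>t. L2_fourier m (- t)) \<in> L2 lebesgue" by (intro L2_minus L2_fourier_L2 m)
  show "x \<in> L2 lebesgue" unfolding x_def by (rule L2_scale[OF M])
  show "AE \<nu> in lebesgue. L2_fourier x \<nu> = m \<nu>"
    using L2_fourier_scale[OF M, of "1 / (2 * pi)"] L2_fourier_minus[OF L2_fourier_L2[OF m]]
      AE_lebesgue_minus[OF L2_fourier_inversion[OF m]]
    unfolding x_def by eventually_elim simp
qed

section \<open>Spectral measures and optimal characteristics\<close>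

definition ext0 :: "real set \<Rightarrow> (real \<Rightarrow> complex) \<Rightarrow> real \<Rightarrow> complex" where
  "ext0 T x u = (if u \<in> T then x u else 0)"

lemma fourier_on_ext0: "fourier_on T x = L2_fourier (ext0 T x)"
  unfolding fourier_on_def ext0_def[abs_def] ..

lemma L2_lebesgue_on_iff:
  assumes T: "T \<in> sets lebesgue"
  shows "x \<in> L2 (lebesgue_on T) \<longleftrightarrow> ext0 T x \<in> L2 lebesgue"
proof -
  have m: "x \<in> borel_measurable (lebesgue_on T) \<longleftrightarrow> ext0 T x \<in> borel_measurable lebesgue"
    unfolding ext0_def[abs_def] using T by (intro measurable_restrict_space_iff) auto
  have "integrable (lebesgue_on T) (\<lambda>t. (cmod (x t))\<^sup>2) \<longleftrightarrow> integrable lebesgue (\<lambda>t. indicator T t *\<^sub>R (cmod (x t))\<^sup>2)"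
    using T by (intro integrable_restrict_space) auto
  also have "(\<lambda>t. indicator T t *\<^sub>R (cmod (x t))\<^sup>2) = (\<lambda>t. (cmod (ext0 T x t))\<^sup>2)"
    by (auto simp: ext0_def indicator_def)
  finally show ?thesis using m by (simp add: L2_def)
qed

lemma L2_inner_ext0:
  assumes T: "T \<in> sets lebesgue"
  shows "L2_inner T x y = L2_ip lebesgue (ext0 T x) (ext0 T y)"
proof -
  have "L2_inner T x y = (LINT t|lebesgue. indicator T t *\<^sub>R (x t * cnj (y t)))"
    unfolding L2_inner_def using T by (intro integral_restrict_space) auto
  also have "\<dots> = L2_ip lebesgue (ext0 T x) (ext0 T y)"
    unfolding L2_ip_def by (rule Bochner_Integration.integral_cong) (auto simp: ext0_def indicator_def)
  finally show ?thesis .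
qed

lemma L2_sq_ext0:
  assumes "T \<in> sets lebesgue"
  shows "L2_sq (lebesgue_on T) x = L2_sq lebesgue (ext0 T x)"
  using L2_inner_ext0[OF assms, of x x] L2_ip_self[of "lebesgue_on T" x] L2_ip_self[of lebesgue "ext0 T x"]
  by (simp add: L2_inner_def L2_ip_def)

lemma spectral_densityD:
  assumes "spectral_density f"
  shows "0 \<le> f \<nu>" "integrable lebesgue f" "f \<in> borel_measurable lebesgue"
  using assms by (auto simp: spectral_density_def)

lemma spectral_measure_simps [simp]:
  "space (spectral_measure f g) = UNIV" "sets (spectral_measure f g) = sets lebesgue"
  "borel_measurable (spectral_measure f g) = borel_measurable lebesgue"
  by (auto simp: spectral_measure_def)

context
  fixes f g :: "real \<Rightarrow> real"
  assumes f: "spectral_density f" and g: "spectral_density g"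
begin

lemma density_sum_nonneg: "0 \<le> f \<nu> + g \<nu>"
  using f g by (simp add: spectral_density_def)

lemma density_sum_measurable: "(\<lambda>\<nu>. f \<nu> + g \<nu>) \<in> borel_measurable lebesgue"
  using spectral_densityD(3)[OF f] spectral_densityD(3)[OF g] by measurable

lemma L2_spectral_iff:
  "h \<in> L2 (spectral_measure f g) \<longleftrightarrow>
     h \<in> borel_measurable lebesgue \<and> integrable lebesgue (\<lambda>\<nu>. (cmod (h \<nu>))\<^sup>2 * (f \<nu> + g \<nu>))"
proof -
  have "integrable (spectral_measure f g) (\<lambda>\<nu>. (cmod (h \<nu>))\<^sup>2)
      \<longleftrightarrow> integrable lebesgue (\<lambda>\<nu>. (f \<nu> + g \<nu>) *\<^sub>R (cmod (h \<nu>))\<^sup>2)" if h: "h \<in> borel_measurable lebesgue"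
    unfolding spectral_measure_def
    by (rule integrable_density) (use h density_sum_measurable density_sum_nonneg in auto)
  then show ?thesis by (auto simp: L2_def mult.commute)
qed

lemma L2_sq_spectral:
  assumes "h \<in> borel_measurable lebesgue"
  shows "L2_sq (spectral_measure f g) h = (LINT \<nu>|lebesgue. (cmod (h \<nu>))\<^sup>2 * (f \<nu> + g \<nu>))"
  unfolding L2_sq_def spectral_measure_def
  by (subst integral_density) (use assms density_sum_measurable density_sum_nonneg in \<open>auto simp: mult.commute\<close>)

lemma L2_ip_spectral:
  assumes "h \<in> borel_measurable lebesgue" "k \<in> borel_measurable lebesgue"
  shows "L2_ip (spectral_measure f g) h k = (LINT \<nu>|lebesgue. h \<nu> * cnj (k \<nu>) * of_real (f \<nu> + g \<nu>))"
proof -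
  have "(\<lambda>\<nu>. h \<nu> * cnj (k \<nu>)) \<in> borel_measurable lebesgue" using assms by measurable
  then show ?thesis
    unfolding L2_ip_def spectral_measure_def
    by (subst integral_density)
      (use density_sum_measurable density_sum_nonneg in \<open>auto simp: scaleR_conv_of_real mult.commute\<close>)
qed

lemma bounded_L2_spectral:
  assumes "h \<in> borel_measurable lebesgue" "\<And>\<nu>. cmod (h \<nu>) \<le> c"
  shows "h \<in> L2 (spectral_measure f g)"
  unfolding L2_spectral_iff
proof
  show "integrable lebesgue (\<lambda>\<nu>. (cmod (h \<nu>))\<^sup>2 * (f \<nu> + g \<nu>))"
  proof (rule Bochner_Integration.integrable_bound)
    show "integrable lebesgue (\<lambda>\<nu>. c\<^sup>2 * (f \<nu> + g \<nu>))"
      using spectral_densityD(2)[OF f] spectral_densityD(2)[OF g] by simp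
    show "(\<lambda>\<nu>. (cmod (h \<nu>))\<^sup>2 * (f \<nu> + g \<nu>)) \<in> borel_measurable lebesgue"
      using assms(1) density_sum_measurable by measurable
    have "(cmod (h \<nu>))\<^sup>2 * (f \<nu> + g \<nu>) \<le> c\<^sup>2 * (f \<nu> + g \<nu>)" for \<nu>
      using assms(2)[of \<nu>] density_sum_nonneg by (intro mult_right_mono power_mono) auto
    then show "AE \<nu> in lebesgue. norm ((cmod (h \<nu>))\<^sup>2 * (f \<nu> + g \<nu>)) \<le> norm (c\<^sup>2 * (f \<nu> + g \<nu>))"
      using density_sum_nonneg by (auto simp: abs_mult)
  qed
qed (fact assms(1))

lemma exp_span_L2: "p \<in> exp_span U \<Longrightarrow> p \<in> L2 (spectral_measure f g)"
proof -
  assume "p \<in> exp_span U"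
  then obtain F c where p: "p = (\<lambda>\<nu>. \<Sum>t\<in>F. c t * cis (t * \<nu>))" by (auto simp: exp_span_def)
  have "(\<lambda>\<nu>. cis (t * \<nu>)) \<in> L2 (spectral_measure f g)" for t
    by (rule bounded_L2_spectral[where c = 1]) auto
  then show ?thesis unfolding p by (intro L2_sum L2_scale)
qed

end

section \<open>Closed spans of exponentials\<close>

lemma exp_span_0: "(\<lambda>\<nu>. 0) \<in> exp_span U"
  unfolding exp_span_def by (auto intro!: exI[of _ "{}"])

lemma exp_span_cis: "t \<in> U \<Longrightarrow> (\<lambda>\<nu>. cis (t * \<nu>)) \<in> exp_span U"
  unfolding exp_span_def by (auto intro!: exI[of _ "{t}"] exI[of _ "\<lambda>_. 1"])

lemma exp_span_scale:
  assumes "p \<in> exp_span U" shows "(\<lambda>\<nu>. c * p \<nu>) \<in> exp_span U"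
proof -
  obtain F d where "finite F" "F \<subseteq> U" "p = (\<lambda>\<nu>. \<Sum>t\<in>F. d t * cis (t * \<nu>))"
    using assms by (auto simp: exp_span_def)
  then show ?thesis
    unfolding exp_span_def
    by (auto intro!: exI[of _ F] exI[of _ "\<lambda>t. c * d t"] simp: sum_distrib_left mult.assoc)
qed

lemma exp_span_add:
  assumes "p \<in> exp_span U" "q \<in> exp_span U" shows "(\<lambda>\<nu>. p \<nu> + q \<nu>) \<in> exp_span U"
proof -
  obtain F c where F: "finite F" "F \<subseteq> U" and p: "p = (\<lambda>\<nu>. \<Sum>t\<in>F. c t * cis (t * \<nu>))"
    using assms(1) by (auto simp: exp_span_def)
  obtain G d where G: "finite G" "G \<subseteq> U" and q: "q = (\<lambda>\<nu>. \<Sum>t\<in>G. d t * cis (t * \<nu>))"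
    using assms(2) by (auto simp: exp_span_def)
  have 1: "(\<Sum>t\<in>F. c t * cis (t * \<nu>)) = (\<Sum>t\<in>F \<union> G. (if t \<in> F then c t else 0) * cis (t * \<nu>))" for \<nu>
    using F G by (intro sum.mono_neutral_cong_left) auto
  have 2: "(\<Sum>t\<in>G. d t * cis (t * \<nu>)) = (\<Sum>t\<in>F \<union> G. (if t \<in> G then d t else 0) * cis (t * \<nu>))" for \<nu>
    using F G by (intro sum.mono_neutral_cong_left) auto
  have "(\<lambda>\<nu>. p \<nu> + q \<nu>) = (\<lambda>\<nu>. \<Sum>t\<in>F \<union> G. ((if t \<in> F then c t else 0) + (if t \<in> G then d t else 0)) * cis (t * \<nu>))"
    unfolding p q distrib_right sum.distrib using 1 2 by (intro ext arg_cong2[where f = "(+)"])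
  then show ?thesis
    unfolding exp_span_def using F G
    by (intro CollectI exI[of _ "F \<union> G"] exI[of _ "\<lambda>t. (if t \<in> F then c t else 0) + (if t \<in> G then d t else 0)"]) simp
qed

lemma L2s_alt:
  "h \<in> L2s U f g \<longleftrightarrow> h \<in> L2 (spectral_measure f g) \<and>
     (\<forall>e>0. \<exists>p\<in>exp_span U. L2_sq (spectral_measure f g) (\<lambda>\<nu>. h \<nu> - p \<nu>) < e)"
  by (auto simp: L2s_def L2_sq_def)

context
  fixes f g :: "real \<Rightarrow> real" and U :: "real set"
  assumes f: "spectral_density f" and g: "spectral_density g"
begin

lemma L2s_closed: "L2_closed (spectral_measure f g) (L2s U f g)"
  unfolding L2_closed_def
proof (intro conjI ballI impI)
  let ?M = "spectral_measure f g"
  show "L2s U f g \<subseteq> L2 ?M" by (auto simp: L2s_def)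
  fix y assume y: "y \<in> L2 ?M" and cl: "\<forall>e>0. \<exists>x\<in>L2s U f g. L2_sq ?M (\<lambda>t. y t - x t) < e"
  have "\<exists>p\<in>exp_span U. L2_sq ?M (\<lambda>\<nu>. y \<nu> - p \<nu>) < e" if e: "0 < e" for e :: real
  proof -
    from e have e4: "0 < e / 4" by simp
    obtain x where x: "x \<in> L2s U f g" "L2_sq ?M (\<lambda>t. y t - x t) < e / 4" using cl e4 by blast
    obtain p where p: "p \<in> exp_span U" "L2_sq ?M (\<lambda>t. x t - p t) < e / 4"
      using x(1) e4 unfolding L2s_alt by blast
    have "x \<in> L2 ?M" using x(1) by (simp add: L2s_alt)
    from L2_sq_two_step[OF y this exp_span_L2[OF f g p(1)]] x(2) p(2)
    have "L2_sq ?M (\<lambda>\<nu>. y \<nu> - p \<nu>) < e" by linarith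
    with p(1) show ?thesis by blast
  qed
  with y show "y \<in> L2s U f g" by (simp add: L2s_alt)
qed

lemma exp_span_subset_L2s: "exp_span U \<subseteq> L2s U f g"
proof
  fix p assume p: "p \<in> exp_span U"
  have "\<exists>q\<in>exp_span U. L2_sq (spectral_measure f g) (\<lambda>\<nu>. p \<nu> - q \<nu>) < e" if "0 < e" for e
    using p that by (intro bexI[of _ p]) (auto simp: L2_sq_def)
  then show "p \<in> L2s U f g" using exp_span_L2[OF f g p] by (simp add: L2s_alt)
qed

lemma L2s_subspace: "L2_subspace (spectral_measure f g) (L2s U f g)"
  unfolding L2_subspace_def
proof (intro conjI ballI allI)
  let ?M = "spectral_measure f g"
  show "L2s U f g \<subseteq> L2 ?M" by (auto simp: L2s_def)
  show "(\<lambda>t. 0) \<in> L2s U f g" using exp_span_0 exp_span_subset_L2s by blast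
  fix x assume x: "x \<in> L2s U f g"
  then have xL: "x \<in> L2 ?M" by (simp add: L2s_alt)
  {
    fix y assume y: "y \<in> L2s U f g"
    then have yL: "y \<in> L2 ?M" by (simp add: L2s_alt)
    have "\<exists>p\<in>exp_span U. L2_sq ?M (\<lambda>\<nu>. (x \<nu> + y \<nu>) - p \<nu>) < e" if e: "0 < e" for e :: real
    proof -
      from e have e4: "0 < e / 4" by simp
      obtain p where p: "p \<in> exp_span U" "L2_sq ?M (\<lambda>t. x t - p t) < e / 4" using x e4 unfolding L2s_alt by blast
      obtain q where q: "q \<in> exp_span U" "L2_sq ?M (\<lambda>t. y t - q t) < e / 4" using y e4 unfolding L2s_alt by blast
      note pL = exp_span_L2[OF f g p(1)] and qL = exp_span_L2[OF f g q(1)]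
      have "L2_sq ?M (\<lambda>\<nu>. (x \<nu> + y \<nu>) - (p \<nu> + q \<nu>)) = L2_sq ?M (\<lambda>\<nu>. (x \<nu> - p \<nu>) + (y \<nu> - q \<nu>))"
        by (simp add: algebra_simps)
      also have "\<dots> \<le> 2 * L2_sq ?M (\<lambda>\<nu>. x \<nu> - p \<nu>) + 2 * L2_sq ?M (\<lambda>\<nu>. y \<nu> - q \<nu>)"
        using L2_parallelogram[OF L2_diff[OF xL pL] L2_diff[OF yL qL]]
          L2_sq_nonneg[of ?M "\<lambda>t. x t - p t - (y t - q t)"] by linarith
      also have "\<dots> < e" using p(2) q(2) by linarith
      finally show ?thesis using exp_span_add[OF p(1) q(1)] by (intro bexI[of _ "\<lambda>\<nu>. p \<nu> + q \<nu>"])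
    qed
    then show "(\<lambda>t. x t + y t) \<in> L2s U f g" using L2_add[OF xL yL] by (simp add: L2s_alt)
  }
  fix c :: complex
  have "\<exists>p\<in>exp_span U. L2_sq ?M (\<lambda>\<nu>. c * x \<nu> - p \<nu>) < e" if e: "0 < e" for e :: real
  proof -
    have c1: "0 < (cmod c)\<^sup>2 + 1" by (simp add: add_nonneg_pos)
    then have "0 < e / ((cmod c)\<^sup>2 + 1)" using e by simp
    then obtain p where p: "p \<in> exp_span U" "L2_sq ?M (\<lambda>t. x t - p t) < e / ((cmod c)\<^sup>2 + 1)"
      using x unfolding L2s_alt by blast
    have "L2_sq ?M (\<lambda>\<nu>. c * x \<nu> - c * p \<nu>) = (cmod c)\<^sup>2 * L2_sq ?M (\<lambda>t. x t - p t)"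
      unfolding right_diff_distrib[symmetric] by (rule L2_sq_scale)
    also have "\<dots> \<le> ((cmod c)\<^sup>2 + 1) * L2_sq ?M (\<lambda>t. x t - p t)" by (intro mult_right_mono) auto
    also have "\<dots> < e" using p(2) c1 by (simp add: pos_less_divide_eq mult.commute)
    finally show ?thesis using exp_span_scale[OF p(1)] by (intro bexI[of _ "\<lambda>\<nu>. c * p \<nu>"])
  qed
  then show "(\<lambda>t. c * x t) \<in> L2s U f g" using L2_scale[OF xL] by (simp add: L2s_alt)
qed

text \<open>Orthogonality passes from single exponentials to finite sums by linearity and to the
  closure by Cauchy-Schwarz.\<close>

lemma L2s_orthogonal:
  assumes k: "k \<in> L2 (spectral_measure f g)"
    and orth: "\<And>t. t \<in> U \<Longrightarrow> L2_ip (spectral_measure f g) k (\<lambda>\<nu>. cis (t * \<nu>)) = 0"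
    and h: "h \<in> L2s U f g"
  shows "L2_ip (spectral_measure f g) k h = 0"
proof -
  let ?M = "spectral_measure f g"
  have hL: "h \<in> L2 ?M" using h by (simp add: L2s_alt)
  have span: "L2_ip ?M k p = 0" if pU: "p \<in> exp_span U" for p
  proof -
    obtain F c where F: "finite F" "F \<subseteq> U" and p: "p = (\<lambda>\<nu>. \<Sum>t\<in>F. c t * cis (t * \<nu>))"
      using pU by (auto simp: exp_span_def)
    have cisL: "(\<lambda>\<nu>. cis (t * \<nu>)) \<in> L2 ?M" for t
      by (rule bounded_L2_spectral[OF f g, where c = 1]) auto
    from F have "L2_ip ?M k (\<lambda>\<nu>. \<Sum>t\<in>F. c t * cis (t * \<nu>)) = 0"
    proof (induction F rule: finite_induct)
      case empty
      then show ?case by (simp add: L2_ip_def)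
    next
      case (insert t F)
      then have "L2_ip ?M k (\<lambda>\<nu>. c t * cis (t * \<nu>) + (\<Sum>t\<in>F. c t * cis (t * \<nu>))) = 0"
        by (subst L2_ip_add_right[OF L2_scale[OF cisL] L2_sum[OF L2_scale[OF cisL]] k])
          (simp add: L2_ip_scale_right orth)
      then show ?case using insert by simp
    qed
    then show ?thesis by (simp add: p)
  qed
  show ?thesis
  proof (rule ccontr)
    assume nz: "L2_ip ?M k h \<noteq> 0"
    define r where "r = cmod (L2_ip ?M k h)"
    have r: "0 < r" using nz by (simp add: r_def)
    have K: "0 < L2_sq ?M k + 1" by (simp add: add_nonneg_pos)
    \<comment> \<open>This accuracy makes the Cauchy-Schwarz bound strictly smaller than
      \<open>r\<^sup>2\<close>; the summand 1 covers a \<open>k\<close> of norm zero.\<close>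
    have "0 < r\<^sup>2 / (L2_sq ?M k + 1)" using r K by simp
    then obtain p where p: "p \<in> exp_span U" "L2_sq ?M (\<lambda>t. h t - p t) < r\<^sup>2 / (L2_sq ?M k + 1)"
      using h unfolding L2s_alt by blast
    note pL = exp_span_L2[OF f g p(1)]
    have "r = cmod (L2_ip ?M k (\<lambda>t. h t - p t))"
      unfolding r_def using span[OF p(1)] by (simp add: L2_ip_diff_right[OF hL pL k])
    also have "\<dots> \<le> sqrt (L2_sq ?M k) * sqrt (L2_sq ?M (\<lambda>t. h t - p t))"
      by (rule L2_Cauchy_Schwarz[OF k L2_diff[OF hL pL]])
    finally have "r\<^sup>2 \<le> (sqrt (L2_sq ?M k) * sqrt (L2_sq ?M (\<lambda>t. h t - p t)))\<^sup>2"
      using r by (intro power_mono) auto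
    also have "\<dots> = L2_sq ?M k * L2_sq ?M (\<lambda>t. h t - p t)" by (simp add: power_mult_distrib)
    also have "\<dots> \<le> (L2_sq ?M k + 1) * L2_sq ?M (\<lambda>t. h t - p t)" by (intro mult_right_mono) auto
    also have "\<dots> < r\<^sup>2" using p(2) K by (simp add: pos_less_divide_eq mult.commute)
    finally show False by simp
  qed
qed

end

text \<open>Completing the square in \<open>h\<close> at one frequency: the unconstrained minimizer
  is \<open>A * f / (f + g)\<close>, and the remainder \<open>fg / (f + g)\<close> is the symbol of
  \<open>Q_op\<close>. At a common zero of \<open>f\<close> and \<open>g\<close> everything vanishes
  under division by zero.\<close>

lemma mse_pointwise:
  fixes A h :: complex and f g :: real
  assumes "0 \<le> f" "0 \<le> g"
  shows "(cmod (A - h))\<^sup>2 * f + (cmod h)\<^sup>2 * g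
       = (cmod (h - A * of_real (f / (f + g))))\<^sup>2 * (f + g) + (cmod A)\<^sup>2 * (f * g / (f + g))"
proof (cases "f + g = 0")
  case True
  with assms have "f = 0" "g = 0" by auto
  then show ?thesis by simp
next
  case False
  have sq: "(cmod (x - y))\<^sup>2 = (cmod x)\<^sup>2 + (cmod y)\<^sup>2 - 2 * Re (x * cnj y)" for x y
    using cmod_add_sq[of x "- y"] by simp
  define r R where "r = f / (f + g)" and "R = Re (h * cnj A)"
  have R: "Re (A * cnj h) = R" by (simp add: R_def mult.commute)
  have "f = r * (f + g)" using False by (simp add: r_def)
  then have rf: "r * f + r * g = f" by (simp add: distrib_left)
  have "f * g / (f + g) = r * g" by (simp add: r_def)
  moreover have "Re (h * cnj (A * of_real r)) = r * R" by (simp add: R_def algebra_simps)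
  moreover have "(cmod (A * of_real r))\<^sup>2 = r\<^sup>2 * (cmod A)\<^sup>2" by (simp add: norm_mult power_mult_distrib)
  ultimately have "(cmod (h - A * of_real r))\<^sup>2 * (f + g) + (cmod A)\<^sup>2 * (f * g / (f + g))
      = ((cmod h)\<^sup>2 + r\<^sup>2 * (cmod A)\<^sup>2 - 2 * (r * R)) * (f + g) + (cmod A)\<^sup>2 * (r * g)"
    by (simp only: sq)
  also have "\<dots> = (cmod h)\<^sup>2 * (f + g) + (cmod A)\<^sup>2 * (r * (r * f + r * g) + r * g) - 2 * R * (r * f + r * g)"
    by (simp add: algebra_simps power2_eq_square)
  also have "\<dots> = (cmod h)\<^sup>2 * (f + g) + (cmod A)\<^sup>2 * f - 2 * R * f"
    by (simp only: rf)
  also have "\<dots> = (cmod (A - h))\<^sup>2 * f + (cmod h)\<^sup>2 * g"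
    unfolding sq R by (simp add: algebra_simps)
  finally show ?thesis by (simp add: r_def)
qed

context
  fixes f g :: "real \<Rightarrow> real" and A :: "real \<Rightarrow> complex" and cA :: real
  assumes f: "spectral_density f" and g: "spectral_density g"
    and Am: "A \<in> borel_measurable lebesgue" and Ab: "\<And>\<nu>. cmod (A \<nu>) \<le> cA"
begin

lemma density_ratio_le_1: "cmod (complex_of_real (f \<nu> / (f \<nu> + g \<nu>))) \<le> 1"
  using spectral_densityD(1)[OF f, of \<nu>] spectral_densityD(1)[OF g, of \<nu>]
  by (auto simp: divide_le_eq simp del: of_real_divide)

lemma signal_part_L2: "(\<lambda>\<nu>. A \<nu> * of_real (f \<nu> / (f \<nu> + g \<nu>))) \<in> L2 (spectral_measure f g)"
proof (rule bounded_L2_spectral[OF f g, where c = cA])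
  note [measurable] = Am spectral_densityD(3)[OF f] spectral_densityD(3)[OF g]
  show "(\<lambda>\<nu>. A \<nu> * of_real (f \<nu> / (f \<nu> + g \<nu>))) \<in> borel_measurable lebesgue" by measurable
  show "cmod (A \<nu> * of_real (f \<nu> / (f \<nu> + g \<nu>))) \<le> cA" for \<nu>
    unfolding norm_mult by (rule order_trans[OF mult_left_le[OF density_ratio_le_1 norm_ge_zero] Ab])
qed

lemma mse_integrable:
  assumes h: "h \<in> L2 (spectral_measure f g)"
  shows "integrable lebesgue (\<lambda>\<nu>. (cmod (A \<nu> - h \<nu>))\<^sup>2 * f \<nu>)"
    and "integrable lebesgue (\<lambda>\<nu>. (cmod (h \<nu>))\<^sup>2 * g \<nu>)"
proof -
  note [measurable] = Am spectral_densityD(3)[OF f] spectral_densityD(3)[OF g]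
  have [measurable]: "h \<in> borel_measurable lebesgue" using h by (simp add: L2_spectral_iff[OF f g])
  have A: "A \<in> L2 (spectral_measure f g)" by (rule bounded_L2_spectral[OF f g Am Ab])
  note nn = spectral_densityD(1)[OF f] spectral_densityD(1)[OF g]
  have le: "\<bar>a\<^sup>2 * f \<nu>\<bar> \<le> \<bar>a\<^sup>2 * (f \<nu> + g \<nu>)\<bar>" "\<bar>a\<^sup>2 * g \<nu>\<bar> \<le> \<bar>a\<^sup>2 * (f \<nu> + g \<nu>)\<bar>" for a \<nu> :: real
    using nn[of \<nu>] by (auto simp: abs_mult intro!: mult_left_mono)
  show "integrable lebesgue (\<lambda>\<nu>. (cmod (A \<nu> - h \<nu>))\<^sup>2 * f \<nu>)"
    by (rule Bochner_Integration.integrable_bound[of _ "\<lambda>\<nu>. (cmod (A \<nu> - h \<nu>))\<^sup>2 * (f \<nu> + g \<nu>)"])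
      (use L2_diff[OF A h] le in \<open>auto simp: L2_spectral_iff[OF f g]\<close>)
  show "integrable lebesgue (\<lambda>\<nu>. (cmod (h \<nu>))\<^sup>2 * g \<nu>)"
    by (rule Bochner_Integration.integrable_bound[of _ "\<lambda>\<nu>. (cmod (h \<nu>))\<^sup>2 * (f \<nu> + g \<nu>)"])
      (use h le in \<open>auto simp: L2_spectral_iff[OF f g]\<close>)
qed

lemma mse_eq_single:
  assumes h: "h \<in> L2 (spectral_measure f g)"
  shows "mse A h f g = 1 / (2 * pi) * (LINT \<nu>|lebesgue. (cmod (A \<nu> - h \<nu>))\<^sup>2 * f \<nu> + (cmod (h \<nu>))\<^sup>2 * g \<nu>)"
  unfolding mse_def by (simp add: mse_integrable[OF h] distrib_left)

text \<open>Minimizing the error therefore means projecting \<open>A * f / (f + g)\<close> in the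
  weighted space; the second term does not depend on \<open>h\<close>.\<close>

lemma mse_decomposition:
  assumes h: "h \<in> L2 (spectral_measure f g)"
  shows "mse A h f g = 1 / (2 * pi) * (L2_sq (spectral_measure f g) (\<lambda>\<nu>. h \<nu> - A \<nu> * of_real (f \<nu> / (f \<nu> + g \<nu>)))
      + (LINT \<nu>|lebesgue. (cmod (A \<nu>))\<^sup>2 * (f \<nu> * g \<nu> / (f \<nu> + g \<nu>))))"
    and "integrable lebesgue (\<lambda>\<nu>. (cmod (A \<nu>))\<^sup>2 * (f \<nu> * g \<nu> / (f \<nu> + g \<nu>)))"
proof -
  let ?z = "\<lambda>\<nu>. A \<nu> * of_real (f \<nu> / (f \<nu> + g \<nu>))"
  note nn = spectral_densityD(1)[OF f] spectral_densityD(1)[OF g]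
  have hz: "(\<lambda>\<nu>. h \<nu> - ?z \<nu>) \<in> L2 (spectral_measure f g)" by (rule L2_diff[OF h signal_part_L2])
  have i1: "integrable lebesgue (\<lambda>\<nu>. (cmod (h \<nu> - ?z \<nu>))\<^sup>2 * (f \<nu> + g \<nu>))"
    using hz by (simp add: L2_spectral_iff[OF f g])
  have "integrable lebesgue (\<lambda>\<nu>. ((cmod (A \<nu> - h \<nu>))\<^sup>2 * f \<nu> + (cmod (h \<nu>))\<^sup>2 * g \<nu>) - (cmod (h \<nu> - ?z \<nu>))\<^sup>2 * (f \<nu> + g \<nu>))"
    by (intro Bochner_Integration.integrable_diff Bochner_Integration.integrable_add mse_integrable[OF h] i1)
  then show i2: "integrable lebesgue (\<lambda>\<nu>. (cmod (A \<nu>))\<^sup>2 * (f \<nu> * g \<nu> / (f \<nu> + g \<nu>)))"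
    unfolding mse_pointwise[OF nn] by simp
  show "mse A h f g = 1 / (2 * pi) * (L2_sq (spectral_measure f g) (\<lambda>\<nu>. h \<nu> - ?z \<nu>)
      + (LINT \<nu>|lebesgue. (cmod (A \<nu>))\<^sup>2 * (f \<nu> * g \<nu> / (f \<nu> + g \<nu>))))"
    unfolding mse_eq_single[OF h] mse_pointwise[OF nn] Bochner_Integration.integral_add[OF i1 i2]
    using hz by (simp add: L2_sq_spectral[OF f g] L2_spectral_iff[OF f g] del: of_real_divide)
qed

text \<open>Pythagoras: away from the projection the error grows by exactly a squared distance. The
  saddle point argument lives on this quadratic growth.\<close>

lemma mse_projection:
  assumes h0: "h0 \<in> L2s U f g"
    and orth: "\<And>h. h \<in> L2s U f g \<Longrightarrow>
      L2_ip (spectral_measure f g) (\<lambda>\<nu>. A \<nu> * of_real (f \<nu> / (f \<nu> + g \<nu>)) - h0 \<nu>) h = 0"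
    and h: "h \<in> L2s U f g"
  shows "mse A h f g = mse A h0 f g + 1 / (2 * pi) * L2_sq (spectral_measure f g) (\<lambda>\<nu>. h \<nu> - h0 \<nu>)"
proof -
  let ?M = "spectral_measure f g" and ?z = "\<lambda>\<nu>. A \<nu> * of_real (f \<nu> / (f \<nu> + g \<nu>))"
  have hL: "h \<in> L2 ?M" and h0L: "h0 \<in> L2 ?M" using h h0 by (auto simp: L2s_alt)
  note z = signal_part_L2
  have ip0: "L2_ip ?M (\<lambda>\<nu>. ?z \<nu> - h0 \<nu>) (\<lambda>\<nu>. h \<nu> - h0 \<nu>) = 0"
    by (simp only: L2_ip_diff_right[OF hL h0L L2_diff[OF z h0L]] orth[OF h] orth[OF h0] diff_self)
  have "L2_sq ?M (\<lambda>\<nu>. (?z \<nu> - h0 \<nu>) - (h \<nu> - h0 \<nu>)) = L2_sq ?M (\<lambda>\<nu>. ?z \<nu> - h0 \<nu>) + L2_sq ?M (\<lambda>\<nu>. h \<nu> - h0 \<nu>)"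
    by (simp only: L2_sq_diff[OF L2_diff[OF z h0L] L2_diff[OF hL h0L]] ip0 zero_complex.simps mult_zero_right diff_zero)
  moreover have "(\<lambda>\<nu>. (?z \<nu> - h0 \<nu>) - (h \<nu> - h0 \<nu>)) = (\<lambda>\<nu>. ?z \<nu> - h \<nu>)" by simp
  ultimately have "L2_sq ?M (\<lambda>\<nu>. h \<nu> - ?z \<nu>) = L2_sq ?M (\<lambda>\<nu>. h0 \<nu> - ?z \<nu>) + L2_sq ?M (\<lambda>\<nu>. h \<nu> - h0 \<nu>)"
    by (simp only: L2_sq_minus_commute[of ?M ?z])
  then show ?thesis
    unfolding mse_decomposition(1)[OF hL] mse_decomposition(1)[OF h0L] by (simp add: distrib_left)
qed

text \<open>The orthogonal projection is a minimizer, so the choice behind \<open>arg_min_on\<close>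
  picks a true minimum and \<open>opt_mse\<close> is attained.\<close>

lemma opt_char_optimal:
  shows "opt_char U A f g \<in> L2s U f g"
    and "h \<in> L2s U f g \<Longrightarrow> opt_mse U A f g \<le> mse A h f g"
proof -
  let ?M = "spectral_measure f g"
  define z where "z \<nu> = A \<nu> * of_real (f \<nu> / (f \<nu> + g \<nu>))" for \<nu>
  have "z \<in> L2 ?M" unfolding z_def[abs_def] by (rule signal_part_L2)
  then obtain h0 where h0: "h0 \<in> L2s U f g" and orth: "\<And>h. h \<in> L2s U f g \<Longrightarrow> L2_ip ?M (\<lambda>\<nu>. z \<nu> - h0 \<nu>) h = 0"
    by (rule L2_projection[OF L2s_subspace[OF f g, of U] L2s_closed[OF f g, of U]]) blast
  have "mse A h0 f g \<le> mse A h f g" if "h \<in> L2s U f g" for h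
    using mse_projection[OF h0 orth[unfolded z_def] that] L2_sq_nonneg[of ?M "\<lambda>\<nu>. h \<nu> - h0 \<nu>"] by simp
  then have "is_arg_min (\<lambda>h. mse A h f g) (\<lambda>h. h \<in> L2s U f g) h0"
    unfolding is_arg_min_linorder using h0 by blast
  then have "is_arg_min (\<lambda>h. mse A h f g) (\<lambda>h. h \<in> L2s U f g) (opt_char U A f g)"
    unfolding opt_char_def arg_min_on_def arg_min_def
    by (rule someI[of "is_arg_min (\<lambda>h. mse A h f g) (\<lambda>h. h \<in> L2s U f g)" h0])
  then show "opt_char U A f g \<in> L2s U f g" "h \<in> L2s U f g \<Longrightarrow> opt_mse U A f g \<le> mse A h f g"
    by (auto simp: is_arg_min_linorder opt_mse_def)
qed

end

text \<open>A larger density gives a stronger norm, so approximation by exponentials is inherited by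
  the smaller density. Applied to a mixture, which dominates multiples of both of its
  ingredients.\<close>

lemma spectral_dominated:
  assumes f: "spectral_density f" and g: "spectral_density g"
    and f': "spectral_density f'" and g': "spectral_density g'"
    and c: "0 < c" and le: "\<And>\<nu>. f \<nu> + g \<nu> \<le> c * (f' \<nu> + g' \<nu>)"
  shows "h \<in> L2 (spectral_measure f' g') \<Longrightarrow> h \<in> L2 (spectral_measure f g)"
    and "h \<in> L2 (spectral_measure f' g') \<Longrightarrow> L2_sq (spectral_measure f g) h \<le> c * L2_sq (spectral_measure f' g') h"
    and "h \<in> L2s U f' g' \<Longrightarrow> h \<in> L2s U f g"
proof -
  have L: "h \<in> L2 (spectral_measure f g) \<and> L2_sq (spectral_measure f g) h \<le> c * L2_sq (spectral_measure f' g') h"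
    if h: "h \<in> L2 (spectral_measure f' g')" for h
  proof -
    have hm: "h \<in> borel_measurable lebesgue" and hi: "integrable lebesgue (\<lambda>\<nu>. c * ((cmod (h \<nu>))\<^sup>2 * (f' \<nu> + g' \<nu>)))"
      using h by (auto simp: L2_spectral_iff[OF f' g'])
    note [measurable] = hm density_sum_measurable[OF f g]
    have pw: "(cmod (h \<nu>))\<^sup>2 * (f \<nu> + g \<nu>) \<le> c * ((cmod (h \<nu>))\<^sup>2 * (f' \<nu> + g' \<nu>))" for \<nu>
      using mult_left_mono[OF le[of \<nu>], of "(cmod (h \<nu>))\<^sup>2"] by (simp add: mult_ac)
    have i: "integrable lebesgue (\<lambda>\<nu>. (cmod (h \<nu>))\<^sup>2 * (f \<nu> + g \<nu>))"
    proof (rule Bochner_Integration.integrable_bound[OF hi])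
      show "AE \<nu> in lebesgue. norm ((cmod (h \<nu>))\<^sup>2 * (f \<nu> + g \<nu>)) \<le> norm (c * ((cmod (h \<nu>))\<^sup>2 * (f' \<nu> + g' \<nu>)))"
      proof (rule AE_I2)
        fix \<nu>
        have "0 \<le> (cmod (h \<nu>))\<^sup>2 * (f \<nu> + g \<nu>)" using density_sum_nonneg[OF f g] by simp
        with pw[of \<nu>] show "norm ((cmod (h \<nu>))\<^sup>2 * (f \<nu> + g \<nu>)) \<le> norm (c * ((cmod (h \<nu>))\<^sup>2 * (f' \<nu> + g' \<nu>)))"
          unfolding real_norm_def by linarith
      qed
    qed measurable
    have "(LINT \<nu>|lebesgue. (cmod (h \<nu>))\<^sup>2 * (f \<nu> + g \<nu>)) \<le> (LINT \<nu>|lebesgue. c * ((cmod (h \<nu>))\<^sup>2 * (f' \<nu> + g' \<nu>)))"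
      by (rule integral_mono[OF i hi pw])
    then show ?thesis using i hm by (simp add: L2_spectral_iff[OF f g] L2_sq_spectral[OF f g] L2_sq_spectral[OF f' g'])
  qed
  then show "h \<in> L2 (spectral_measure f' g') \<Longrightarrow> h \<in> L2 (spectral_measure f g)"
    "h \<in> L2 (spectral_measure f' g') \<Longrightarrow> L2_sq (spectral_measure f g) h \<le> c * L2_sq (spectral_measure f' g') h" by auto
  assume h: "h \<in> L2s U f' g'"
  then have hL: "h \<in> L2 (spectral_measure f' g')" by (simp add: L2s_alt)
  have "\<exists>p\<in>exp_span U. L2_sq (spectral_measure f g) (\<lambda>\<nu>. h \<nu> - p \<nu>) < e" if e: "0 < e" for e
  proof -
    have "0 < e / c" using e c by simp
    then obtain p where p: "p \<in> exp_span U" "L2_sq (spectral_measure f' g') (\<lambda>\<nu>. h \<nu> - p \<nu>) < e / c"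
      using h unfolding L2s_alt by blast
    have "L2_sq (spectral_measure f g) (\<lambda>\<nu>. h \<nu> - p \<nu>) \<le> c * L2_sq (spectral_measure f' g') (\<lambda>\<nu>. h \<nu> - p \<nu>)"
      using L[OF L2_diff[OF hL exp_span_L2[OF f' g' p(1)]]] by simp
    also have "\<dots> < e" using p(2) c by (simp add: pos_less_divide_eq mult.commute)
    finally show ?thesis using p(1) by blast
  qed
  then show "h \<in> L2s U f g" using L[OF hL] by (simp add: L2s_alt)
qed

section \<open>Spectra and density of trigonometric polynomials\<close>

text \<open>The minimality condition supplies an \<alpha> that is only integrable, so inversion is
  needed without square integrability. The double transform is bounded, hence locally integrable,
  and is compared with \<open>x\<close> on intervals.\<close>

lemma fourier_int_inversion_AE:
  fixes x :: "real \<Rightarrow> complex"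
  assumes x: "integrable lebesgue x" and X: "integrable lebesgue (fourier_int x)"
  shows "AE u in lebesgue. fourier_int (fourier_int x) (- u) = 2 * pi * x u"
proof -
  note [measurable] = borel_measurable_fourier_int[OF x] borel_measurable_fourier_int[OF X]
  have xm [measurable]: "x \<in> borel_measurable lebesgue" using x by auto
  define y where "y u = fourier_int (fourier_int x) (- u)" for u
  have ym [measurable]: "y \<in> borel_measurable lebesgue"
    using borel_measurable_affine[OF borel_measurable_fourier_int[OF X], of "-1" 0] by (simp add: y_def[abs_def])
  have yb: "cmod (y u) \<le> (LINT u|lebesgue. cmod (fourier_int x u))" for u
    unfolding y_def by (rule fourier_int_bound)
  have int: "integrable lebesgue (\<lambda>u. (y u - 2 * pi * x u) * indicator {a..b} u)" for a b :: real
  proof -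
    have "integrable lebesgue (\<lambda>u. indicator {a..b} u * y u)"
      by (rule integrable_bounded_mult[OF indicator_interval_L1_L2(1) ym yb])
    then have "integrable lebesgue (\<lambda>u. y u * indicator {a..b} u)" by (simp add: mult.commute)
    moreover have "integrable lebesgue (\<lambda>u. (2 * pi * x u) * indicator {a..b} u)"
      by (rule integrable_bounded_mult[where c = 1]) (use x in \<open>auto simp: indicator_def\<close>)
    ultimately show ?thesis unfolding left_diff_distrib by (rule Bochner_Integration.integrable_diff)
  qed
  have zero: "(LINT u|lebesgue. (y u - 2 * pi * x u) * indicator {a..b} u) = 0" if ab: "a < b" for a b :: real
  proof -
    let ?I = "indicator {a..b} :: real \<Rightarrow> complex"
    note I = indicator_interval_L1_L2(1)[of a b]
    note [measurable] = borel_measurable_fourier_int[OF I]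
    have e1: "(LINT \<nu>|lebesgue. fourier_int x \<nu> * cnj (fourier_int ?I \<nu>)) = 2 * pi * (LINT u|lebesgue. x u * ?I u)"
    proof (rule fourier_int_interval[OF x ab integrable_bounded_mult[OF X]])
      show "cmod (cnj (fourier_int ?I \<nu>)) \<le> (LINT u|lebesgue. cmod (?I u))" for \<nu>
        unfolding complex_mod_cnj by (rule fourier_int_bound)
    qed measurable
    let ?J = "\<lambda>u. ?I (- u)"
    have J: "integrable lebesgue ?J" by (rule integrable_lebesgue_minus[OF I])
    have cJ: "cnj (fourier_int ?I \<nu>) = fourier_int ?J \<nu>" for \<nu>
    proof -
      have "cnj (fourier_int ?I \<nu>) = (LINT u|lebesgue. ?I u * cis (u * - \<nu>))"
        unfolding cnj_fourier_int unfolding fourier_int_def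
        by (rule Bochner_Integration.integral_cong) (auto simp: indicator_def)
      also have "\<dots> = fourier_int ?J \<nu>"
        unfolding fourier_int_def by (subst integral_lebesgue_minus[symmetric]) simp
      finally show ?thesis .
    qed
    have "(LINT \<nu>|lebesgue. fourier_int x \<nu> * cnj (fourier_int ?I \<nu>)) = (LINT u|lebesgue. ?J u * fourier_int (fourier_int x) u)"
      unfolding cJ by (rule fourier_int_multiplication[OF J X])
    also have "\<dots> = (LINT u|lebesgue. y u * ?I u)"
      by (subst integral_lebesgue_minus[symmetric]) (simp add: y_def mult.commute)
    finally have e2: "(LINT u|lebesgue. y u * ?I u) = 2 * pi * (LINT u|lebesgue. x u * ?I u)" using e1 by simp
    have i1: "integrable lebesgue (\<lambda>u. y u * ?I u)"
      using integrable_bounded_mult[OF I ym yb] by (simp add: mult.commute)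
    have i2: "integrable lebesgue (\<lambda>u. 2 * pi * x u * ?I u)"
      by (rule integrable_bounded_mult[where c = 1]) (use x in \<open>auto simp: indicator_def\<close>)
    have "(LINT u|lebesgue. (y u - 2 * pi * x u) * ?I u) = (LINT u|lebesgue. y u * ?I u) - (LINT u|lebesgue. 2 * pi * x u * ?I u)"
      unfolding left_diff_distrib by (rule Bochner_Integration.integral_diff[OF i1 i2])
    also have "(LINT u|lebesgue. 2 * pi * x u * ?I u) = 2 * pi * (LINT u|lebesgue. x u * ?I u)"
      by (subst integral_mult_right_zero[symmetric]) (simp add: mult.assoc)
    finally show ?thesis using e2 by simp
  qed
  have "AE u in lebesgue. y u - 2 * pi * x u = 0"
    by (rule locally_eq_0_if_interval_integrals_eq_0[OF int zero])
  then show ?thesis by eventually_elim (simp add: y_def)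
qed

text \<open>Inversion gives the claim almost everywhere on the open half line, and continuity of the
  transform extends it to each point; single frequencies are needed for translates by trigonometric
  polynomials.\<close>

lemma fourier_int_half_line_spectrum:
  fixes x :: "real \<Rightarrow> complex"
  assumes x: "integrable lebesgue x" and X: "integrable lebesgue (fourier_int x)"
    and supp: "\<And>u. u < 0 \<Longrightarrow> x u = 0" and r: "0 < r"
  shows "fourier_int (fourier_int x) r = 0"
proof -
  have "AE u in lebesgue. fourier_int (fourier_int x) (- (- u)) = 2 * pi * x (- u)"
    using AE_lebesgue_minus[OF fourier_int_inversion_AE[OF x X]] .
  then have ae: "AE u\<in>{0<..} in lebesgue. u \<in> {u. fourier_int (fourier_int x) u = 0}"
    by eventually_elim (auto simp: supp)
  have cl: "closed {u. fourier_int (fourier_int x) u = 0}"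
    by (rule closed_Collect_eq[OF continuous_on_fourier_int[OF X] continuous_on_const])
  have "r \<in> {u. fourier_int (fourier_int x) u = 0}"
    by (rule mem_closed_if_AE_lebesgue_open[OF open_greaterThan cl ae]) (simp add: r)
  then show ?thesis by simp
qed

text \<open>If \<open>k\<close> annihilates all exponentials, then \<open>k * (f + g)\<close> is an
  integrable function with vanishing transform, hence zero almost everywhere.\<close>

lemma L2_trig_dense:
  assumes f: "spectral_density f" and g: "spectral_density g"
    and h: "h \<in> L2 (spectral_measure f g)"
  shows "h \<in> L2s UNIV f g"
proof (rule L2_double_orthogonal[OF L2s_subspace[OF f g] L2s_closed[OF f g] h])
  let ?M = "spectral_measure f g"
  fix k assume k: "k \<in> L2 ?M" and orth: "\<And>x. x \<in> L2s UNIV f g \<Longrightarrow> L2_ip ?M k x = 0"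
  define m where "m \<nu> = k \<nu> * of_real (f \<nu> + g \<nu>)" for \<nu>
  have km: "k \<in> borel_measurable lebesgue" and ki: "integrable lebesgue (\<lambda>\<nu>. (cmod (k \<nu>))\<^sup>2 * (f \<nu> + g \<nu>))"
    using k by (auto simp: L2_spectral_iff[OF f g])
  note [measurable] = km density_sum_measurable[OF f g]
  have mi: "integrable lebesgue m"
  proof (rule Bochner_Integration.integrable_bound)
    show "integrable lebesgue (\<lambda>\<nu>. (cmod (k \<nu>))\<^sup>2 * (f \<nu> + g \<nu>) + (f \<nu> + g \<nu>))"
      using ki spectral_densityD(2)[OF f] spectral_densityD(2)[OF g] by simp
    show "m \<in> borel_measurable lebesgue" unfolding m_def by measurable
    have "cmod (m \<nu>) \<le> (cmod (k \<nu>))\<^sup>2 * (f \<nu> + g \<nu>) + (f \<nu> + g \<nu>)" for \<nu>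
    proof -
      have p: "0 \<le> f \<nu> + g \<nu>" by (rule density_sum_nonneg[OF f g])
      have "cmod (k \<nu>) \<le> (cmod (k \<nu>))\<^sup>2 + 1"
        using sum_squares_bound[of "cmod (k \<nu>)" 1] norm_ge_zero[of "k \<nu>"]
        unfolding power_one mult_1_right by linarith
      from mult_right_mono[OF this p] have "cmod (k \<nu>) * (f \<nu> + g \<nu>) \<le> (cmod (k \<nu>))\<^sup>2 * (f \<nu> + g \<nu>) + (f \<nu> + g \<nu>)"
        by (simp only: distrib_right mult_1)
      moreover have "cmod (m \<nu>) = cmod (k \<nu>) * (f \<nu> + g \<nu>)"
        unfolding m_def norm_mult norm_of_real using p by simp
      ultimately show ?thesis by simp
    qed
    then show "AE \<nu> in lebesgue. norm (m \<nu>) \<le> norm ((cmod (k \<nu>))\<^sup>2 * (f \<nu> + g \<nu>) + (f \<nu> + g \<nu>))"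
      by (intro AE_I2) (metis abs_ge_self order_trans real_norm_def)
  qed
  have "fourier_int m t = 0" for t
  proof -
    have "(\<lambda>\<nu>. cis (- t * \<nu>)) \<in> L2s UNIV f g"
      using exp_span_subset_L2s[OF f g, of UNIV] exp_span_cis[of "- t" UNIV] by blast
    from orth[OF this] show ?thesis
      by (subst (asm) L2_ip_spectral[OF f g]) (simp_all add: fourier_int_def m_def cis_cnj mult_ac)
  qed
  then have "AE \<nu> in lebesgue. m \<nu> = 0" by (rule fourier_int_unique[OF mi])
  then have z: "AE \<nu> in lebesgue. h \<nu> * cnj (k \<nu>) * of_real (f \<nu> + g \<nu>) = 0"
    by eventually_elim (simp add: m_def del: of_real_add)
  show "L2_ip ?M h k = 0"
    using h km by (simp add: L2_ip_spectral[OF f g] L2_spectral_iff[OF f g] integral_eq_zero_AE[OF z] del: of_real_add)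
qed

text \<open>Approximate the indicator of the set where the inequality fails by trigonometric
  polynomials. Doing so in the space with weight \<open>w + v\<close> controls both sides at once,
  and the limiting inequality makes that set null.\<close>

lemma trig_dominated_imp_le:
  fixes w v :: "real \<Rightarrow> real" and K :: real
  assumes w: "spectral_density w" and v: "spectral_density v" and K: "0 \<le> K"
    and trig: "\<And>\<theta>. \<theta> \<in> exp_span UNIV \<Longrightarrow>
      (LINT \<nu>|lebesgue. (cmod (\<theta> \<nu>))\<^sup>2 * w \<nu>) \<le> K * (LINT \<nu>|lebesgue. (cmod (\<theta> \<nu>))\<^sup>2 * v \<nu>)"
  shows "AE \<nu> in lebesgue. w \<nu> \<le> K * v \<nu>"
proof -
  have z: "spectral_density (\<lambda>_. 0)" by (simp add: spectral_density_def)
  let ?W = "spectral_measure w (\<lambda>_. 0)" and ?V = "spectral_measure v (\<lambda>_. 0)" and ?M = "spectral_measure w v"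
  note nn = spectral_densityD(1)[OF w] spectral_densityD(1)[OF v]
  note domW = spectral_dominated[OF w z w v zero_less_one] and domV = spectral_dominated[OF v z w v zero_less_one]
  note [measurable] = spectral_densityD(3)[OF w] spectral_densityD(3)[OF v]
  define E where "E = {\<nu>. K * v \<nu> < w \<nu>}"
  have Em [measurable]: "E \<in> sets lebesgue"
  proof -
    have "{\<nu> \<in> space lebesgue. K * v \<nu> < w \<nu>} \<in> sets lebesgue" by measurable
    then show ?thesis by (simp add: E_def)
  qed
  define h :: "real \<Rightarrow> complex" where "h = indicator E"
  have hm [measurable]: "h \<in> borel_measurable lebesgue" unfolding h_def by measurable
  have hM: "h \<in> L2 ?M" by (rule bounded_L2_spectral[OF w v hm, where c = 1]) (simp add: h_def indicator_def)
  have hW: "h \<in> L2 ?W" and hV: "h \<in> L2 ?V" using domW(1)[OF _ hM] domV(1)[OF _ hM] nn by auto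
  have key: "sqrt (L2_sq ?W h) \<le> e + sqrt K * (sqrt (L2_sq ?V h) + e)" if e: "0 < e" for e :: real
  proof -
    have "0 < e\<^sup>2" using e by simp
    then obtain \<theta> where \<theta>: "\<theta> \<in> exp_span UNIV" "L2_sq ?M (\<lambda>\<nu>. h \<nu> - \<theta> \<nu>) < e\<^sup>2"
      using L2_trig_dense[OF w v hM] unfolding L2s_alt by blast
    note \<theta>L = exp_span_L2[OF w v \<theta>(1)] exp_span_L2[OF w z \<theta>(1)] exp_span_L2[OF v z \<theta>(1)]
    have \<theta>m: "\<theta> \<in> borel_measurable lebesgue" using \<theta>L(1) by (simp add: L2_spectral_iff[OF w v])
    have d: "(\<lambda>\<nu>. h \<nu> - \<theta> \<nu>) \<in> L2 ?M" by (rule L2_diff[OF hM \<theta>L(1)])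
    have dW: "sqrt (L2_sq ?W (\<lambda>\<nu>. h \<nu> - \<theta> \<nu>)) \<le> e"
      using domW(2)[OF _ d] \<theta>(2) nn e by (intro real_le_lsqrt) auto
    have dV: "sqrt (L2_sq ?V (\<lambda>\<nu>. h \<nu> - \<theta> \<nu>)) \<le> e"
      using domV(2)[OF _ d] \<theta>(2) nn e by (intro real_le_lsqrt) auto
    have "L2_sq ?W \<theta> \<le> K * L2_sq ?V \<theta>"
      using trig[OF \<theta>(1)] by (simp add: L2_sq_spectral[OF w z \<theta>m] L2_sq_spectral[OF v z \<theta>m])
    then have \<theta>W: "sqrt (L2_sq ?W \<theta>) \<le> sqrt K * sqrt (L2_sq ?V \<theta>)" by (simp flip: real_sqrt_mult)
    have "sqrt (L2_sq ?V \<theta>) \<le> sqrt (L2_sq ?V h) + sqrt (L2_sq ?V (\<lambda>\<nu>. h \<nu> - \<theta> \<nu>))"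
      using L2_minkowski_diff[OF hV L2_diff[OF hV \<theta>L(3)]] by simp
    then have "sqrt K * sqrt (L2_sq ?V \<theta>) \<le> sqrt K * (sqrt (L2_sq ?V h) + e)"
      using dV K by (intro mult_left_mono) auto
    moreover have "sqrt (L2_sq ?W h) \<le> sqrt (L2_sq ?W (\<lambda>\<nu>. h \<nu> - \<theta> \<nu>)) + sqrt (L2_sq ?W \<theta>)"
      using L2_minkowski[OF L2_diff[OF hW \<theta>L(2)] \<theta>L(2)] by simp
    ultimately show ?thesis using dW \<theta>W by linarith
  qed
  have "(\<lambda>n. 1 / real (Suc n) + sqrt K * (sqrt (L2_sq ?V h) + 1 / real (Suc n))) \<longlonglongrightarrow> 0 + sqrt K * (sqrt (L2_sq ?V h) + 0)"
    using LIMSEQ_inverse_real_of_nat unfolding inverse_eq_divide by (intro tendsto_intros)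
  then have "sqrt (L2_sq ?W h) \<le> 0 + sqrt K * (sqrt (L2_sq ?V h) + 0)"
    by (rule LIMSEQ_le_const) (use key in \<open>auto simp del: of_nat_Suc\<close>)
  then have "L2_sq ?W h \<le> K * L2_sq ?V h" by (simp flip: real_sqrt_mult)
  then have le: "(LINT \<nu>|lebesgue. (cmod (h \<nu>))\<^sup>2 * w \<nu>) \<le> K * (LINT \<nu>|lebesgue. (cmod (h \<nu>))\<^sup>2 * v \<nu>)"
    by (simp add: L2_sq_spectral[OF w z hm] L2_sq_spectral[OF v z hm])
  have iw: "integrable lebesgue (\<lambda>\<nu>. (cmod (h \<nu>))\<^sup>2 * w \<nu>)" and iv: "integrable lebesgue (\<lambda>\<nu>. (cmod (h \<nu>))\<^sup>2 * v \<nu>)"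
    using hW hV by (auto simp: L2_spectral_iff[OF w z] L2_spectral_iff[OF v z])
  define u where "u \<nu> = (cmod (h \<nu>))\<^sup>2 * w \<nu> - K * ((cmod (h \<nu>))\<^sup>2 * v \<nu>)" for \<nu>
  have u: "integrable lebesgue u" unfolding u_def using iw iv by simp
  have u0: "0 \<le> u \<nu>" for \<nu> unfolding u_def h_def E_def by (auto simp: indicator_def)
  have "(LINT \<nu>|lebesgue. u \<nu>) \<le> 0" unfolding u_def using iw iv le by simp
  moreover have "0 \<le> (LINT \<nu>|lebesgue. u \<nu>)" by (intro integral_nonneg_AE AE_I2 u0)
  ultimately have "(LINT \<nu>|lebesgue. u \<nu>) = 0" by simp
  then have "AE \<nu> in lebesgue. u \<nu> = 0" using integral_nonneg_eq_0_iff_AE[OF u] u0 by simp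
  then show ?thesis
  proof eventually_elim
    case (elim \<nu>)
    then show ?case by (auto simp: u_def h_def E_def indicator_def split: if_splits)
  qed
qed

section \<open>Coercivity and boundedness of the spectral density\<close>

text \<open>The function in the minimality condition is entire and not identically zero, so it has
  countably many zeros and vanishes on the real line only on a null set.\<close>

lemma minimalityE:
  assumes "minimality f g"
  obtains a where "integrable lebesgue a" "\<And>u. u < 0 \<Longrightarrow> a u = 0"
    "AE \<nu> in lebesgue. fourier_int a \<nu> \<noteq> 0"
    "(\<integral>\<^sup>+ \<nu>. ennreal ((cmod (fourier_int a \<nu>))\<^sup>2) / ennreal (f \<nu> + g \<nu>) \<partial>lebesgue) < \<infinity>"
proof -
  obtain \<gamma> \<alpha> where hol: "\<gamma> holomorphic_on UNIV" and \<alpha>: "set_integrable lebesgue {0..} \<alpha>"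
    and \<gamma>: "\<And>\<nu>::real. \<gamma> (of_real \<nu>) = (LINT t:{0..}|lebesgue. \<alpha> t * cis (t * \<nu>))"
    and nz: "\<exists>\<nu>::real. \<gamma> (of_real \<nu>) \<noteq> 0"
    and fin: "(\<integral>\<^sup>+ \<nu>. ennreal ((cmod (\<gamma> (of_real \<nu>)))\<^sup>2) / ennreal (f \<nu> + g \<nu>) \<partial>lebesgue) < \<infinity>"
    using assms unfolding minimality_def exponential_type_def by blast
  define a where "a t = indicator {0..} t *\<^sub>R \<alpha> t" for t
  have eq: "fourier_int a \<nu> = \<gamma> (of_real \<nu>)" for \<nu>
    unfolding fourier_int_def a_def \<gamma> set_lebesgue_integral_def by simp
  have cz: "countable {z. \<gamma> z = 0}"
  proof (rule ccontr)
    assume "uncountable {z. \<gamma> z = 0}"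
    then have "\<gamma> = (\<lambda>_. 0)" using holomorphic_countable_equal_UNIV[OF hol holomorphic_on_const[of 0]] by simp
    with nz show False by simp
  qed
  have "countable (complex_of_real ` {\<nu>. fourier_int a \<nu> = 0})"
    by (rule countable_subset[OF _ cz]) (auto simp: eq)
  then have "countable {\<nu>. fourier_int a \<nu> = 0}"
    by (rule countable_image_inj_on) (auto intro: inj_onI)
  then have "AE \<nu> in lborel. \<nu> \<notin> {\<nu>. fourier_int a \<nu> = 0}" by (intro AE_not_in countable_imp_null_set_lborel)
  then have "AE \<nu> in lebesgue. fourier_int a \<nu> \<noteq> 0" by (intro AE_completion) simp
  moreover have "integrable lebesgue a" using \<alpha> unfolding a_def set_integrable_def .
  ultimately show thesis using that[of a] fin by (simp add: a_def eq)
qed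

text \<open>The quotient is infinite wherever \<open>f + g\<close> vanishes and the transform does
  not; a finite integral permits this only on a null set.\<close>

lemma minimality_pos:
  assumes "minimality f g" and f: "spectral_density f" and g: "spectral_density g"
  shows "AE \<nu> in lebesgue. 0 < f \<nu> + g \<nu>"
proof -
  obtain a where a: "integrable lebesgue a" and nz: "AE \<nu> in lebesgue. fourier_int a \<nu> \<noteq> 0"
    and fin: "(\<integral>\<^sup>+ \<nu>. ennreal ((cmod (fourier_int a \<nu>))\<^sup>2) / ennreal (f \<nu> + g \<nu>) \<partial>lebesgue) < \<infinity>"
    by (rule minimalityE[OF assms(1)])
  note [measurable] = borel_measurable_fourier_int[OF a] density_sum_measurable[OF f g]
  have "AE \<nu> in lebesgue. ennreal ((cmod (fourier_int a \<nu>))\<^sup>2) / ennreal (f \<nu> + g \<nu>) \<noteq> \<infinity>"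
    by (rule nn_integral_noteq_infinite) (use fin in auto)
  with nz show ?thesis
  proof eventually_elim
    case (elim \<nu>)
    show ?case
    proof (rule ccontr)
      assume "\<not> 0 < f \<nu> + g \<nu>"
      then have "f \<nu> + g \<nu> = 0" using density_sum_nonneg[OF f g, of \<nu>] by linarith
      with elim show False by (simp add: ennreal_divide_eq_top_iff)
    qed
  qed
qed

text \<open>Division by the square root of the density turns the form of B into
  \<open>1 / (2 * pi)\<close> times an unweighted inner product, so the L2 theory applies to the
  form domain.\<close>

definition weighted ::
  "(real \<Rightarrow> real) \<Rightarrow> (real \<Rightarrow> real) \<Rightarrow> (real \<Rightarrow> complex) \<Rightarrow> real \<Rightarrow> complex" where
  "weighted f g m \<nu> = m \<nu> / of_real (sqrt (f \<nu> + g \<nu>))"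

lemma weighted_sq: "0 \<le> (f \<nu> + g \<nu>) \<Longrightarrow> (cmod (weighted f g m \<nu>))\<^sup>2 = (cmod (m \<nu>))\<^sup>2 / (f \<nu> + g \<nu>)"
  by (simp add: weighted_def norm_divide power_divide)

lemma weighted_mult: "0 \<le> (f \<nu> + g \<nu>) \<Longrightarrow> weighted f g m \<nu> * cnj (weighted f g k \<nu>) = m \<nu> * cnj (k \<nu>) / of_real ((f \<nu> + g \<nu>))"
proof -
  assume "0 \<le> (f \<nu> + g \<nu>)"
  then have "complex_of_real ((f \<nu> + g \<nu>)) = of_real (sqrt ((f \<nu> + g \<nu>))) * of_real (sqrt ((f \<nu> + g \<nu>)))"
    by (simp flip: of_real_mult)
  then show ?thesis by (simp add: weighted_def)
qed

lemma fourier_on_scale: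
  assumes T: "T \<in> sets lebesgue" and x: "ext0 T x \<in> L2 lebesgue"
  shows "AE \<nu> in lebesgue. fourier_on T (\<lambda>t. c * x t) \<nu> = c * fourier_on T x \<nu>"
proof -
  have "ext0 T (\<lambda>t. c * x t) = (\<lambda>t. c * ext0 T x t)" by (auto simp: ext0_def)
  then show ?thesis using L2_fourier_scale[OF x, of c] by (simp add: fourier_on_ext0)
qed

context
  fixes f g :: "real \<Rightarrow> real" and T :: "real set"
  assumes f: "spectral_density f" and g: "spectral_density g"
    and pos: "AE \<nu> in lebesgue. 0 < f \<nu> + g \<nu>"
    and T: "T \<in> sets lebesgue"
begin

lemmas [simp] = density_sum_nonneg[OF f g]

lemma density_sum_integrable: "integrable lebesgue (\<lambda>\<nu>. f \<nu> + g \<nu>)"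
  using spectral_densityD(2)[OF f] spectral_densityD(2)[OF g] by simp

lemma weighted_measurable: "m \<in> borel_measurable lebesgue \<Longrightarrow> weighted f g m \<in> borel_measurable lebesgue"
proof -
  assume [measurable]: "m \<in> borel_measurable lebesgue"
  note [measurable] = spectral_densityD(3)[OF f] spectral_densityD(3)[OF g]
  show ?thesis unfolding weighted_def[abs_def] by measurable
qed

lemma weighted_L2_iff:
  assumes "m \<in> borel_measurable lebesgue"
  shows "weighted f g m \<in> L2 lebesgue \<longleftrightarrow> integrable lebesgue (\<lambda>\<nu>. (cmod (m \<nu>))\<^sup>2 / (f \<nu> + g \<nu>))"
  using weighted_measurable[OF assms] by (simp add: L2_def weighted_sq)

lemma L2_sq_weighted: "L2_sq lebesgue (weighted f g m) = (LINT \<nu>|lebesgue. (cmod (m \<nu>))\<^sup>2 / (f \<nu> + g \<nu>))"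
  by (simp add: L2_sq_def weighted_sq)

lemma L2_ip_weighted: "L2_ip lebesgue (weighted f g m) (weighted f g k) = (LINT \<nu>|lebesgue. m \<nu> * cnj (k \<nu>) / of_real ((f \<nu> + g \<nu>)))"
  by (simp add: L2_ip_def weighted_mult del: of_real_add)

lemma weighted_L2_nn_integral:
  assumes m: "m \<in> borel_measurable lebesgue"
  shows "(\<integral>\<^sup>+ \<nu>. ennreal ((cmod (m \<nu>))\<^sup>2) / ennreal ((f \<nu> + g \<nu>)) \<partial>lebesgue) < \<infinity> \<longleftrightarrow> weighted f g m \<in> L2 lebesgue"
proof -
  note [measurable] = m weighted_measurable[OF m]
  have "(\<integral>\<^sup>+ \<nu>. ennreal ((cmod (m \<nu>))\<^sup>2) / ennreal ((f \<nu> + g \<nu>)) \<partial>lebesgue) = (\<integral>\<^sup>+ \<nu>. ennreal ((cmod (weighted f g m \<nu>))\<^sup>2) \<partial>lebesgue)"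
  proof (rule nn_integral_cong_AE)
    show "AE \<nu> in lebesgue. ennreal ((cmod (m \<nu>))\<^sup>2) / ennreal ((f \<nu> + g \<nu>)) = ennreal ((cmod (weighted f g m \<nu>))\<^sup>2)"
      using pos by eventually_elim (simp add: weighted_sq divide_ennreal)
  qed
  moreover have "(\<integral>\<^sup>+ \<nu>. ennreal ((cmod (weighted f g m \<nu>))\<^sup>2) \<partial>lebesgue) < \<infinity> \<longleftrightarrow> weighted f g m \<in> L2 lebesgue"
    using L2I_nn_integral[OF weighted_measurable[OF m]] nn_integral_eq_L2_sq[of "weighted f g m" lebesgue]
    by (metis ennreal_less_top infinity_ennreal_def)
  ultimately show ?thesis by (simp only:)
qed

text \<open>Write \<open>m\<close> as its weighted version times \<open>sqrt (f + g)\<close>, both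
  square integrable. Transforms from the form domain are thus integrable, and their own transforms
  are continuous.\<close>

lemma weighted_L2_imp_L1:
  assumes m: "m \<in> borel_measurable lebesgue" and w: "weighted f g m \<in> L2 lebesgue"
  shows "integrable lebesgue m"
proof (rule Bochner_Integration.integrable_bound)
  show "integrable lebesgue (\<lambda>\<nu>. (cmod (weighted f g m \<nu>))\<^sup>2 + (f \<nu> + g \<nu>))"
    by (intro Bochner_Integration.integrable_add L2_integrable[OF w] density_sum_integrable)
  show "AE \<nu> in lebesgue. norm (m \<nu>) \<le> norm ((cmod (weighted f g m \<nu>))\<^sup>2 + (f \<nu> + g \<nu>))"
    using pos
  proof eventually_elim
    case (elim \<nu>)
    have "m \<nu> = weighted f g m \<nu> * of_real (sqrt ((f \<nu> + g \<nu>)))" using elim by (simp add: weighted_def del: of_real_add)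
    then have "cmod (m \<nu>) = cmod (weighted f g m \<nu>) * sqrt ((f \<nu> + g \<nu>))"
      using elim by (metis norm_mult norm_of_real abs_of_nonneg real_sqrt_ge_zero less_imp_le)
    moreover have "2 * cmod (weighted f g m \<nu>) * sqrt ((f \<nu> + g \<nu>)) \<le> (cmod (weighted f g m \<nu>))\<^sup>2 + (sqrt ((f \<nu> + g \<nu>)))\<^sup>2"
      by (rule sum_squares_bound)
    moreover have "(sqrt ((f \<nu> + g \<nu>)))\<^sup>2 = (f \<nu> + g \<nu>)" by simp
    moreover have "0 \<le> cmod (weighted f g m \<nu>) * sqrt ((f \<nu> + g \<nu>))" by simp
    ultimately have "cmod (m \<nu>) \<le> (cmod (weighted f g m \<nu>))\<^sup>2 + (f \<nu> + g \<nu>)" by linarith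
    then show ?case by (metis abs_ge_self order_trans real_norm_def)
  qed
qed (fact m)

lemma B_domain_iff:
  "x \<in> B_domain T f g \<longleftrightarrow> ext0 T x \<in> L2 lebesgue \<and> weighted f g (fourier_on T x) \<in> L2 lebesgue"
  unfolding B_domain_def mem_Collect_eq L2_lebesgue_on_iff[OF T]
  using weighted_L2_nn_integral[OF L2_measurable[OF L2_fourier_L2[of "ext0 T x"]]] fourier_on_ext0[of T x]
  by auto

lemma B_domainD:
  assumes "x \<in> B_domain T f g"
  shows "ext0 T x \<in> L2 lebesgue" "fourier_on T x \<in> L2 lebesgue" "weighted f g (fourier_on T x) \<in> L2 lebesgue"
    "integrable lebesgue (fourier_on T x)"
proof -
  show x: "ext0 T x \<in> L2 lebesgue" and w: "weighted f g (fourier_on T x) \<in> L2 lebesgue"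
    using assms by (auto simp: B_domain_iff)
  show m: "fourier_on T x \<in> L2 lebesgue" unfolding fourier_on_ext0 by (rule L2_fourier_L2[OF x])
  show "integrable lebesgue (fourier_on T x)" by (rule weighted_L2_imp_L1[OF L2_measurable[OF m] w])
qed

lemma L2_sq_fourier_on:
  assumes "ext0 T x \<in> L2 lebesgue"
  shows "L2_sq lebesgue (fourier_on T x) = 2 * pi * L2_sq (lebesgue_on T) x"
proof -
  have "complex_of_real (L2_sq lebesgue (fourier_on T x)) = of_real (2 * pi * L2_sq (lebesgue_on T) x)"
    using L2_fourier_Parseval[OF assms assms] by (simp add: L2_ip_self fourier_on_ext0 L2_sq_ext0[OF T])
  then show ?thesis by (simp only: of_real_eq_iff)
qed

text \<open>The preimage of \<open>m\<close> under the transform is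
  \<open>fourier_int m (- t) / (2 * pi)\<close> up to null sets, so the spectral condition says that
  this preimage lives on \<open>T\<close>.\<close>

lemma B_domain_of_spectrum:
  assumes m1: "integrable lebesgue m" and m2: "m \<in> L2 lebesgue" and w: "weighted f g m \<in> L2 lebesgue"
    and supp: "\<And>t. t \<notin> T \<Longrightarrow> fourier_int m (- t) = 0"
  obtains x where "x \<in> B_domain T f g" "AE \<nu> in lebesgue. fourier_on T x \<nu> = m \<nu>"
proof -
  define x where "x t = 1 / (2 * pi) * L2_fourier m (- t)" for t
  have x: "x \<in> L2 lebesgue" and X: "AE \<nu> in lebesgue. L2_fourier x \<nu> = m \<nu>"
    using L2_fourier_surj[OF m2] by (simp_all add: x_def[abs_def])
  have "AE t in lebesgue. L2_fourier m (- t) = fourier_int m (- t)"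
    using AE_lebesgue_minus[OF L2_fourier_eq_fourier_int[OF m1 m2]] .
  then have ae: "AE t in lebesgue. x t = ext0 T x t"
    by eventually_elim (auto simp: x_def ext0_def supp)
  have em: "ext0 T x \<in> borel_measurable lebesgue"
    unfolding ext0_def[abs_def] using L2_measurable[OF x] T by (intro measurable_If_set) auto
  have eL: "ext0 T x \<in> L2 lebesgue" by (rule L2_cong_AE[OF x em ae])
  have "L2_fourier x = fourier_on T x"
    unfolding fourier_on_ext0 by (rule L2_fourier_cong_AE[OF L2_measurable[OF x] em ae])
  with X have AE: "AE \<nu> in lebesgue. fourier_on T x \<nu> = m \<nu>" by simp
  have fm: "fourier_on T x \<in> borel_measurable lebesgue"
    unfolding fourier_on_ext0 by (rule L2_measurable[OF L2_fourier_L2[OF eL]])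
  have "weighted f g (fourier_on T x) \<in> L2 lebesgue"
    by (rule L2_cong_AE[OF w weighted_measurable[OF fm]])
      (use AE in \<open>eventually_elim, simp add: weighted_def\<close>)
  then have "x \<in> B_domain T f g" using eL by (simp add: B_domain_iff)
  then show thesis using AE that by blast
qed

text \<open>Surjectivity writes each \<open>y\<close> as \<open>B x\<close>, so on the unit ball of
  the form the pairing with \<open>y\<close> is a form pairing with \<open>x\<close> and is bounded
  by Cauchy-Schwarz. Uniform boundedness then bounds the ball in L2(T), and scaling gives the
  inequality.\<close>

lemma B_coercive:
  assumes surj: "\<And>y. y \<in> L2 (lebesgue_on T) \<Longrightarrow> \<exists>x. B_rel T f g x y"
  obtains C where "0 \<le> C"
    "\<And>x. x \<in> B_domain T f g \<Longrightarrow> L2_sq (lebesgue_on T) x \<le> C * L2_sq lebesgue (weighted f g (fourier_on T x))"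
proof -
  define D where "D = {k \<in> B_domain T f g. L2_sq lebesgue (weighted f g (fourier_on T k)) \<le> 1}"
  have "\<exists>C. \<forall>k\<in>D. L2_sq (lebesgue_on T) k \<le> C"
  proof (rule L2_uniform_boundedness)
    show "D \<subseteq> L2 (lebesgue_on T)" by (auto simp: D_def B_domain_def)
    fix y assume "y \<in> L2 (lebesgue_on T)"
    then obtain x where x: "B_rel T f g x y" using surj by blast
    then have xD: "x \<in> B_domain T f g" by (simp add: B_rel_def)
    have "cmod (L2_ip (lebesgue_on T) y k) \<le> 1 / (2 * pi) * sqrt (L2_sq lebesgue (weighted f g (fourier_on T x)))"
      if k: "k \<in> D" for k
    proof -
      have kD: "k \<in> B_domain T f g" and k1: "L2_sq lebesgue (weighted f g (fourier_on T k)) \<le> 1"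
        using k by (auto simp: D_def)
      have "L2_ip (lebesgue_on T) y k = 1 / (2 * pi) * L2_ip lebesgue (weighted f g (fourier_on T x)) (weighted f g (fourier_on T k))"
        using x kD unfolding B_rel_def L2_ip_weighted by (simp add: L2_inner_def L2_ip_def)
      then have "cmod (L2_ip (lebesgue_on T) y k)
          = 1 / (2 * pi) * cmod (L2_ip lebesgue (weighted f g (fourier_on T x)) (weighted f g (fourier_on T k)))"
        by (simp add: norm_mult norm_divide)
      also have "\<dots> \<le> 1 / (2 * pi) * (sqrt (L2_sq lebesgue (weighted f g (fourier_on T x))) * sqrt (L2_sq lebesgue (weighted f g (fourier_on T k))))"
        by (intro mult_left_mono L2_Cauchy_Schwarz B_domainD xD kD) auto
      also have "\<dots> \<le> 1 / (2 * pi) * (sqrt (L2_sq lebesgue (weighted f g (fourier_on T x))) * 1)"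
        using k1 by (intro mult_left_mono) auto
      finally show ?thesis by simp
    qed
    then show "\<exists>c. \<forall>k\<in>D. cmod (L2_ip (lebesgue_on T) y k) \<le> c" by blast
  qed
  then obtain C where C: "\<And>k. k \<in> D \<Longrightarrow> L2_sq (lebesgue_on T) k \<le> C" by blast
  show thesis
  proof
    show "0 \<le> max C 0" by simp
    fix x assume x: "x \<in> B_domain T f g"
    define q where "q = L2_sq lebesgue (weighted f g (fourier_on T x))"
    note xL = B_domainD[OF x]
    show "L2_sq (lebesgue_on T) x \<le> max C 0 * q"
    proof (cases "q = 0")
      \<comment> \<open>A vanishing form leaves nothing to normalise by; positivity of
        \<open>f + g\<close> makes the transform of \<open>x\<close> vanish, and Parseval makes its
        norm zero.\<close>
      case True
      then have "AE \<nu> in lebesgue. weighted f g (fourier_on T x) \<nu> = 0"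
        using L2_sq_eq_0_iff[OF xL(3)] by (simp add: q_def)
      with pos have "AE \<nu> in lebesgue. fourier_on T x \<nu> = 0"
        by eventually_elim (auto simp: weighted_def)
      then have "L2_sq lebesgue (fourier_on T x) = 0" using L2_sq_eq_0_iff[OF xL(2)] by simp
      then show ?thesis using L2_sq_fourier_on[OF xL(1)] True by simp
    next
      case False
      then have q: "0 < q" using L2_sq_nonneg[of lebesgue "weighted f g (fourier_on T x)"] by (simp add: q_def less_le)
      define c where "c = complex_of_real (1 / sqrt q)"
      have c2: "(cmod c)\<^sup>2 = 1 / q" using q by (simp add: c_def norm_divide power_divide)
      define k where "k t = c * x t" for t
      have ek: "ext0 T k = (\<lambda>t. c * ext0 T x t)" by (auto simp: ext0_def k_def)
      have ekL: "ext0 T k \<in> L2 lebesgue" unfolding ek by (rule L2_scale[OF xL(1)])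
      have "AE \<nu> in lebesgue. fourier_on T k \<nu> = c * fourier_on T x \<nu>"
        using fourier_on_scale[OF T xL(1)] by (simp add: k_def[abs_def])
      then have ae: "AE \<nu> in lebesgue. c * weighted f g (fourier_on T x) \<nu> = weighted f g (fourier_on T k) \<nu>"
        by eventually_elim (simp add: weighted_def)
      have wk: "weighted f g (fourier_on T k) \<in> borel_measurable lebesgue"
        unfolding fourier_on_ext0 by (intro weighted_measurable L2_measurable L2_fourier_L2 ekL)
      have wkL: "weighted f g (fourier_on T k) \<in> L2 lebesgue"
        by (rule L2_cong_AE[OF L2_scale[OF xL(3)] wk ae])
      have "L2_sq lebesgue (weighted f g (fourier_on T k)) = L2_sq lebesgue (\<lambda>\<nu>. c * weighted f g (fourier_on T x) \<nu>)"
        unfolding L2_sq_def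
        by (rule integral_cong_AE) (use wk weighted_measurable[OF L2_measurable[OF xL(2)]] ae in \<open>auto elim: eventually_mono\<close>)
      also have "\<dots> = 1" using q by (simp add: L2_sq_scale c2 flip: q_def)
      finally have "k \<in> D" using ekL wkL by (simp add: D_def B_domain_iff)
      from C[OF this] have "1 / q * L2_sq (lebesgue_on T) x \<le> C"
        by (simp add: k_def[abs_def] L2_sq_scale c2)
      then have "L2_sq (lebesgue_on T) x \<le> C * q" using q by (simp add: field_simps)
      also have "\<dots> \<le> max C 0 * q" using q by (intro mult_right_mono) auto
      finally show ?thesis .
    qed
  qed
qed

text \<open>On the products \<open>G * \<theta>\<close>, coercivity and Parseval compare the weights
  of modulus squared \<open>G\<close> and of the same divided by \<open>f + g\<close>, with constant
  \<open>2 * pi * C\<close>. Since \<theta> is arbitrary, the comparison holds pointwise, and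
  \<open>G\<close> cancels because it is nonzero almost everywhere.\<close>

lemma density_bounded:
  assumes min: "minimality f g" and half: "{0..} \<subseteq> T"
    and surj: "\<And>y. y \<in> L2 (lebesgue_on T) \<Longrightarrow> \<exists>x. B_rel T f g x y"
  obtains K where "AE \<nu> in lebesgue. (f \<nu> + g \<nu>) \<le> K"
proof -
  obtain C where C: "0 \<le> C"
    "\<And>x. x \<in> B_domain T f g \<Longrightarrow> L2_sq (lebesgue_on T) x \<le> C * L2_sq lebesgue (weighted f g (fourier_on T x))"
    by (rule B_coercive[OF surj]) blast+
  obtain a where a: "integrable lebesgue a" and supp: "\<And>u. u < 0 \<Longrightarrow> a u = 0"
    and nz: "AE \<nu> in lebesgue. fourier_int a \<nu> \<noteq> 0"
    and fin: "(\<integral>\<^sup>+ \<nu>. ennreal ((cmod (fourier_int a \<nu>))\<^sup>2) / ennreal ((f \<nu> + g \<nu>)) \<partial>lebesgue) < \<infinity>"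
    by (rule minimalityE[OF min]) blast
  define G where "G = fourier_int a"
  have Gm [measurable]: "G \<in> borel_measurable lebesgue" unfolding G_def by (rule borel_measurable_fourier_int[OF a])
  have Gw: "weighted f g G \<in> L2 lebesgue" using fin weighted_L2_nn_integral[OF Gm] by (simp add: G_def)
  have G1: "integrable lebesgue G" by (rule weighted_L2_imp_L1[OF Gm Gw])
  define c where "c = (LINT u|lebesgue. cmod (a u))"
  have Gb: "cmod (G \<nu>) \<le> c" for \<nu> unfolding G_def c_def by (rule fourier_int_bound)
  have G2: "G \<in> L2 lebesgue"
  proof (rule L2I_bound[OF Gm])
    show "integrable lebesgue (\<lambda>\<nu>. c * cmod (G \<nu>))" using G1 by simp
    show "AE \<nu> in lebesgue. (cmod (G \<nu>))\<^sup>2 \<le> c * cmod (G \<nu>)"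
      unfolding power2_eq_square by (intro AE_I2 mult_right_mono Gb) auto
  qed
  have spec: "fourier_int G r = 0" if "0 < r" for r
    unfolding G_def by (rule fourier_int_half_line_spectrum[OF a _ supp that]) (use G1 in \<open>simp_all add: G_def\<close>)
  define w v where "w \<nu> = (cmod (G \<nu>))\<^sup>2" and "v \<nu> = (cmod (G \<nu>))\<^sup>2 / (f \<nu> + g \<nu>)" for \<nu>
  have w: "spectral_density w" using L2_integrable[OF G2] by (simp add: spectral_density_def w_def[abs_def])
  have v: "spectral_density v"
    using Gw weighted_L2_iff[OF Gm] by (simp add: spectral_density_def v_def[abs_def])
  have "AE \<nu> in lebesgue. w \<nu> \<le> 2 * pi * C * v \<nu>"
  proof (rule trig_dominated_imp_le[OF w v])
    show "0 \<le> 2 * pi * C" using C(1) by simp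
    fix \<theta> assume "\<theta> \<in> exp_span UNIV"
    then obtain F d where F: "finite F" and \<theta>: "\<theta> = (\<lambda>\<nu>. \<Sum>t\<in>F. d t * cis (t * \<nu>))" by (auto simp: exp_span_def)
    \<comment> \<open>The factor \<open>cis (L * \<nu>)\<close> shifts every frequency of \<theta>
      to a nonnegative one, so the preimage of the product stays supported in the half line inside
      \<open>T\<close>; moduli are unchanged.\<close>
    define L where "L = (\<Sum>t\<in>F. \<bar>t\<bar>)"
    have L: "0 \<le> t + L" if "t \<in> F" for t
      using member_le_sum[OF that, of abs] F by (simp add: L_def)
    define m where "m \<nu> = G \<nu> * (\<theta> \<nu> * cis (L * \<nu>))" for \<nu>
    have \<theta>m [measurable]: "\<theta> \<in> borel_measurable lebesgue" unfolding \<theta> by measurable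
    have \<theta>b: "cmod (\<theta> \<nu> * cis (L * \<nu>)) \<le> (\<Sum>t\<in>F. cmod (d t))" for \<nu>
      unfolding \<theta> norm_mult norm_cis mult_1_right
      by (rule order_trans[OF norm_sum]) (simp add: norm_mult)
    have tb: "AE \<nu> in lebesgue. cmod (\<theta> \<nu> * cis (L * \<nu>)) \<le> (\<Sum>t\<in>F. cmod (d t))"
      by (intro AE_I2 \<theta>b)
    have tm: "(\<lambda>\<nu>. \<theta> \<nu> * cis (L * \<nu>)) \<in> borel_measurable lebesgue" by measurable
    have cm: "cmod (m \<nu>) = cmod (\<theta> \<nu>) * cmod (G \<nu>)" for \<nu> by (simp add: m_def norm_mult)
    have m1: "integrable lebesgue m" unfolding m_def by (rule integrable_bounded_mult[OF G1 _ \<theta>b]) measurable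
    have m2: "m \<in> L2 lebesgue"
      unfolding m_def[abs_def] by (subst mult.commute) (rule L2_bounded_mult[OF G2 tm tb])
    have "weighted f g m = (\<lambda>\<nu>. (\<theta> \<nu> * cis (L * \<nu>)) * weighted f g G \<nu>)" by (auto simp: m_def weighted_def)
    then have mw: "weighted f g m \<in> L2 lebesgue" using L2_bounded_mult[OF Gw tm tb] by simp
    have "fourier_int m (- t) = 0" if t: "t \<notin> T" for t
    proof -
      have t0: "t < 0" using t half by (metis atLeast_iff not_le subsetD)
      have gi: "integrable lebesgue (\<lambda>\<nu>. G \<nu> * cis (\<nu> * r))" for r by (rule integrable_cis_mult[OF G1])
      have "m \<nu> * cis (\<nu> * - t) = (\<Sum>s\<in>F. d s * (G \<nu> * cis (\<nu> * (s + L - t))))" for \<nu>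
      proof -
        have "cis (\<nu> * (s + L - t)) = cis (s * \<nu>) * cis (L * \<nu>) * cis (\<nu> * - t)" for s
          by (simp add: cis_mult algebra_simps)
        then show ?thesis
          unfolding m_def \<theta> sum_distrib_left sum_distrib_right
          by (intro sum.cong refl) (simp only: mult_ac)
      qed
      then have "fourier_int m (- t) = (\<Sum>s\<in>F. d s * fourier_int G (s + L - t))"
        unfolding fourier_int_def using gi by (simp add: Bochner_Integration.integral_sum)
      also have "\<dots> = 0"
      proof (intro sum.neutral ballI)
        fix s assume "s \<in> F"
        then have "0 < s + L - t" using L[of s] t0 by linarith
        then show "d s * fourier_int G (s + L - t) = 0" by (simp add: spec)
      qed
      finally show ?thesis .
    qed
    then obtain x where x: "x \<in> B_domain T f g" and ae: "AE \<nu> in lebesgue. fourier_on T x \<nu> = m \<nu>"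
      by (rule B_domain_of_spectrum[OF m1 m2 mw])
    note xL = B_domainD[OF x]
    have "L2_sq lebesgue m = L2_sq lebesgue (fourier_on T x)"
      unfolding L2_sq_def
      by (rule integral_cong_AE) (use L2_measurable[OF m2] L2_measurable[OF xL(2)] ae in \<open>auto elim: eventually_mono\<close>)
    also have "\<dots> \<le> 2 * pi * (C * L2_sq lebesgue (weighted f g (fourier_on T x)))"
      unfolding L2_sq_fourier_on[OF xL(1)] by (intro mult_left_mono C(2)[OF x]) simp
    also have "L2_sq lebesgue (weighted f g (fourier_on T x)) = L2_sq lebesgue (weighted f g m)"
    proof (rule L2_sq_cong_AE[OF L2_measurable[OF xL(3)] L2_measurable[OF mw]])
      show "AE \<nu> in lebesgue. weighted f g (fourier_on T x) \<nu> = weighted f g m \<nu>"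
        using ae by eventually_elim (simp add: weighted_def)
    qed
    finally have "L2_sq lebesgue m \<le> 2 * pi * C * L2_sq lebesgue (weighted f g m)" by (simp add: mult.assoc)
    then show "(LINT \<nu>|lebesgue. (cmod (\<theta> \<nu>))\<^sup>2 * w \<nu>) \<le> 2 * pi * C * (LINT \<nu>|lebesgue. (cmod (\<theta> \<nu>))\<^sup>2 * v \<nu>)"
      unfolding L2_sq_weighted unfolding L2_sq_def by (simp add: cm power_mult_distrib w_def v_def)
  qed
  with nz pos have "AE \<nu> in lebesgue. (f \<nu> + g \<nu>) \<le> 2 * pi * C"
  proof eventually_elim
    case (elim \<nu>)
    then have "0 < (cmod (G \<nu>))\<^sup>2" by (simp add: G_def)
    moreover from elim have "(cmod (G \<nu>))\<^sup>2 * (f \<nu> + g \<nu>) \<le> (cmod (G \<nu>))\<^sup>2 * (2 * pi * C)"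
      by (simp add: w_def v_def pos_le_divide_eq mult_ac del: distrib_left_numeral)
    ultimately show ?case by (simp only: mult_le_cancel_left_pos)
  qed
  then show thesis by (rule that)
qed

end

section \<open>The optimal estimate for an invertible pair\<close>

lemma ext0_L2:
  assumes T: "T \<in> sets lebesgue" and x: "x \<in> L2 lebesgue"
  shows "ext0 T x \<in> L2 lebesgue"
proof -
  have "(\<lambda>t. indicator T t * x t) \<in> L2 lebesgue"
    by (rule L2_bounded_mult[OF x, where c = 1]) (use T in \<open>auto simp: indicator_def\<close>)
  moreover have "ext0 T x = (\<lambda>t. indicator T t * x t)" by (auto simp: ext0_def indicator_def)
  ultimately show ?thesis by simp
qed

context
  fixes f g :: "real \<Rightarrow> real" and T :: "real set" and b :: "real \<Rightarrow> complex"
  assumes f: "spectral_density f" and g: "spectral_density g"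
    and min: "minimality f g" and inv: "B_invertible T f g"
    and T: "T \<in> sets lebesgue" and T_closed: "closed T" and half: "{0..} \<subseteq> T"
    and b1: "integrable lebesgue b" and b2: "b \<in> L2 lebesgue" and b0: "\<And>u. u \<notin> T \<Longrightarrow> b u = 0"
begin

lemma signal_measurable: "(\<lambda>\<nu>. fourier_int b (- \<nu>)) \<in> borel_measurable lebesgue"
  using borel_measurable_affine[OF borel_measurable_fourier_int[OF b1], of "-1" 0] by simp

lemma signal_bounded: "cmod (fourier_int b (- \<nu>)) \<le> (LINT u|lebesgue. cmod (b u))"
  by (rule fourier_int_bound)

text \<open>The minimizer of the error when every characteristic is allowed; the estimate is its
  projection onto the observed exponentials.\<close>

definition signal_part :: "real \<Rightarrow> complex" where
  "signal_part \<nu> = fourier_int b (- \<nu>) * of_real (f \<nu> / (f \<nu> + g \<nu>))"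

lemma signal_part_L2_lebesgue: "signal_part \<in> L2 lebesgue"
proof -
  note [measurable] = spectral_densityD(3)[OF f] spectral_densityD(3)[OF g]
  have "(\<lambda>\<nu>. of_real (f \<nu> / (f \<nu> + g \<nu>)) * fourier_int b (- \<nu>)) \<in> L2 lebesgue"
  proof (rule L2_bounded_mult[OF L2_minus[OF fourier_int_L2(1)[OF b1 b2]]])
    show "AE \<nu> in lebesgue. cmod (of_real (f \<nu> / (f \<nu> + g \<nu>))) \<le> 1"
      by (intro AE_I2 density_ratio_le_1[OF f g signal_measurable signal_bounded])
  qed measurable
  then show ?thesis unfolding signal_part_def[abs_def] by (simp add: mult.commute)
qed

text \<open>\<open>R_op\<close> is the inverse transform formula applied to the signal part. Its
  value is considered on the whole line here; restriction to \<open>T\<close> takes place in the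
  inner products.\<close>

lemma R_op_L2:
  shows "R_op T f g b \<in> L2 lebesgue"
    and "AE \<nu> in lebesgue. L2_fourier (R_op T f g b) \<nu> = signal_part \<nu>"
proof -
  note [measurable] = spectral_densityD(3)[OF f] spectral_densityD(3)[OF g]
  define W where "W \<nu> = fourier_on T b (- \<nu>) * complex_of_real (f \<nu> / (f \<nu> + g \<nu>))" for \<nu>
  have "ext0 T b = b" using b0 by (auto simp: ext0_def)
  then have fb: "fourier_on T b = L2_fourier b" by (simp add: fourier_on_ext0)
  have ae: "AE \<nu> in lebesgue. signal_part \<nu> = W \<nu>"
    using AE_lebesgue_minus[OF L2_fourier_eq_fourier_int[OF b1 b2]]
    by eventually_elim (simp add: W_def fb signal_part_def)
  have [measurable]: "(\<lambda>\<nu>. fourier_on T b (- \<nu>)) \<in> borel_measurable lebesgue"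
    unfolding fb by (rule L2_measurable[OF L2_minus[OF L2_fourier_L2[OF b2]]])
  have "W \<in> borel_measurable lebesgue" unfolding W_def by measurable
  then have W: "W \<in> L2 lebesgue" by (rule L2_cong_AE[OF signal_part_L2_lebesgue _ ae])
  have R: "R_op T f g b = (\<lambda>t. 1 / (2 * pi) * L2_fourier W (- t))"
    by (auto simp: R_op_def W_def[abs_def])
  show "R_op T f g b \<in> L2 lebesgue" unfolding R by (rule L2_fourier_surj(1)[OF W])
  show "AE \<nu> in lebesgue. L2_fourier (R_op T f g b) \<nu> = signal_part \<nu>"
    using L2_fourier_surj(2)[OF W] ae unfolding R by eventually_elim simp
qed

lemma R_op_inner:
  assumes x: "ext0 T x \<in> L2 lebesgue"
  shows "L2_inner T (R_op T f g b) x = 1 / (2 * pi) * L2_ip lebesgue signal_part (fourier_on T x)"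
proof -
  have "L2_inner T (R_op T f g b) x = L2_ip lebesgue (R_op T f g b) (ext0 T x)"
    unfolding L2_inner_ext0[OF T] L2_ip_def
    by (rule Bochner_Integration.integral_cong) (auto simp: ext0_def)
  also have "\<dots> = 1 / (2 * pi) * L2_ip lebesgue (L2_fourier (R_op T f g b)) (fourier_on T x)"
    unfolding fourier_on_ext0 L2_fourier_Parseval[OF R_op_L2(1) x] by simp
  also have "L2_ip lebesgue (L2_fourier (R_op T f g b)) (fourier_on T x) = L2_ip lebesgue signal_part (fourier_on T x)"
    by (rule L2_ip_cong_AE[OF L2_fourier_L2[OF R_op_L2(1)] _ signal_part_L2_lebesgue _ R_op_L2(2)])
      (auto simp: fourier_on_ext0 intro: L2_fourier_L2 x)
  finally show ?thesis .
qed

lemma C_fun_rel: "B_rel T f g (B_inv T f g (R_op T f g b)) (R_op T f g b)"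
proof -
  have "R_op T f g b \<in> L2 (lebesgue_on T)"
    unfolding L2_lebesgue_on_iff[OF T] by (rule ext0_L2[OF T R_op_L2(1)])
  then have "\<exists>x. B_rel T f g x (R_op T f g b)" using inv by (simp add: B_invertible_def)
  then show ?thesis unfolding B_inv_def by (rule someI_ex)
qed

lemmas density_pos = minimality_pos[OF min f g]

lemmas x0_domain = C_fun_rel[unfolded B_rel_def, THEN conjunct1]

lemmas C_fun_L2 = B_domainD[OF f g density_pos T x0_domain, folded C_fun_def]

text \<open>The equation \<open>B x = R b\<close> in weak form, with both sides moved to the
  frequency side: \<open>noise_part\<close> and \<open>signal_part\<close> have the same unweighted
  pairing with all transforms from the form domain. These are the normal equations of the
  projection.\<close>

lemma C_fun_inner:
  assumes k: "k \<in> B_domain T f g"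
  shows "L2_ip lebesgue (weighted f g (C_fun T b f g)) (weighted f g (fourier_on T k))
       = L2_ip lebesgue signal_part (fourier_on T k)"
proof -
  have "1 / (2 * pi) * L2_ip lebesgue (weighted f g (C_fun T b f g)) (weighted f g (fourier_on T k))
      = L2_inner T (R_op T f g b) k"
    using C_fun_rel k unfolding B_rel_def L2_ip_weighted[OF f g density_pos T] C_fun_def by blast
  also have "\<dots> = 1 / (2 * pi) * L2_ip lebesgue signal_part (fourier_on T k)"
    by (rule R_op_inner) (rule B_domainD(1)[OF f g density_pos T k])
  finally show ?thesis by simp
qed

text \<open>The residual of the projection: what the estimate leaves of the signal part.\<close>

definition noise_part :: "real \<Rightarrow> complex" where
  "noise_part \<nu> = C_fun T b f g \<nu> / of_real (f \<nu> + g \<nu>)"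

lemma noise_part_L2:
  shows "noise_part \<in> L2 (spectral_measure f g)"
    and "L2_sq (spectral_measure f g) noise_part = L2_sq lebesgue (weighted f g (C_fun T b f g))"
proof -
  note [measurable] = spectral_densityD(3)[OF f] spectral_densityD(3)[OF g] L2_measurable[OF C_fun_L2(2)]
  have m: "noise_part \<in> borel_measurable lebesgue" unfolding noise_part_def[abs_def] by measurable
  have pw: "(cmod (noise_part \<nu>))\<^sup>2 * (f \<nu> + g \<nu>) = (cmod (weighted f g (C_fun T b f g) \<nu>))\<^sup>2" for \<nu>
    unfolding weighted_sq[where f = f and g = g, OF density_sum_nonneg[OF f g]] noise_part_def norm_divide norm_of_real power_divide power2_abs
    by (simp add: power2_eq_square)
  show "noise_part \<in> L2 (spectral_measure f g)"
    using m L2_integrable[OF C_fun_L2(3)] by (simp add: L2_spectral_iff[OF f g] pw)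
  show "L2_sq (spectral_measure f g) noise_part = L2_sq lebesgue (weighted f g (C_fun T b f g))"
    unfolding L2_sq_spectral[OF f g m] pw by (simp add: L2_sq_def)
qed

text \<open>The weight cancels, so the pairing with the exponential of frequency \<open>t\<close> is
  \<open>fourier_int C (- t)\<close>. By inversion it vanishes almost everywhere off
  \<open>T\<close>; it is continuous and the complement of \<open>T\<close> is open, so it vanishes
  at each observed time.\<close>

lemma noise_part_orthogonal:
  assumes h: "h \<in> L2s (- T) f g"
  shows "L2_ip (spectral_measure f g) noise_part h = 0"
proof (rule L2s_orthogonal[OF f g noise_part_L2(1) _ h])
  let ?C = "C_fun T b f g" and ?x = "B_inv T f g (R_op T f g b)"
  note [measurable] = spectral_densityD(3)[OF f] spectral_densityD(3)[OF g] L2_measurable[OF C_fun_L2(2)]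
  have xL: "ext0 T ?x \<in> L2 lebesgue" by (rule B_domainD(1)[OF f g density_pos T x0_domain])
  have "AE t in lebesgue. L2_fourier ?C t = 2 * pi * ext0 T ?x (- t)"
    unfolding C_fun_def fourier_on_ext0 by (rule L2_fourier_inversion[OF xL])
  with L2_fourier_eq_fourier_int[OF C_fun_L2(4,2)]
  have "AE t in lebesgue. fourier_int ?C t = 2 * pi * ext0 T ?x (- t)" by eventually_elim simp
  from AE_lebesgue_minus[OF this] have ae: "AE t\<in>- T in lebesgue. t \<in> {t. fourier_int ?C (- t) = 0}"
    by eventually_elim (auto simp: ext0_def)
  have cl: "closed {t. fourier_int ?C (- t) = 0}"
    by (intro closed_Collect_eq continuous_on_const
        continuous_on_compose2[OF continuous_on_fourier_int[OF C_fun_L2(4), of UNIV]] continuous_intros) auto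
  fix t assume "t \<in> - T"
  with T_closed have "t \<in> {t. fourier_int ?C (- t) = 0}"
    by (intro mem_closed_if_AE_lebesgue_open[OF _ cl ae]) auto
  then have z: "fourier_int ?C (- t) = 0" by simp
  have "L2_ip (spectral_measure f g) noise_part (\<lambda>\<nu>. cis (t * \<nu>))
      = (LINT \<nu>|lebesgue. noise_part \<nu> * cnj (cis (t * \<nu>)) * of_real (f \<nu> + g \<nu>))"
    by (rule L2_ip_spectral[OF f g]) (use noise_part_L2(1) in \<open>auto simp: L2_spectral_iff[OF f g]\<close>)
  also have "\<dots> = fourier_int ?C (- t)"
    unfolding fourier_int_def
  proof (rule integral_cong_AE)
    show "AE \<nu> in lebesgue. noise_part \<nu> * cnj (cis (t * \<nu>)) * of_real (f \<nu> + g \<nu>) = ?C \<nu> * cis (\<nu> * - t)"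
      using density_pos
    proof eventually_elim
      case (elim \<nu>)
      then have "complex_of_real (f \<nu> + g \<nu>) \<noteq> 0" by (simp del: of_real_add)
      then show ?case by (simp add: noise_part_def cis_cnj mult.commute del: of_real_add)
    qed
    show "(\<lambda>\<nu>. noise_part \<nu> * cnj (cis (t * \<nu>)) * complex_of_real (f \<nu> + g \<nu>)) \<in> borel_measurable lebesgue"
      unfolding noise_part_def[abs_def] by measurable
  qed measurable
  finally show "L2_ip (spectral_measure f g) noise_part (\<lambda>\<nu>. cis (t * \<nu>)) = 0" using z by simp
qed

lemma signal_minus_noise_L2s: "(\<lambda>\<nu>. signal_part \<nu> - noise_part \<nu>) \<in> L2s (- T) f g"
proof -
  let ?M = "spectral_measure f g" and ?C = "C_fun T b f g"
  have sL: "signal_part \<in> L2 ?M"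
    unfolding signal_part_def[abs_def] by (rule signal_part_L2[OF f g signal_measurable signal_bounded])
  have hL: "(\<lambda>\<nu>. signal_part \<nu> - noise_part \<nu>) \<in> L2 ?M" by (rule L2_diff[OF sL noise_part_L2(1)])
  have surj: "\<exists>x. B_rel T f g x y" if "y \<in> L2 (lebesgue_on T)" for y
    using inv that by (simp add: B_invertible_def)
  obtain K where K: "AE \<nu> in lebesgue. f \<nu> + g \<nu> \<le> K"
    by (rule density_bounded[OF f g density_pos T min half surj]) blast+
  show ?thesis
  proof (rule L2_double_orthogonal[OF L2s_subspace[OF f g] L2s_closed[OF f g] hL])
    fix k assume k: "k \<in> L2 ?M" and orth: "\<And>x. x \<in> L2s (- T) f g \<Longrightarrow> L2_ip ?M k x = 0"
    have km: "k \<in> borel_measurable lebesgue" and ki: "integrable lebesgue (\<lambda>\<nu>. (cmod (k \<nu>))\<^sup>2 * (f \<nu> + g \<nu>))"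
      using k by (auto simp: L2_spectral_iff[OF f g])
    note [measurable] = km spectral_densityD(3)[OF f] spectral_densityD(3)[OF g]
      L2_measurable[OF C_fun_L2(2)] L2_measurable[OF signal_part_L2_lebesgue]
    \<comment> \<open>Absorbing the weight turns orthogonality to the observed exponentials into
      vanishing of the unweighted transform off \<open>T\<close>.\<close>
    define m where "m \<nu> = k \<nu> * of_real (f \<nu> + g \<nu>)" for \<nu>
    have mm [measurable]: "m \<in> borel_measurable lebesgue" unfolding m_def by measurable
    have cm: "(cmod (m \<nu>))\<^sup>2 = (cmod (k \<nu>))\<^sup>2 * (f \<nu> + g \<nu>)\<^sup>2" for \<nu>
      unfolding m_def norm_mult norm_of_real power_mult_distrib power2_abs ..
    have mw: "weighted f g m \<in> L2 lebesgue"
    proof (rule L2I_bound[OF weighted_measurable[OF f g density_pos T mm] ki])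
      show "AE \<nu> in lebesgue. (cmod (weighted f g m \<nu>))\<^sup>2 \<le> (cmod (k \<nu>))\<^sup>2 * (f \<nu> + g \<nu>)"
        unfolding weighted_sq[where f = f and g = g, OF density_sum_nonneg[OF f g]] cm by (simp add: power2_eq_square)
    qed
    have m1: "integrable lebesgue m" by (rule weighted_L2_imp_L1[OF f g density_pos T mm mw])
    have m2: "m \<in> L2 lebesgue"
    proof (rule L2I_bound[OF mm])
      show "integrable lebesgue (\<lambda>\<nu>. K * ((cmod (k \<nu>))\<^sup>2 * (f \<nu> + g \<nu>)))" using ki by simp
      show "AE \<nu> in lebesgue. (cmod (m \<nu>))\<^sup>2 \<le> K * ((cmod (k \<nu>))\<^sup>2 * (f \<nu> + g \<nu>))"
        using K
      proof eventually_elim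
        case (elim \<nu>)
        have "(cmod (k \<nu>))\<^sup>2 * (f \<nu> + g \<nu>) * (f \<nu> + g \<nu>) \<le> (cmod (k \<nu>))\<^sup>2 * (f \<nu> + g \<nu>) * K"
          using elim density_sum_nonneg[OF f g, of \<nu>] by (intro mult_left_mono) auto
        then show ?case unfolding cm by (simp add: power2_eq_square mult_ac)
      qed
    qed
    have "fourier_int m (- t) = 0" if "t \<notin> T" for t
    proof -
      have "(\<lambda>\<nu>. cis (t * \<nu>)) \<in> L2s (- T) f g"
        using exp_span_subset_L2s[OF f g, of "- T"] exp_span_cis[of t "- T"] that by blast
      from orth[OF this] show ?thesis
        by (subst (asm) L2_ip_spectral[OF f g]) (simp_all add: fourier_int_def m_def cis_cnj mult_ac)
    qed
    then obtain x where x: "x \<in> B_domain T f g" and ae: "AE \<nu> in lebesgue. fourier_on T x \<nu> = m \<nu>"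
      by (rule B_domain_of_spectrum[OF f g density_pos T m1 m2 mw])
    note xL = B_domainD[OF f g density_pos T x]
    note [measurable] = L2_measurable[OF xL(2)]
    have nm: "noise_part \<in> borel_measurable lebesgue" using noise_part_L2(1) by (simp add: L2_spectral_iff[OF f g])
    have "L2_ip ?M signal_part k = (LINT \<nu>|lebesgue. signal_part \<nu> * cnj (k \<nu>) * of_real (f \<nu> + g \<nu>))"
      by (rule L2_ip_spectral[OF f g]) measurable
    also have "\<dots> = L2_ip lebesgue signal_part (fourier_on T x)"
      unfolding L2_ip_def
    proof (rule integral_cong_AE)
      show "AE \<nu> in lebesgue. signal_part \<nu> * cnj (k \<nu>) * of_real (f \<nu> + g \<nu>) = signal_part \<nu> * cnj (fourier_on T x \<nu>)"
        using ae by eventually_elim (simp add: m_def)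
    qed measurable
    \<comment> \<open>The weak equation tested at the preimage \<open>x\<close> of \<open>m\<close>
      makes the pairings of signal and noise part with \<open>k\<close> equal.\<close>
    also have "\<dots> = L2_ip lebesgue (weighted f g ?C) (weighted f g (fourier_on T x))"
      by (rule C_fun_inner[OF x, symmetric])
    also have "\<dots> = (LINT \<nu>|lebesgue. ?C \<nu> * cnj (fourier_on T x \<nu>) / of_real (f \<nu> + g \<nu>))"
      by (rule L2_ip_weighted[OF f g density_pos T])
    also have "\<dots> = (LINT \<nu>|lebesgue. noise_part \<nu> * cnj (k \<nu>) * of_real (f \<nu> + g \<nu>))"
    proof (rule integral_cong_AE)
      show "AE \<nu> in lebesgue. ?C \<nu> * cnj (fourier_on T x \<nu>) / of_real (f \<nu> + g \<nu>) = noise_part \<nu> * cnj (k \<nu>) * of_real (f \<nu> + g \<nu>)"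
        using ae by eventually_elim (simp add: m_def noise_part_def)
      show "(\<lambda>\<nu>. noise_part \<nu> * cnj (k \<nu>) * complex_of_real (f \<nu> + g \<nu>)) \<in> borel_measurable lebesgue"
        using nm by measurable
    qed measurable
    also have "\<dots> = L2_ip ?M noise_part k"
      by (rule L2_ip_spectral[OF f g nm km, symmetric])
    finally show "L2_ip ?M (\<lambda>\<nu>. signal_part \<nu> - noise_part \<nu>) k = 0"
      by (simp add: L2_ip_diff_left[OF sL noise_part_L2(1) k])
  qed
qed

text \<open>The symbol \<open>fg / (f + g)\<close> is dominated by \<open>f\<close>, hence
  integrable, so two interchanges of integration diagonalise the form of Q. The result is the term
  of \<open>mse_decomposition\<close> that does not depend on \<open>h\<close>.\<close>

lemma Q_op_inner:
  "L2_inner T (Q_op T f g b) b = of_real (1 / (2 * pi) *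
     (LINT \<nu>|lebesgue. (cmod (fourier_int b (- \<nu>)))\<^sup>2 * (f \<nu> * g \<nu> / (f \<nu> + g \<nu>))))"
proof -
  note [measurable] = spectral_densityD(3)[OF f] spectral_densityD(3)[OF g] signal_measurable L2_measurable[OF b2]
  define q where "q \<nu> = complex_of_real (f \<nu> * g \<nu> / (f \<nu> + g \<nu>))" for \<nu>
  define A where "A \<nu> = fourier_int b (- \<nu>)" for \<nu>
  have Am [measurable]: "A \<in> borel_measurable lebesgue" unfolding A_def[abs_def] by (rule signal_measurable)
  have qm [measurable]: "q \<in> borel_measurable lebesgue" unfolding q_def by measurable
  have q1: "integrable lebesgue q"
  proof (rule Bochner_Integration.integrable_bound[OF spectral_densityD(2)[OF f] qm])
    have "\<bar>f \<nu> * g \<nu> / (f \<nu> + g \<nu>)\<bar> \<le> \<bar>f \<nu>\<bar>" for \<nu>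
    proof -
      have "0 \<le> f \<nu>" "0 \<le> g \<nu>" using spectral_densityD(1)[OF f] spectral_densityD(1)[OF g] by auto
      then have "f \<nu> * (g \<nu> / (f \<nu> + g \<nu>)) \<le> f \<nu> * 1" by (intro mult_left_mono) (auto simp: divide_le_eq)
      with \<open>0 \<le> f \<nu>\<close> \<open>0 \<le> g \<nu>\<close> show ?thesis by simp
    qed
    then show "AE \<nu> in lebesgue. norm (q \<nu>) \<le> norm (f \<nu>)" unfolding q_def norm_of_real real_norm_def by simp
  qed
  have qA: "integrable lebesgue (\<lambda>\<nu>. q \<nu> * A \<nu>)"
    by (rule integrable_bounded_mult[OF q1 Am]) (unfold A_def, rule signal_bounded)
  have inner: "Q_op T f g b t = 1 / (2 * pi) * (LINT \<nu>|lebesgue. q \<nu> * A \<nu> * cis (t * \<nu>))" for t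
  proof -
    let ?k = "\<lambda>\<nu> u. cis (- (\<nu> * (u - t)))"
    have "(LINT u|lebesgue_on T. b u * (LINT \<nu>|lebesgue. cis (- (\<nu> * (u - t))) * q \<nu>))
        = (LINT u|lebesgue. indicator T u *\<^sub>R (b u * (LINT \<nu>|lebesgue. cis (- (\<nu> * (u - t))) * q \<nu>)))"
      using T by (intro integral_restrict_space) auto
    also have "\<dots> = (LINT u|lebesgue. b u * (LINT \<nu>|lebesgue. q \<nu> * ?k \<nu> u))"
      by (rule Bochner_Integration.integral_cong) (use b0 in \<open>auto simp: indicator_def mult.commute\<close>)
    also have "\<dots> = (LINT \<nu>|lebesgue. q \<nu> * (LINT u|lebesgue. b u * ?k \<nu> u))"
      by (rule Fubini_pair_bounded[OF q1 b1, where c = 1]) auto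
    also have "(\<lambda>\<nu>. q \<nu> * (LINT u|lebesgue. b u * ?k \<nu> u)) = (\<lambda>\<nu>. q \<nu> * A \<nu> * cis (t * \<nu>))"
    proof
      fix \<nu>
      have "?k \<nu> u = cis (u * - \<nu>) * cis (t * \<nu>)" for u by (simp add: cis_mult algebra_simps)
      then have "(LINT u|lebesgue. b u * ?k \<nu> u) = (LINT u|lebesgue. b u * cis (u * - \<nu>) * cis (t * \<nu>))"
        by (simp only: mult.assoc)
      also have "\<dots> = A \<nu> * cis (t * \<nu>)" unfolding A_def fourier_int_def by (rule integral_mult_left_zero)
      finally show "q \<nu> * (LINT u|lebesgue. b u * ?k \<nu> u) = q \<nu> * A \<nu> * cis (t * \<nu>)" by (simp only: mult.assoc)
    qed
    finally show ?thesis by (simp add: Q_op_def q_def)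
  qed
  have b1': "integrable lebesgue (\<lambda>t. cnj (b t))" using b1 by simp
  have "L2_inner T (Q_op T f g b) b = (LINT t|lebesgue. indicator T t *\<^sub>R (Q_op T f g b t * cnj (b t)))"
    unfolding L2_inner_def using T by (intro integral_restrict_space) auto
  also have "\<dots> = (LINT t|lebesgue. 1 / (2 * pi) * (cnj (b t) * (LINT \<nu>|lebesgue. q \<nu> * A \<nu> * cis (t * \<nu>))))"
    by (rule Bochner_Integration.integral_cong) (use b0 in \<open>auto simp: indicator_def inner\<close>)
  also have "\<dots> = 1 / (2 * pi) * (LINT t|lebesgue. cnj (b t) * (LINT \<nu>|lebesgue. q \<nu> * A \<nu> * cis (t * \<nu>)))"
    by (rule integral_mult_right_zero)
  also have "(LINT t|lebesgue. cnj (b t) * (LINT \<nu>|lebesgue. q \<nu> * A \<nu> * cis (t * \<nu>)))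
      = (LINT \<nu>|lebesgue. q \<nu> * A \<nu> * (LINT t|lebesgue. cnj (b t) * cis (t * \<nu>)))"
    by (rule Fubini_pair_bounded[OF qA b1', where c = 1]) auto
  also have "\<dots> = (LINT \<nu>|lebesgue. complex_of_real ((cmod (A \<nu>))\<^sup>2 * (f \<nu> * g \<nu> / (f \<nu> + g \<nu>))))"
  proof (rule Bochner_Integration.integral_cong[OF refl])
    fix \<nu>
    have "cnj (A \<nu>) = (LINT t|lebesgue. cnj (b t) * cis (t * \<nu>))"
      unfolding A_def cnj_fourier_int minus_minus by (simp only: fourier_int_def)
    moreover have "A \<nu> * cnj (A \<nu>) = complex_of_real ((cmod (A \<nu>))\<^sup>2)" by (rule complex_norm_square[symmetric])
    ultimately show "q \<nu> * A \<nu> * (LINT t|lebesgue. cnj (b t) * cis (t * \<nu>)) = complex_of_real ((cmod (A \<nu>))\<^sup>2 * (f \<nu> * g \<nu> / (f \<nu> + g \<nu>)))"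
      unfolding q_def of_real_mult[of "(cmod (A \<nu>))\<^sup>2"] by (metis mult.assoc mult.commute)
  qed
  also have "\<dots> = of_real (LINT \<nu>|lebesgue. (cmod (A \<nu>))\<^sup>2 * (f \<nu> * g \<nu> / (f \<nu> + g \<nu>)))"
    by (rule integral_complex_of_real)
  finally show ?thesis by (simp add: A_def)
qed

text \<open>The two summands of the error expression match the two summands of the error of
  \<open>h0\<close>: the R-term is the squared norm of the residual over \<open>2 * pi\<close>, by
  the weak equation tested at its own solution, and the Q-term is the constant.\<close>

theorem invertible_optimal:
  defines "A \<equiv> \<lambda>\<nu>. fourier_int b (- \<nu>)"
    and "h0 \<equiv> \<lambda>\<nu>. fourier_int b (- \<nu>) * of_real (f \<nu> / (f \<nu> + g \<nu>)) - C_fun T b f g \<nu> / of_real (f \<nu> + g \<nu>)"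
  shows "h0 \<in> L2s (- T) f g"
    and "h \<in> L2s (- T) f g \<Longrightarrow>
      mse A h f g = mse A h0 f g + 1 / (2 * pi) * L2_sq (spectral_measure f g) (\<lambda>\<nu>. h \<nu> - h0 \<nu>)"
    and "opt_mse (- T) A f g = mse A h0 f g"
    and "error_expr T b f g = mse A h0 f g"
proof -
  let ?M = "spectral_measure f g" and ?C = "C_fun T b f g"
  have Am: "A \<in> borel_measurable lebesgue" unfolding A_def by (rule signal_measurable)
  have Abd: "cmod (A \<nu>) \<le> (LINT u|lebesgue. cmod (b u))" for \<nu> unfolding A_def by (rule signal_bounded)
  note Ab = Am Abd
  have h0_eq: "h0 = (\<lambda>\<nu>. signal_part \<nu> - noise_part \<nu>)" by (simp add: h0_def signal_part_def noise_part_def)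
  show h0: "h0 \<in> L2s (- T) f g" unfolding h0_eq by (rule signal_minus_noise_L2s)
  then have h0L: "h0 \<in> L2 ?M" by (simp add: L2s_alt)
  have sd: "(\<lambda>\<nu>. A \<nu> * of_real (f \<nu> / (f \<nu> + g \<nu>)) - h0 \<nu>) = noise_part"
    by (auto simp: h0_eq A_def signal_part_def)
  have sd': "(\<lambda>\<nu>. h0 \<nu> - A \<nu> * of_real (f \<nu> / (f \<nu> + g \<nu>))) = (\<lambda>\<nu>. - 1 * noise_part \<nu>)"
    by (auto simp: h0_eq A_def signal_part_def)
  have dec: "mse A h f g = mse A h0 f g + 1 / (2 * pi) * L2_sq ?M (\<lambda>\<nu>. h \<nu> - h0 \<nu>)" if "h \<in> L2s (- T) f g" for h
    by (rule mse_projection[OF f g Ab h0 _ that]) (unfold sd, rule noise_part_orthogonal)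
  then show "h \<in> L2s (- T) f g \<Longrightarrow> mse A h f g = mse A h0 f g + 1 / (2 * pi) * L2_sq ?M (\<lambda>\<nu>. h \<nu> - h0 \<nu>)" .
  note opt = opt_char_optimal[OF f g Ab, where U = "- T"]
  have "mse A h0 f g \<le> opt_mse (- T) A f g"
    unfolding opt_mse_def using dec[OF opt(1)] L2_sq_nonneg[of ?M "\<lambda>\<nu>. opt_char (- T) A f g \<nu> - h0 \<nu>"] by simp
  then show "opt_mse (- T) A f g = mse A h0 f g" using opt(2)[OF h0] by (rule order_antisym[rotated])
  have "L2_inner T (R_op T f g b) (B_inv T f g (R_op T f g b)) = 1 / (2 * pi) * L2_ip lebesgue signal_part ?C"
    unfolding C_fun_def by (rule R_op_inner) (rule B_domainD(1)[OF f g density_pos T x0_domain])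
  also have "L2_ip lebesgue signal_part ?C = of_real (L2_sq lebesgue (weighted f g ?C))"
    using C_fun_inner[OF x0_domain] unfolding C_fun_def[symmetric] L2_ip_self by simp
  finally have "error_expr T b f g = Re (of_real (1 / (2 * pi) * L2_sq lebesgue (weighted f g ?C))
      + of_real (1 / (2 * pi) * (LINT \<nu>|lebesgue. (cmod (A \<nu>))\<^sup>2 * (f \<nu> * g \<nu> / (f \<nu> + g \<nu>)))))"
    unfolding error_expr_def Q_op_inner A_def by simp
  also have "\<dots> = mse A h0 f g"
    unfolding mse_decomposition(1)[OF f g Ab h0L] sd' L2_sq_scale noise_part_L2(2) by (simp add: distrib_left)
  finally show "error_expr T b f g = mse A h0 f g" .
qed

end

section \<open>The saddle point\<close>

text \<open>The same \<gamma> serves for the larger density, since its quotient grows by at most the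
  factor \<open>c\<close>; where the smaller density vanishes and \<gamma> does not, the bound is
  infinite.\<close>

lemma minimality_mono:
  assumes min: "minimality f g" and c: "0 < c"
    and f: "spectral_density f" and g: "spectral_density g" and le: "\<And>\<nu>. f \<nu> + g \<nu> \<le> c * (f' \<nu> + g' \<nu>)"
  shows "minimality f' g'"
proof -
  obtain \<gamma> \<alpha> where \<gamma>: "exponential_type \<gamma>" "set_integrable lebesgue {0..} \<alpha>"
    "\<forall>\<nu>::real. \<gamma> (of_real \<nu>) = (LINT t:{0..}|lebesgue. \<alpha> t * cis (t * \<nu>))" "\<exists>\<nu>::real. \<gamma> (of_real \<nu>) \<noteq> 0"
    and fin: "(\<integral>\<^sup>+ \<nu>. ennreal ((cmod (\<gamma> (of_real \<nu>)))\<^sup>2) / ennreal (f \<nu> + g \<nu>) \<partial>lebesgue) < \<infinity>"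
    using min unfolding minimality_def by blast
  have "continuous_on UNIV \<gamma>" using \<gamma>(1) by (auto simp: exponential_type_def intro: holomorphic_on_imp_continuous_on)
  then have "continuous_on UNIV (\<lambda>\<nu>::real. \<gamma> (of_real \<nu>))"
    by (rule continuous_on_compose2) (auto intro!: continuous_intros)
  then have [measurable]: "(\<lambda>\<nu>::real. \<gamma> (of_real \<nu>)) \<in> borel_measurable lebesgue"
    by (intro measurable_completion) (simp add: borel_measurable_continuous_onI)
  note [measurable] = spectral_densityD(3)[OF f] spectral_densityD(3)[OF g]
  note nn = density_sum_nonneg[OF f g]
  have "ennreal x / ennreal p' \<le> ennreal c * (ennreal x / ennreal p)"
    if "0 \<le> x" "0 \<le> p" "p \<le> c * p'" for x p p' :: real
  proof (cases "x = 0")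
    case False
    with that have x: "0 < x" by simp
    show ?thesis
    proof (cases "p = 0")
      case True
      then show ?thesis using x c by (simp add: ennreal_divide_eq_top_iff ennreal_mult_eq_top_iff)
    next
      case False
      with that have p: "0 < p" by simp
      with that(3) have "0 < c * p'" by linarith
      then have p': "0 < p'" using c by (simp add: zero_less_mult_iff)
      have "x * p \<le> x * (c * p')" using that(3) x by (intro mult_left_mono) auto
      then have "x / p' \<le> c * (x / p)" using p p' by (simp add: field_simps)
      then show ?thesis using x p p' c by (simp add: divide_ennreal ennreal_leI flip: ennreal_mult)
    qed
  qed simp
  then have "(\<integral>\<^sup>+ \<nu>. ennreal ((cmod (\<gamma> (of_real \<nu>)))\<^sup>2) / ennreal (f' \<nu> + g' \<nu>) \<partial>lebesgue)
      \<le> (\<integral>\<^sup>+ \<nu>. ennreal c * (ennreal ((cmod (\<gamma> (of_real \<nu>)))\<^sup>2) / ennreal (f \<nu> + g \<nu>)) \<partial>lebesgue)"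
    by (intro nn_integral_mono) (use nn le in auto)
  also have "\<dots> = ennreal c * (\<integral>\<^sup>+ \<nu>. ennreal ((cmod (\<gamma> (of_real \<nu>)))\<^sup>2) / ennreal (f \<nu> + g \<nu>) \<partial>lebesgue)"
    by (rule nn_integral_cmult) measurable
  also have "\<dots> < \<infinity>" using fin by (simp add: ennreal_mult_less_top)
  finally show ?thesis unfolding minimality_def using \<gamma> by blast
qed

lemma spectral_density_convex:
  assumes "spectral_density f" "spectral_density g" "0 \<le> t" "t \<le> (1::real)"
  shows "spectral_density (\<lambda>\<nu>. (1 - t) * f \<nu> + t * g \<nu>)"
  using assms by (auto simp: spectral_density_def)

lemma mse_nonneg:
  assumes "spectral_density f" "spectral_density g"
  shows "0 \<le> mse A h f g"
  unfolding mse_def using assms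
  by (intro add_nonneg_nonneg mult_nonneg_nonneg integral_nonneg_AE AE_I2) (auto simp: spectral_density_def)

text \<open>For a fixed characteristic the error is linear in the pair; square integrability for
  both pairs is what lets the integrals be split.\<close>

lemma mse_convex:
  assumes "spectral_density f0" "spectral_density g0" "spectral_density f" "spectral_density g"
    and A: "A \<in> borel_measurable lebesgue" "\<And>\<nu>. cmod (A \<nu>) \<le> cA"
    and h: "h \<in> L2 (spectral_measure f0 g0)" "h \<in> L2 (spectral_measure f g)"
  shows "mse A h (\<lambda>\<nu>. (1 - t) * f0 \<nu> + t * f \<nu>) (\<lambda>\<nu>. (1 - t) * g0 \<nu> + t * g \<nu>)
       = (1 - t) * mse A h f0 g0 + t * mse A h f g"
proof -
  note i0 = mse_integrable[OF assms(1,2) A h(1)] and i1 = mse_integrable[OF assms(3,4) A h(2)]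
  have lin: "(LINT \<nu>|lebesgue. w \<nu> * ((1 - t) * u \<nu> + t * v \<nu>)) = (1 - t) * (LINT \<nu>|lebesgue. w \<nu> * u \<nu>) + t * (LINT \<nu>|lebesgue. w \<nu> * v \<nu>)"
    if "integrable lebesgue (\<lambda>\<nu>. w \<nu> * u \<nu>)" "integrable lebesgue (\<lambda>\<nu>. w \<nu> * v \<nu>)" for w u v :: "real \<Rightarrow> real"
  proof -
    have "(\<lambda>\<nu>. w \<nu> * ((1 - t) * u \<nu> + t * v \<nu>)) = (\<lambda>\<nu>. (1 - t) * (w \<nu> * u \<nu>) + t * (w \<nu> * v \<nu>))"
      by (auto simp: algebra_simps)
    then show ?thesis using that by simp
  qed
  show ?thesis unfolding mse_def lin[OF i0(1) i1(1)] lin[OF i0(2) i1(2)]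
    by (simp add: algebra_simps add_divide_distrib diff_divide_distrib)
qed

text \<open>\<open>dec\<close> is the quadratic growth of the error at the first pair, and
  \<open>opt\<close> is optimality along the segment to the second. The characteristics of the
  mixtures stand in for \<open>h0\<close>, whose error at the second pair is not known to be finite
  beforehand.\<close>

lemma saddle_point:
  fixes f0 g0 f g :: "real \<Rightarrow> real"
  assumes d0: "spectral_density f0" "spectral_density g0" and d: "spectral_density f" "spectral_density g"
    and A: "A \<in> borel_measurable lebesgue" "\<And>\<nu>. cmod (A \<nu>) \<le> cA"
    and pos: "AE \<nu> in lebesgue. 0 < f0 \<nu> + g0 \<nu>"
    and h0: "h0 \<in> L2s U f0 g0"
    and dec: "\<And>h. h \<in> L2s U f0 g0 \<Longrightarrow>
      mse A h f0 g0 = mse A h0 f0 g0 + 1 / (2 * pi) * L2_sq (spectral_measure f0 g0) (\<lambda>\<nu>. h \<nu> - h0 \<nu>)"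
    and opt: "\<And>t. 0 < t \<Longrightarrow> t < 1 \<Longrightarrow>
      opt_mse U A (\<lambda>\<nu>. (1 - t) * f0 \<nu> + t * f \<nu>) (\<lambda>\<nu>. (1 - t) * g0 \<nu> + t * g \<nu>) \<le> mse A h0 f0 g0"
  shows "h0 \<in> L2s U f g" and "mse A h0 f g \<le> mse A h0 f0 g0"
proof -
  let ?W = "spectral_measure f0 g0" and ?M = "spectral_measure f g"
  define V where "V = mse A h0 f0 g0"
  define z where "z \<nu> = A \<nu> * of_real (f \<nu> / (f \<nu> + g \<nu>))" for \<nu>
  define Q where "Q = (LINT \<nu>|lebesgue. (cmod (A \<nu>))\<^sup>2 * (f \<nu> * g \<nu> / (f \<nu> + g \<nu>)))"
  have z: "z \<in> L2 ?M" unfolding z_def[abs_def] by (rule signal_part_L2[OF d A])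
  \<comment> \<open>The double successor keeps \<open>t n\<close> at most 1/2, so
    \<open>1 - t n\<close> can be bounded below by a constant.\<close>
  define t where "t n = inverse (real (Suc (Suc n)))" for n
  have t: "0 < t n" "t n < 1" "1 / 2 \<le> 1 - t n" for n by (auto simp: t_def field_simps)
  define F G where "F n \<nu> = (1 - t n) * f0 \<nu> + t n * f \<nu>" and "G n \<nu> = (1 - t n) * g0 \<nu> + t n * g \<nu>" for n \<nu>
  have FG: "spectral_density (F n)" "spectral_density (G n)" for n
    unfolding F_def[abs_def] G_def[abs_def] using t(1,2)[of n] by (auto intro!: spectral_density_convex d0 d)
  define h where "h n = opt_char U A (F n) (G n)" for n
  have h: "h n \<in> L2s U (F n) (G n)" for n unfolding h_def by (rule opt_char_optimal(1)[OF FG A])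
  note nn = density_sum_nonneg[OF d0] density_sum_nonneg[OF d]
  have dom0: "f0 \<nu> + g0 \<nu> \<le> 1 / (1 - t n) * (F n \<nu> + G n \<nu>)" for n \<nu>
  proof -
    have "(1 - t n) * (f0 \<nu> + g0 \<nu>) \<le> F n \<nu> + G n \<nu>"
      using mult_nonneg_nonneg[of "t n" "f \<nu> + g \<nu>"] nn(2)[of \<nu>] t(1)[of n] by (simp add: F_def G_def algebra_simps)
    then show ?thesis using t(2)[of n] by (simp add: field_simps)
  qed
  have dom1: "f \<nu> + g \<nu> \<le> 1 / t n * (F n \<nu> + G n \<nu>)" for n \<nu>
  proof -
    have "t n * (f \<nu> + g \<nu>) \<le> F n \<nu> + G n \<nu>"
      using mult_nonneg_nonneg[of "1 - t n" "f0 \<nu> + g0 \<nu>"] nn(1)[of \<nu>] t(2)[of n] by (simp add: F_def G_def algebra_simps)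
    then show ?thesis using t(1)[of n] by (simp add: field_simps)
  qed
  have hs0: "h n \<in> L2s U f0 g0" for n
    by (rule spectral_dominated(3)[OF d0 FG _ dom0 h]) (use t(2)[of n] in simp)
  have hs: "h n \<in> L2s U f g" for n
    by (rule spectral_dominated(3)[OF d FG _ dom1 h]) (use t(1)[of n] in simp)
  have hL0: "h n \<in> L2 ?W" and hL: "h n \<in> L2 ?M" and h0L: "h0 \<in> L2 ?W" for n
    using hs0[of n] hs[of n] h0 by (auto simp: L2s_alt)
  define e where "e n = L2_sq ?W (\<lambda>\<nu>. h n \<nu> - h0 \<nu>)" for n
  have V0: "0 \<le> V" unfolding V_def by (rule mse_nonneg[OF d0])
  have main: "(1 - t n) * (1 / (2 * pi) * e n) + t n * mse A (h n) f g \<le> t n * V" for n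
  proof -
    have "mse A (h n) (F n) (G n) \<le> V"
      using opt[OF t(1,2)[of n]] by (simp add: opt_mse_def h_def F_def[abs_def] G_def[abs_def] V_def)
    moreover have "mse A (h n) (F n) (G n) = (1 - t n) * mse A (h n) f0 g0 + t n * mse A (h n) f g"
      unfolding F_def[abs_def] G_def[abs_def] by (rule mse_convex[OF d0 d A hL0 hL])
    moreover have "mse A (h n) f0 g0 = V + 1 / (2 * pi) * e n"
      unfolding V_def e_def by (rule dec[OF hs0])
    ultimately show ?thesis by (simp add: algebra_simps)
  qed
  have mse_le: "mse A (h n) f g \<le> V" for n
  proof -
    have "0 \<le> (1 - t n) * (1 / (2 * pi) * e n)" using t(2)[of n] by (simp add: e_def)
    with main[of n] have "t n * mse A (h n) f g \<le> t n * V" by linarith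
    then show ?thesis using t(1)[of n] by simp
  qed
  \<comment> \<open>The constant \<open>4 * pi\<close> undoes the factor \<open>1 / (2 * pi)\<close>
    of the error and the lower bound 1/2 for \<open>1 - t n\<close>.\<close>
  have e_le: "e n \<le> 4 * pi * V * t n" for n
  proof -
    have "0 \<le> t n * mse A (h n) f g" using t(1)[of n] mse_nonneg[OF d] by (intro mult_nonneg_nonneg) auto
    with main[of n] have "(1 - t n) * (1 / (2 * pi) * e n) \<le> t n * V" by linarith
    moreover have "1 / 2 * (1 / (2 * pi) * e n) \<le> (1 - t n) * (1 / (2 * pi) * e n)"
      using t(3)[of n] by (intro mult_right_mono) (auto simp: e_def)
    ultimately have "1 / 2 * (1 / (2 * pi) * e n) \<le> t n * V" by linarith
    then show ?thesis by (simp add: field_simps)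
  qed
  have "e \<longlonglongrightarrow> 0"
  proof (rule tendsto_sandwich[where f = "\<lambda>_. 0"])
    have "t \<longlonglongrightarrow> 0"
      unfolding t_def by (rule LIMSEQ_Suc[OF LIMSEQ_inverse_real_of_nat])
    then have "(\<lambda>n. 4 * pi * V * t n) \<longlonglongrightarrow> 4 * pi * V * 0" by (intro tendsto_intros)
    then show "(\<lambda>n. 4 * pi * V * t n) \<longlonglongrightarrow> 0" by simp
  qed (use e_le in \<open>auto simp: e_def\<close>)
  moreover have "integrable ?W (\<lambda>\<nu>. (cmod (h n \<nu> - h0 \<nu>))\<^sup>2)" for n by (rule L2_integrable[OF L2_diff[OF hL0 h0L]])
  ultimately obtain r where r: "strict_mono r" and ae0: "AE \<nu> in ?W. (\<lambda>n. (cmod (h (r n) \<nu> - h0 \<nu>))\<^sup>2) \<longlonglongrightarrow> 0"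
    using tendsto_L1_AE_subseq[of ?W "\<lambda>n \<nu>. (cmod (h n \<nu> - h0 \<nu>))\<^sup>2"] by (auto simp: e_def[abs_def] L2_sq_def)
  \<comment> \<open>Convergence in the mean gives a subsequence that converges almost everywhere for
    the weight \<open>f0 + g0\<close>; positivity of this weight removes it, and the limit then
    holds for any other density.\<close>
  have "AE \<nu> in lebesgue. 0 < ennreal (f0 \<nu> + g0 \<nu>) \<longrightarrow> (\<lambda>n. (cmod (h (r n) \<nu> - h0 \<nu>))\<^sup>2) \<longlonglongrightarrow> 0"
    using ae0 density_sum_measurable[OF d0] unfolding spectral_measure_def by (subst (asm) AE_density) auto
  with pos have aeL: "AE \<nu> in lebesgue. (\<lambda>n. h (r n) \<nu>) \<longlonglongrightarrow> h0 \<nu>"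
  proof eventually_elim
    case (elim \<nu>)
    then have "(\<lambda>n. (cmod (h (r n) \<nu> - h0 \<nu>))\<^sup>2) \<longlonglongrightarrow> 0" by simp
    then have "(\<lambda>n. sqrt ((cmod (h (r n) \<nu> - h0 \<nu>))\<^sup>2)) \<longlonglongrightarrow> sqrt 0" by (rule tendsto_real_sqrt)
    then have "(\<lambda>n. h (r n) \<nu> - h0 \<nu>) \<longlonglongrightarrow> 0" by (simp add: tendsto_norm_zero_iff)
    then show ?case by (rule LIM_zero_cancel)
  qed
  then have ae: "AE \<nu> in ?M. (\<lambda>n. h (r n) \<nu>) \<longlonglongrightarrow> h0 \<nu>"
    unfolding spectral_measure_def using density_sum_measurable[OF d] by (subst AE_density) (auto elim: eventually_mono)
  \<comment> \<open>Subtracting the unconstrained optimum \<open>z\<close> turns the error bound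
    into a norm bound in the second space.\<close>
  have bound: "L2_sq ?M (\<lambda>\<nu>. h n \<nu> - z \<nu>) \<le> 2 * pi * V - Q" for n
  proof -
    have "1 / (2 * pi) * (L2_sq ?M (\<lambda>\<nu>. h n \<nu> - z \<nu>) + Q) \<le> V"
      using mse_le[of n] unfolding mse_decomposition(1)[OF d A hL] z_def Q_def .
    then have "2 * pi * (1 / (2 * pi) * (L2_sq ?M (\<lambda>\<nu>. h n \<nu> - z \<nu>) + Q)) \<le> 2 * pi * V"
      by (intro mult_left_mono) auto
    then show ?thesis by simp
  qed
  have h0m: "h0 \<in> borel_measurable ?M" using h0L by (simp add: L2_spectral_iff[OF d0])
  have zm: "z \<in> borel_measurable ?M" using z by (rule L2_measurable)
  have lim: "AE \<nu> in ?M. (\<lambda>n. h (r n) \<nu> - z \<nu>) \<longlonglongrightarrow> h0 \<nu> - z \<nu>"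
    using ae by eventually_elim (intro tendsto_intros)
  have m: "(\<lambda>\<nu>. h0 \<nu> - z \<nu>) \<in> borel_measurable ?M" using h0m zm by (rule borel_measurable_diff)
  have ev: "eventually (\<lambda>n. L2_sq ?M (\<lambda>\<nu>. h (r n) \<nu> - z \<nu>) \<le> 2 * pi * V - Q) sequentially"
    using bound by simp
  note fat = L2_Fatou[OF L2_diff[OF hL z] m lim ev]
  have h0M: "h0 \<in> L2 ?M" using L2_add[OF fat(1) z] by simp
  have "mse A h0 f g = 1 / (2 * pi) * (L2_sq ?M (\<lambda>\<nu>. h0 \<nu> - z \<nu>) + Q)"
    unfolding mse_decomposition(1)[OF d A h0M] z_def Q_def ..
  also have "\<dots> \<le> 1 / (2 * pi) * (2 * pi * V)" using fat(2) by (intro mult_left_mono) auto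
  finally show "mse A h0 f g \<le> mse A h0 f0 g0" by (simp add: V_def)
  show "h0 \<in> L2s U f g"
  proof (rule L2_double_orthogonal[OF L2s_subspace[OF d] L2s_closed[OF d] h0M])
    fix k assume k: "k \<in> L2 ?M" and orth: "\<And>x. x \<in> L2s U f g \<Longrightarrow> L2_ip ?M k x = 0"
    show "L2_ip ?M h0 k = 0"
    proof (rule L2_weak_limit_orthogonal[OF hL h0M k ae])
      show "L2_sq ?M (\<lambda>\<nu>. h (r n) \<nu> - h0 \<nu>) \<le> 2 * (2 * pi * V - Q) + 2 * L2_sq ?M (\<lambda>\<nu>. z \<nu> - h0 \<nu>)" for n
        by (rule order_trans[OF L2_sq_two_step[OF hL z h0M]]) (intro add_right_mono mult_left_mono bound, simp)
      show "L2_ip ?M (h (r n)) k = 0" for n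
        using orth[OF hs[of "r n"]] L2_ip_commute[of ?M "h (r n)" k] by simp
    qed
  qed
qed

section \<open>Convexity of the uncertainty classes and the theorem\<close>

lemma D_contamD:
  assumes "f \<in> D_contam e1 f1 P1" "spectral_density f1" "0 < e1" "e1 < 1"
  shows "spectral_density f"
proof -
  obtain w where w: "spectral_density w" "\<forall>\<nu>. f \<nu> = (1 - e1) * f1 \<nu> + e1 * w \<nu>"
    using assms(1) unfolding D_contam_def by blast
  have "f = (\<lambda>\<nu>. (1 - e1) * f1 \<nu> + e1 * w \<nu>)" by (rule ext) (rule w(2)[rule_format])
  then show ?thesis using spectral_density_convex[OF assms(2) w(1), of e1] assms(3,4) by (simp only: less_imp_le)
qed

lemma D_contam_convex:
  assumes f0: "f0 \<in> D_contam e1 f1 P1" and f: "f \<in> D_contam e1 f1 P1"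
    and f1: "spectral_density f1" and e1: "0 < e1" "e1 < 1" and t: "0 \<le> t" "t \<le> 1"
  shows "(\<lambda>\<nu>. (1 - t) * f0 \<nu> + t * f \<nu>) \<in> D_contam e1 f1 P1"
proof -
  obtain w0 where w0: "spectral_density w0" "\<forall>\<nu>. f0 \<nu> = (1 - e1) * f1 \<nu> + e1 * w0 \<nu>"
    and P0: "1 / (2 * pi) * (LINT \<nu>|lebesgue. f0 \<nu>) \<le> P1" using f0 unfolding D_contam_def by blast
  obtain w where w: "spectral_density w" "\<forall>\<nu>. f \<nu> = (1 - e1) * f1 \<nu> + e1 * w \<nu>"
    and P: "1 / (2 * pi) * (LINT \<nu>|lebesgue. f \<nu>) \<le> P1" using f unfolding D_contam_def by blast
  have i: "integrable lebesgue f0" "integrable lebesgue f"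
    using D_contamD[OF f0 f1 e1] D_contamD[OF f f1 e1] by (auto simp: spectral_density_def)
  have "1 / (2 * pi) * (LINT \<nu>|lebesgue. (1 - t) * f0 \<nu> + t * f \<nu>)
      = (1 - t) * (1 / (2 * pi) * (LINT \<nu>|lebesgue. f0 \<nu>)) + t * (1 / (2 * pi) * (LINT \<nu>|lebesgue. f \<nu>))"
    using i by (simp add: algebra_simps add_divide_distrib diff_divide_distrib)
  also have "\<dots> \<le> (1 - t) * P1 + t * P1" using t P0 P by (intro add_mono mult_left_mono) auto
  also have "\<dots> = P1" by (simp add: algebra_simps)
  finally have "1 / (2 * pi) * (LINT \<nu>|lebesgue. (1 - t) * f0 \<nu> + t * f \<nu>) \<le> P1" .
  moreover have "(1 - t) * f0 \<nu> + t * f \<nu> = (1 - e1) * f1 \<nu> + e1 * ((1 - t) * w0 \<nu> + t * w \<nu>)" for \<nu>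
    unfolding w0(2)[rule_format, of \<nu>] w(2)[rule_format, of \<nu>] by (simp add: algebra_simps)
  ultimately show ?thesis
    unfolding D_contam_def
    by (intro CollectI conjI exI[of _ "\<lambda>\<nu>. (1 - t) * w0 \<nu> + t * w \<nu>"] allI spectral_density_convex w0(1) w(1) t)
qed

lemma D_L1_ball_convex:
  assumes g0: "g0 \<in> D_L1_ball e2 g1" and g: "g \<in> D_L1_ball e2 g1"
    and g1: "spectral_density g1" and t: "0 \<le> t" "t \<le> 1"
  shows "(\<lambda>\<nu>. (1 - t) * g0 \<nu> + t * g \<nu>) \<in> D_L1_ball e2 g1"
proof -
  have d: "spectral_density g0" "spectral_density g"
    and e: "1 / (2 * pi) * (LINT \<nu>|lebesgue. \<bar>g0 \<nu> - g1 \<nu>\<bar>) \<le> e2" "1 / (2 * pi) * (LINT \<nu>|lebesgue. \<bar>g \<nu> - g1 \<nu>\<bar>) \<le> e2"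
    using g0 g by (auto simp: D_L1_ball_def)
  have i: "integrable lebesgue g0" "integrable lebesgue g" "integrable lebesgue g1"
    using d g1 by (auto simp: spectral_density_def)
  have "(LINT \<nu>|lebesgue. \<bar>(1 - t) * g0 \<nu> + t * g \<nu> - g1 \<nu>\<bar>)
      \<le> (LINT \<nu>|lebesgue. (1 - t) * \<bar>g0 \<nu> - g1 \<nu>\<bar> + t * \<bar>g \<nu> - g1 \<nu>\<bar>)"
  proof (rule integral_mono)
    fix \<nu>
    have "(1 - t) * g0 \<nu> + t * g \<nu> - g1 \<nu> = (1 - t) * (g0 \<nu> - g1 \<nu>) + t * (g \<nu> - g1 \<nu>)"
      by (simp add: algebra_simps)
    then have "\<bar>(1 - t) * g0 \<nu> + t * g \<nu> - g1 \<nu>\<bar> \<le> \<bar>(1 - t) * (g0 \<nu> - g1 \<nu>)\<bar> + \<bar>t * (g \<nu> - g1 \<nu>)\<bar>"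
      by (simp only: abs_triangle_ineq)
    then show "\<bar>(1 - t) * g0 \<nu> + t * g \<nu> - g1 \<nu>\<bar> \<le> (1 - t) * \<bar>g0 \<nu> - g1 \<nu>\<bar> + t * \<bar>g \<nu> - g1 \<nu>\<bar>"
      using t by (simp add: abs_mult)
  qed (use i in auto)
  then have "1 / (2 * pi) * (LINT \<nu>|lebesgue. \<bar>(1 - t) * g0 \<nu> + t * g \<nu> - g1 \<nu>\<bar>)
      \<le> 1 / (2 * pi) * (LINT \<nu>|lebesgue. (1 - t) * \<bar>g0 \<nu> - g1 \<nu>\<bar> + t * \<bar>g \<nu> - g1 \<nu>\<bar>)"
    by (rule mult_left_mono) simp
  also have "\<dots> = (1 - t) * (1 / (2 * pi) * (LINT \<nu>|lebesgue. \<bar>g0 \<nu> - g1 \<nu>\<bar>)) + t * (1 / (2 * pi) * (LINT \<nu>|lebesgue. \<bar>g \<nu> - g1 \<nu>\<bar>))"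
    using i by (simp add: algebra_simps add_divide_distrib diff_divide_distrib)
  also have "\<dots> \<le> (1 - t) * e2 + t * e2" using t e by (intro add_mono mult_left_mono) auto
  also have "\<dots> = e2" by (simp add: algebra_simps)
  finally show ?thesis using spectral_density_convex[OF d t] by (simp add: D_L1_ball_def)
qed

lemma T_set_facts:
  shows "closed (T_set s N K)" "T_set s N K \<in> sets lebesgue" "{0..} \<subseteq> T_set s N K" "obs_set s N K = - T_set s N K"
proof -
  show "closed (T_set s N K)" unfolding T_set_def S_set_def by (intro closed_Un closed_UN) auto
  then show "T_set s N K \<in> sets lebesgue" by (intro sets_completionI_sets) simp
qed (auto simp: T_set_def obs_set_def)

theorem theorem5p1:
  fixes s :: nat and N K :: "nat \<Rightarrow> real" and a :: "real \<Rightarrow> complex"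
    and f1 g1 f0 g0 \<phi> \<Psi> :: "real \<Rightarrow> real"
    and \<epsilon>1 \<epsilon>2 P1 \<alpha>1 \<alpha>2 :: real
  defines "T \<equiv> T_set s N K"
    and "Rs \<equiv> R_set s N K"
    and "Obs \<equiv> obs_set s N K"
    and "A \<equiv> A_fun (R_set s N K) a"
    and "b \<equiv> bold_a (R_set s N K) a"
    and "C0 \<equiv> C_fun (T_set s N K) (bold_a (R_set s N K) a) f0 g0"
    and "Df \<equiv> D_contam \<epsilon>1 f1 P1"
    and "Dg \<equiv> D_L1_ball \<epsilon>2 g1"
  assumes gaps: "gap_structure s N K"
    and a_L1: "set_integrable lebesgue Rs a"
    and a_weighted: "set_integrable lebesgue Rs (\<lambda>t. t * (cmod (a t))\<^sup>2)"
    and a_L2: "b \<in> L2 (lebesgue_on T)"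
    and f1: "spectral_density f1" and g1: "spectral_density g1"
    and eps1: "0 < \<epsilon>1" "\<epsilon>1 < 1" and eps2: "0 < \<epsilon>2" and P1: "0 < P1"
    and f0: "f0 \<in> Df" and g0: "g0 \<in> Dg"
    and minimal: "minimality f0 g0"
    and invertible: "B_invertible T f0 g0"
    and hf_bounded: "\<exists>c. AE \<nu> in lebesgue.
      (cmod (A \<nu> * of_real (g0 \<nu>) + C0 \<nu>))\<^sup>2 / (f0 \<nu> + g0 \<nu>)\<^sup>2 \<le> c"
    and hg_bounded: "\<exists>c. AE \<nu> in lebesgue.
      (cmod (A \<nu> * of_real (f0 \<nu>) - C0 \<nu>))\<^sup>2 / (f0 \<nu> + g0 \<nu>)\<^sup>2 \<le> c"
    and alpha1: "\<alpha>1 \<noteq> 0"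
    and eq_f: "AE \<nu> in lebesgue.
      cmod (A \<nu> * of_real (g0 \<nu>) + C0 \<nu>) = (f0 \<nu> + g0 \<nu>) * (\<phi> \<nu> + inverse \<alpha>1)"
    and eq_g: "AE \<nu> in lebesgue.
      cmod (A \<nu> * of_real (f0 \<nu>) - C0 \<nu>) = (f0 \<nu> + g0 \<nu>) * \<Psi> \<nu> * \<alpha>2"
    and phi: "AE \<nu> in lebesgue. \<phi> \<nu> \<le> 0 \<and> (f0 \<nu> > (1 - \<epsilon>1) * f1 \<nu> \<longrightarrow> \<phi> \<nu> = 0)"
    and Psi: "AE \<nu> in lebesgue. \<bar>\<Psi> \<nu>\<bar> \<le> 1 \<and> (g0 \<nu> \<noteq> g1 \<nu> \<longrightarrow> \<Psi> \<nu> = sgn (g0 \<nu> - g1 \<nu>))"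
    and optimal: "\<forall>(f, g)\<in>Df \<times> Dg. objective T Obs A b f g \<le> error_expr T b f0 g0"
  shows "least_favorable Obs A (Df \<times> Dg) f0 g0 \<and>
    minimax_robust Obs A (Df \<times> Dg)
      (\<lambda>\<nu>. A \<nu> * of_real (f0 \<nu> / (f0 \<nu> + g0 \<nu>)) - C0 \<nu> / of_real (f0 \<nu> + g0 \<nu>))"
proof -
  note T = T_set_facts[of s N K, folded T_def]
  have Obs: "Obs = - T" using T(4) by (simp add: Obs_def)
  have off: "b u = 0" if "u \<notin> T" for u
    using that T(3) by (auto simp: b_def bold_a_def R_set_def)
  have "b = (\<lambda>t. indicator Rs t *\<^sub>R a t)" by (auto simp: b_def bold_a_def Rs_def indicator_def)
  then have b1: "integrable lebesgue b" using a_L1 by (simp add: set_integrable_def)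
  have "ext0 T b = b" using off by (auto simp: ext0_def)
  then have b2: "b \<in> L2 lebesgue" using a_L2 unfolding L2_lebesgue_on_iff[OF T(2)] by simp
  have A: "A = (\<lambda>\<nu>. fourier_int b (- \<nu>))"
    unfolding A_def A_fun_def[abs_def] fourier_int_def set_lebesgue_integral_def b_def bold_a_def
    by (intro ext Bochner_Integration.integral_cong) (auto simp: indicator_def)
  have d0: "spectral_density f0" "spectral_density g0"
    using D_contamD[OF f0[unfolded Df_def] f1 eps1] g0 by (auto simp: Dg_def D_L1_ball_def)
  define h0 where "h0 \<nu> = A \<nu> * of_real (f0 \<nu> / (f0 \<nu> + g0 \<nu>)) - C0 \<nu> / of_real (f0 \<nu> + g0 \<nu>)" for \<nu>
  have h0_eq: "h0 = (\<lambda>\<nu>. fourier_int b (- \<nu>) * of_real (f0 \<nu> / (f0 \<nu> + g0 \<nu>)) - C_fun T b f0 g0 \<nu> / of_real (f0 \<nu> + g0 \<nu>))"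
    by (simp add: h0_def A C0_def T_def b_def fun_eq_iff)
  note invertible_optimal_0 = invertible_optimal[OF d0 minimal invertible T(2,1,3) b1 b2 off]
  have inv1: "h0 \<in> L2s Obs f0 g0"
    unfolding h0_eq Obs by (rule invertible_optimal_0(1))
  have inv2: "mse A h f0 g0 = mse A h0 f0 g0 + 1 / (2 * pi) * L2_sq (spectral_measure f0 g0) (\<lambda>\<nu>. h \<nu> - h0 \<nu>)"
    if "h \<in> L2s Obs f0 g0" for h
    unfolding h0_eq A by (rule invertible_optimal_0(2)[OF _ that[unfolded Obs]])
  have inv3: "opt_mse Obs A f0 g0 = mse A h0 f0 g0"
    unfolding h0_eq Obs A by (rule invertible_optimal_0(3))
  have inv4: "error_expr T b f0 g0 = mse A h0 f0 g0"
    unfolding h0_eq A by (rule invertible_optimal_0(4))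
  have Am: "A \<in> borel_measurable lebesgue" unfolding A by (rule signal_measurable[OF d0 minimal invertible T(2,1,3) b1 b2 off])
  have Ab: "cmod (A \<nu>) \<le> (LINT u|lebesgue. cmod (b u))" for \<nu> unfolding A by (rule fourier_int_bound)
  define V where "V = mse A h0 f0 g0"
  have saddle: "h0 \<in> L2s Obs f g \<and> mse A h0 f g \<le> V" and dfg: "spectral_density f" "spectral_density g"
    if fg: "f \<in> Df" "g \<in> Dg" for f g
  proof -
    show d: "spectral_density f" "spectral_density g"
      using D_contamD[OF fg(1)[unfolded Df_def] f1 eps1] fg(2) by (auto simp: Dg_def D_L1_ball_def)
    have "opt_mse Obs A (\<lambda>\<nu>. (1 - t) * f0 \<nu> + t * f \<nu>) (\<lambda>\<nu>. (1 - t) * g0 \<nu> + t * g \<nu>) \<le> mse A h0 f0 g0"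
      if t: "0 < t" "t < 1" for t
    proof -
      define F G where "F \<nu> = (1 - t) * f0 \<nu> + t * f \<nu>" and "G \<nu> = (1 - t) * g0 \<nu> + t * g \<nu>" for \<nu>
      have FD: "F \<in> Df" unfolding F_def[abs_def] Df_def
        by (rule D_contam_convex) (use f0 fg t f1 eps1 in \<open>auto simp: Df_def\<close>)
      have GD: "G \<in> Dg" unfolding G_def[abs_def] Dg_def
        by (rule D_L1_ball_convex) (use g0 fg t g1 in \<open>auto simp: Dg_def\<close>)
      have FG: "spectral_density F" "spectral_density G"
        unfolding F_def[abs_def] G_def[abs_def] using t by (auto intro!: spectral_density_convex d0 d)
      \<comment> \<open>The mixture is at least \<open>(1 - t)\<close> times the first pair, so the
        \<gamma> of that pair still works and \<open>invertible_optimal\<close> becomes available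
        here.\<close>
      have minFG: "minimality F G"
      proof (rule minimality_mono[OF minimal _ d0])
        show "0 < 1 / (1 - t)" using t by simp
        show "f0 \<nu> + g0 \<nu> \<le> 1 / (1 - t) * (F \<nu> + G \<nu>)" for \<nu>
        proof -
          have "(1 - t) * (f0 \<nu> + g0 \<nu>) \<le> F \<nu> + G \<nu>"
            using mult_nonneg_nonneg[of t "f \<nu> + g \<nu>"] density_sum_nonneg[OF d, of \<nu>] t by (simp add: F_def G_def algebra_simps)
          then show ?thesis using t by (simp add: field_simps)
        qed
      qed
      \<comment> \<open>If B is invertible for the mixture, the expression equals the optimal error
        by \<open>invertible_optimal\<close>; otherwise this is its stipulated meaning.\<close>
      have "objective T Obs A b F G = opt_mse Obs A F G"
        unfolding objective_def A Obs
        using invertible_optimal(3,4)[OF FG minFG _ T(2,1,3) b1 b2 off] by auto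
      moreover have "objective T Obs A b F G \<le> error_expr T b f0 g0" using optimal FD GD by blast
      ultimately have "opt_mse Obs A F G \<le> mse A h0 f0 g0" using inv4 by simp
      then show ?thesis unfolding F_def[abs_def] G_def[abs_def] .
    qed
    from saddle_point[OF d0 d Am Ab minimality_pos[OF minimal d0] inv1 inv2 this]
    show "h0 \<in> L2s Obs f g \<and> mse A h0 f g \<le> V" by (simp add: V_def)
  qed
  have V: "opt_mse Obs A f0 g0 = V" using inv3 by (simp add: V_def)
  have lf: "least_favorable Obs A (Df \<times> Dg) f0 g0"
    unfolding least_favorable_def
  proof (intro conjI)
    show "(f0, g0) \<in> Df \<times> Dg" using f0 g0 by simp
    show "\<forall>(f, g)\<in>Df \<times> Dg. opt_mse Obs A f g \<le> opt_mse Obs A f0 g0"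
    proof (clarify)
      fix f g assume fg: "f \<in> Df" "g \<in> Dg"
      have "opt_mse Obs A f g \<le> mse A h0 f g"
        by (rule opt_char_optimal(2)[OF dfg[OF fg] Am Ab]) (use saddle[OF fg] in simp)
      also have "\<dots> \<le> opt_mse Obs A f0 g0" using saddle[OF fg] V by simp
      finally show "opt_mse Obs A f g \<le> opt_mse Obs A f0 g0" .
    qed
  qed
  have H0: "h0 \<in> H_class Obs (Df \<times> Dg)" using saddle by (auto simp: H_class_def)
  \<comment> \<open>Every admissible \<open>h\<close> already has error at least \<open>V\<close> at
    the pair \<open>(f0, g0)\<close>, while \<open>h0\<close> has error at most \<open>V\<close> at
    every pair.\<close>
  have "(SUP (f, g)\<in>Df \<times> Dg. ereal (mse A h0 f g)) \<le> (SUP (f, g)\<in>Df \<times> Dg. ereal (mse A h f g))"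
    if h: "h \<in> H_class Obs (Df \<times> Dg)" for h
  proof (rule SUP_least)
    fix x assume x: "x \<in> Df \<times> Dg"
    have "h \<in> L2s Obs f0 g0" using h f0 g0 by (auto simp: H_class_def)
    then have "V \<le> mse A h f0 g0" using opt_char_optimal(2)[OF d0 Am Ab, of h Obs] V by simp
    moreover have "(case x of (f, g) \<Rightarrow> ereal (mse A h0 f g)) \<le> ereal V" using saddle x by auto
    moreover have "ereal (mse A h f0 g0) \<le> (SUP (f, g)\<in>Df \<times> Dg. ereal (mse A h f g))"
      by (rule SUP_upper2[of "(f0, g0)"]) (use f0 g0 in auto)
    ultimately show "(case x of (f, g) \<Rightarrow> ereal (mse A h0 f g)) \<le> (SUP (f, g)\<in>Df \<times> Dg. ereal (mse A h f g))"
      by (meson ereal_less_eq(3) order_trans)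
  qed
  then have "(INF h\<in>H_class Obs (Df \<times> Dg). SUP (f, g)\<in>Df \<times> Dg. ereal (mse A h f g)) = (SUP (f, g)\<in>Df \<times> Dg. ereal (mse A h0 f g))"
    by (intro order_antisym INF_lower[OF H0] INF_greatest)
  then have "minimax_robust Obs A (Df \<times> Dg) h0" using H0 by (simp add: minimax_robust_def)
  with lf show ?thesis by (simp add: h0_def[abs_def])
qed

end
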